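(* In the two-tier cache-enabled network model described in the context, the successful access delivery probability $C^w_{Lp,1}$, i.e. the probability that a tagged user requesting a content of the second (less popular) group connects to the macro base station tier and has wireless access rate $R^w_{Lp,1}\ge R_0$, is $$C^w_{Lp,1}=\int_0^\infty\sum_{l_1=0}^\infty2\pi\lambda_1z\,\exp\!\left(-z^\alpha P_1^{-1}\delta_1\sigma^2\right)\exp\!\left(-\pi\lambda_1z^2\big(\xi_1G(\delta_1,\alpha)+\varsigma_1H(\delta_1,\alpha)+\zeta_1\big)\right)P_{L_1}(l_1+1)\,dz,$$ where $\delta_1=2^{(l_1+1)R_0/W}-1$ and $$\xi_1=\frac{\lambda_1P_1+p_ap_{Lp}\lambda_2P_2}{\lambda_1P_1},\quad \varsigma_1=\frac{p_a(1-p_{Lp})\lambda_2P_2}{\lambda_1P_1},\quad \zeta_1=\frac{\lambda_1P_1+p_{Lp}\lambda_2P_2}{\lambda_1P_1}.$$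
   Context: Parameters: path loss exponent $\alpha\in(2,4]$; $\lambda_1,\lambda_2,\lambda_u,P_1,P_2,W,R_0>0$; noise power $\sigma^2\ge 0$; integers $N,N_1,N_2\ge1$ with $N_1<N$ and $N_2\le N-N_1$; $\gamma\ge0$. Contents: content $n\in\{1,\dots,N\}$ is requested with probability $q_n=n^{-\gamma}/\sum_{k=1}^N k^{-\gamma}$. The first group is $\{1,\dots,N_1\}$, stored by every macro base station (MBS); the second group is $\{N_1+1,\dots,N\}$, each content of which is stored by each helper independently with probability $p_{Lp}=N_2/(N-N_1)$. Put $Q_{Mp}=\sum_{n\le N_1}q_n$, $Q_{Lp}=1-Q_{Mp}$. Network: MBSs (tier 1) and helpers (tier 2) form independent homogeneous Poisson point processes $\Phi_1,\Phi_2$ in $\mathbb R^2$ of intensities $\lambda_1,\lambda_2$, with transmit powers $P_1,P_2$; users have density $\lambda_u$. A tagged user is at the origin; the base station $x_{i,j}$ at distance $z_{i,j}$ from the origin has received power $P_ih_{i,j}z_{i,j}^{-\alpha}$, with $h_{i,j}$ i.i.d. exponential of mean 1, independent of the locations. Association constants: $A_{Lp,1}=\frac{\lambda_1P_1^{2/\alpha}}{\lambda_1P_1^{2/\alpha}+p_{Lp}\lambda_2P_2^{2/\alpha}}$, $A_{Lp,2}=1-A_{Lp,1}$, $A_1=Q_{Mp}+Q_{Lp}A_{Lp,1}$, $A_2=Q_{Lp}A_{Lp,2}$. Load: the number $L_k$ of users served by the serving base station of tier $k$ (tagged user included) is taken to be independent of locations and fading, with law, for $l\ge 0$, $$P_{L_k}(l+1)=\mathbb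 P(L_k=l+1)=\frac{3.5^{3.5}}{l!}\frac{\Gamma(l+4.5)}{\Gamma(3.5)}\Big(\frac{A_k\lambda_u}{\lambda_k}\Big)^{l}\Big(3.5+\frac{A_k\lambda_u}{\lambda_k}\Big)^{-(l+4.5)}.$$ Active helpers: only active helpers transmit; non-serving helpers are active independently with probability $p_a=1-\big(1+\frac{A_2\lambda_u}{3.5\lambda_2}\big)^{-3.5}$. Second-group request for content $f_n$: let $\Phi_{n^+,2}$ and $\Phi_{n^-,2}$ be the helpers storing, respectively not storing, $f_n$ (independent Poisson processes of intensities $p_{Lp}\lambda_2$ and $(1-p_{Lp})\lambda_2$). The user is served by the base station $x_0$ maximizing $P_iz_{i,j}^{-\alpha}$ over $\Phi_1\cup\Phi_{n^+,2}$. If $x_0$ is in tier $k$, at distance $z$ with fading $h$, then $\mathrm{SINR}=\frac{P_khz^{-\alpha}}{I+\sigma^2}$, where $I$ is the sum of the received powers from all MBSs and all active helpers (storing or not storing $f_n$) other than $x_0$. When $k=1$, the wireless access rate is $R^w_{Lp,1}=\frac{W}{L_1}\log_2(1+\mathrm{SINR})$. Functions: $G(x,\alpha)=\frac{2x}{\alpha-2}\,{}_2F_1\big(1,1-\tfrac2\alpha;2-\tfrac2\alpha;-x\big)$ and $H(x,\alpha)=\frac2\alpha x^{2/\alpha}B\big(\tfrac2\alpha,1-\tfrac2\alpha\big)$, with ${}_2F_1$ the Gauss hypergeometric function and $B$ the Beta function.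
   Formalization: In ξ_1, ς_1 and ζ_1 the powers P_1, P_2 are replaced by P_1^{2/α}, P_2^{2/α}; as printed the formula fails for P_1≠P_2 (for σ²=0 and R_0→0 it tends to 1/ζ_1 instead of A_{Lp,1}), and the two versions agree when P_1=P_2. *)

theory Defs
  imports "HOL-Probability.Probability" "HOL-Complex_Analysis.Complex_Analysis"
begin

section \<open>Special functions\<close>

text \<open>
  Gauss' function on the plane slit along [1, \<open>\<infinity>\<close>): the analytic continuation of the
  hypergeometric series (which only converges on the unit disc). The slit plane is connected,
  so the continuation is unique there; the values on the slit are unspecified.
\<close>

definition hyp2F1_fun :: "complex \<Rightarrow> complex \<Rightarrow> complex \<Rightarrow> complex \<Rightarrow> complex" where
  "hyp2F1_fun a b c = (SOME f. f holomorphic_on - (complex_of_real ` {1..}) \<and>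
     f has_fps_expansion fps_hypergeo [a, b] [c] 1)"

definition hyp2F1 :: "real \<Rightarrow> real \<Rightarrow> real \<Rightarrow> real \<Rightarrow> real" where
  "hyp2F1 a b c x = Re (hyp2F1_fun (of_real a) (of_real b) (of_real c) (of_real x))"

definition G_fun :: "real \<Rightarrow> real \<Rightarrow> real" where
  "G_fun x \<alpha> = 2 * x / (\<alpha> - 2) * hyp2F1 1 (1 - 2 / \<alpha>) (2 - 2 / \<alpha>) (- x)"

definition H_fun :: "real \<Rightarrow> real \<Rightarrow> real" where
  "H_fun x \<alpha> = 2 / \<alpha> * x powr (2 / \<alpha>) * Beta (2 / \<alpha>) (1 - 2 / \<alpha>)"


section \<open>Parameters\<close>

record net_params =
  alpha :: real
  lambda1 :: real
  lambda2 :: real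
  lambda_u :: real
  power1 :: real
  power2 :: real
  bandwidth :: real
  rate_req :: real      \<comment> \<open>\<open>R\<^sub>0\<close>\<close>
  noise :: real         \<comment> \<open>\<open>\<sigma>\<^sup>2\<close>\<close>
  zipf :: real          \<comment> \<open>\<open>\<gamma>\<close>\<close>
  num_contents :: nat   \<comment> \<open>\<open>N\<close>\<close>
  num_first :: nat      \<comment> \<open>\<open>N\<^sub>1\<close>\<close>
  num_cached :: nat     \<comment> \<open>\<open>N\<^sub>2\<close>\<close>

definition valid_params :: "net_params \<Rightarrow> bool" where
  "valid_params p \<longleftrightarrow>
     2 < alpha p \<and> alpha p \<le> 4 \<and>
     0 < lambda1 p \<and> 0 < lambda2 p \<and> 0 < lambda_u p \<and>
     0 < power1 p \<and> 0 < power2 p \<and> 0 < bandwidth p \<and> 0 < rate_req p \<and>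
     0 \<le> noise p \<and> 0 \<le> zipf p \<and>
     1 \<le> num_contents p \<and> 1 \<le> num_first p \<and> 1 \<le> num_cached p \<and>
     num_first p < num_contents p \<and> num_cached p \<le> num_contents p - num_first p"

definition request_prob :: "net_params \<Rightarrow> nat \<Rightarrow> real" where
  "request_prob p n =
     real n powr (- zipf p) / (\<Sum>k = 1..num_contents p. real k powr (- zipf p))"

definition second_group :: "net_params \<Rightarrow> nat set" where
  "second_group p = {num_first p <.. num_contents p}"

definition p_Lp :: "net_params \<Rightarrow> real" where
  "p_Lp p = real (num_cached p) / (real (num_contents p) - real (num_first p))"

definition Q_Mp :: "net_params \<Rightarrow> real" where
  "Q_Mp p = (\<Sum>n = 1..num_first p. request_prob p n)"

definition Q_Lp :: "net_params \<Rightarrow> real" where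
  "Q_Lp p = 1 - Q_Mp p"

definition A_Lp1 :: "net_params \<Rightarrow> real" where
  "A_Lp1 p = lambda1 p * power1 p powr (2 / alpha p) /
     (lambda1 p * power1 p powr (2 / alpha p)
      + p_Lp p * lambda2 p * power2 p powr (2 / alpha p))"

definition A_Lp2 :: "net_params \<Rightarrow> real" where
  "A_Lp2 p = 1 - A_Lp1 p"

definition A1 :: "net_params \<Rightarrow> real" where
  "A1 p = Q_Mp p + Q_Lp p * A_Lp1 p"

definition A2 :: "net_params \<Rightarrow> real" where
  "A2 p = Q_Lp p * A_Lp2 p"

definition p_active :: "net_params \<Rightarrow> real" where
  "p_active p = 1 - (1 + A2 p * lambda_u p / (3.5 * lambda2 p)) powr (- 3.5)"

text \<open>\<open>load1_law p l\<close> is the probability that the serving macro base station has load \<open>l + 1\<close>.\<close>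

definition load1_law :: "net_params \<Rightarrow> nat \<Rightarrow> real" where
  "load1_law p l =
     3.5 powr 3.5 / fact l * (Gamma (real l + 4.5) / Gamma 3.5)
     * (A1 p * lambda_u p / lambda1 p) ^ l
     * (3.5 + A1 p * lambda_u p / lambda1 p) powr (- (real l + 4.5))"


section \<open>Constants of the delivery probability\<close>

definition delta1 :: "net_params \<Rightarrow> nat \<Rightarrow> real" where
  "delta1 p l = 2 powr (real (l + 1) * rate_req p / bandwidth p) - 1"

text \<open>
  The powers enter these three constants with exponent \<open>2/\<alpha>\<close>, as they do in \<open>A_Lp1\<close>.
  The source prints them with exponent 1; that version contradicts its own association
  probability, since \<open>1 / zeta1\<close> has to be the probability of association with the macro tier
  (lemma \<open>zeta1_inverse\<close>), and agrees with this one only for \<open>power1 = power2\<close>.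
\<close>

definition xi1 :: "net_params \<Rightarrow> real" where
  "xi1 p = (lambda1 p * power1 p powr (2 / alpha p)
            + p_active p * p_Lp p * lambda2 p * power2 p powr (2 / alpha p))
           / (lambda1 p * power1 p powr (2 / alpha p))"

definition varsigma1 :: "net_params \<Rightarrow> real" where
  "varsigma1 p = p_active p * (1 - p_Lp p) * lambda2 p * power2 p powr (2 / alpha p)
           / (lambda1 p * power1 p powr (2 / alpha p))"

definition zeta1 :: "net_params \<Rightarrow> real" where
  "zeta1 p = (lambda1 p * power1 p powr (2 / alpha p)
              + p_Lp p * lambda2 p * power2 p powr (2 / alpha p))
             / (lambda1 p * power1 p powr (2 / alpha p))"

lemma zeta1_inverse: "1 / zeta1 p = A_Lp1 p"
  by (simp add: zeta1_def A_Lp1_def)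


section \<open>Poisson point processes in the plane\<close>

text \<open>
  A point process is given by an enumeration \<open>X 0, X 1, \<dots>\<close> of its points. A homogeneous process
  of positive intensity on the whole plane has almost surely infinitely many points, so
  enumerating by the naturals loses nothing; no particular order of enumeration is assumed.
\<close>

definition num_points :: "(nat \<Rightarrow> 'w \<Rightarrow> real ^ 2) \<Rightarrow> (real ^ 2) set \<Rightarrow> 'w \<Rightarrow> nat" where
  "num_points X B w = card {j. X j w \<in> B}"

definition (in prob_space) poisson_process :: "real \<Rightarrow> (nat \<Rightarrow> 'a \<Rightarrow> real ^ 2) \<Rightarrow> bool" where
  "poisson_process \<mu> X \<longleftrightarrow>
     (\<forall>j. random_variable borel (X j)) \<and>
     (\<forall>B \<in> sets borel. bounded B \<longrightarrow>
        (AE w in M. finite {j. X j w \<in> B}) \<and>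
        (\<forall>k. prob {w \<in> space M. num_points X B w = k} =
              (\<mu> * measure lborel B) ^ k / fact k * exp (- (\<mu> * measure lborel B)))) \<and>
     (\<forall>(m::nat) B. (\<forall>i<m. B i \<in> sets borel \<and> bounded (B i)) \<and> disjoint_family_on B {..<m} \<longrightarrow>
        indep_vars (\<lambda>_. count_space UNIV) (\<lambda>i. num_points X (B i)) {..<m})"


section \<open>Network model\<close>

datatype station = MBS nat | Helper nat

primrec tx_power :: "net_params \<Rightarrow> station \<Rightarrow> real" where
  "tx_power p (MBS j) = power1 p"
| "tx_power p (Helper j) = power2 p"

text \<open>
  The independent sources of randomness for a request of content \<open>n\<close>, as sub-sigma-algebras:
  the two location processes, the fading of each station, whether helper \<open>j\<close> stores \<open>n\<close>,
  whether helper \<open>j\<close> is active when not serving, and the load of the serving macro base station.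
\<close>

datatype source = MBS_locs | Helper_locs | Fading station | Storing nat | Activity nat | Load

primrec source_events ::
  "'w measure \<Rightarrow> (station \<Rightarrow> 'w \<Rightarrow> real ^ 2) \<Rightarrow> (station \<Rightarrow> 'w \<Rightarrow> real)
   \<Rightarrow> (nat \<Rightarrow> nat \<Rightarrow> 'w \<Rightarrow> bool) \<Rightarrow> (nat \<Rightarrow> 'w \<Rightarrow> bool) \<Rightarrow> ('w \<Rightarrow> nat)
   \<Rightarrow> nat \<Rightarrow> source \<Rightarrow> 'w set set" where
  "source_events M loc fading stores active load1 n MBS_locs =
     sets (vimage_algebra (space M) (\<lambda>w j. loc (MBS j) w) (Pi\<^sub>M UNIV (\<lambda>_. borel)))"
| "source_events M loc fading stores active load1 n Helper_locs =
     sets (vimage_algebra (space M) (\<lambda>w j. loc (Helper j) w) (Pi\<^sub>M UNIV (\<lambda>_. borel)))"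
| "source_events M loc fading stores active load1 n (Fading s) =
     sets (vimage_algebra (space M) (fading s) borel)"
| "source_events M loc fading stores active load1 n (Storing j) =
     sets (vimage_algebra (space M) (stores j n) (count_space UNIV))"
| "source_events M loc fading stores active load1 n (Activity j) =
     sets (vimage_algebra (space M) (active j) (count_space UNIV))"
| "source_events M loc fading stores active load1 n Load =
     sets (vimage_algebra (space M) load1 (count_space UNIV))"

text \<open>
  \<open>stores j n w\<close>: helper \<open>j\<close> stores content \<open>n\<close>. The joint law of the stored contents of one
  helper is left open, since a request only ever involves one content.
\<close>

locale cache_network = prob_space M
  for M :: "'w measure" +
  fixes p :: net_params
    and loc :: "station \<Rightarrow> 'w \<Rightarrow> real ^ 2"
    and fading :: "station \<Rightarrow> 'w \<Rightarrow> real"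
    and stores :: "nat \<Rightarrow> nat \<Rightarrow> 'w \<Rightarrow> bool"
    and active :: "nat \<Rightarrow> 'w \<Rightarrow> bool"
    and load1 :: "'w \<Rightarrow> nat"
  assumes params: "valid_params p"
    and MBS_process: "poisson_process (lambda1 p) (\<lambda>j. loc (MBS j))"
    and Helper_process: "poisson_process (lambda2 p) (\<lambda>j. loc (Helper j))"
    and fading_law: "\<And>s. distributed M lborel (fading s) (exponential_density 1)"
    and storing_law: "\<And>j n. n \<in> second_group p \<Longrightarrow>
          distr M (count_space UNIV) (stores j n) = measure_pmf (bernoulli_pmf (p_Lp p))"
    and storing_measurable: "\<And>j n. n \<in> second_group p \<Longrightarrow>
          random_variable (count_space UNIV) (stores j n)"
    and activity_law:
          "\<And>j. distr M (count_space UNIV) (active j) = measure_pmf (bernoulli_pmf (p_active p))"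
    and activity_measurable: "\<And>j. random_variable (count_space UNIV) (active j)"
    and load1_measurable: "random_variable (count_space UNIV) load1"
    and load1_law: "\<And>l. prob {w \<in> space M. load1 w = l + 1} = load1_law p l"
    and independence: "\<And>n. n \<in> second_group p \<Longrightarrow>
          indep_sets (source_events M loc fading stores active load1 n) UNIV"

text \<open>Average received power \<open>P\<^sub>i z\<^sup>-\<^sup>\<alpha>\<close> at the origin, i.e. without fading.\<close>

definition mean_rx_power :: "net_params \<Rightarrow> (station \<Rightarrow> 'w \<Rightarrow> real ^ 2) \<Rightarrow> station \<Rightarrow> 'w \<Rightarrow> real" where
  "mean_rx_power p loc s w = tx_power p s * norm (loc s w) powr (- alpha p)"

primrec can_serve :: "(nat \<Rightarrow> nat \<Rightarrow> 'w \<Rightarrow> bool) \<Rightarrow> nat \<Rightarrow> 'w \<Rightarrow> station \<Rightarrow> bool" where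
  "can_serve stores n w (MBS j) \<longleftrightarrow> True"
| "can_serve stores n w (Helper j) \<longleftrightarrow> stores j n w"

definition is_serving ::
  "net_params \<Rightarrow> (station \<Rightarrow> 'w \<Rightarrow> real ^ 2) \<Rightarrow> (nat \<Rightarrow> nat \<Rightarrow> 'w \<Rightarrow> bool) \<Rightarrow> nat
   \<Rightarrow> 'w \<Rightarrow> station \<Rightarrow> bool" where
  "is_serving p loc stores n w s0 \<longleftrightarrow> can_serve stores n w s0 \<and>
     (\<forall>s. can_serve stores n w s \<longrightarrow> mean_rx_power p loc s w \<le> mean_rx_power p loc s0 w)"

primrec transmits :: "(nat \<Rightarrow> 'w \<Rightarrow> bool) \<Rightarrow> 'w \<Rightarrow> station \<Rightarrow> bool" where
  "transmits active w (MBS j) \<longleftrightarrow> True"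
| "transmits active w (Helper j) \<longleftrightarrow> active j w"

definition interference ::
  "net_params \<Rightarrow> (station \<Rightarrow> 'w \<Rightarrow> real ^ 2) \<Rightarrow> (station \<Rightarrow> 'w \<Rightarrow> real) \<Rightarrow> (nat \<Rightarrow> 'w \<Rightarrow> bool)
   \<Rightarrow> 'w \<Rightarrow> station \<Rightarrow> real" where
  "interference p loc fading active w s0 =
     (\<Sum>\<^sub>\<infinity>s\<in>{s. s \<noteq> s0 \<and> transmits active w s}. fading s w * mean_rx_power p loc s w)"

definition SINR ::
  "net_params \<Rightarrow> (station \<Rightarrow> 'w \<Rightarrow> real ^ 2) \<Rightarrow> (station \<Rightarrow> 'w \<Rightarrow> real) \<Rightarrow> (nat \<Rightarrow> 'w \<Rightarrow> bool)
   \<Rightarrow> 'w \<Rightarrow> station \<Rightarrow> real" where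
  "SINR p loc fading active w s0 =
     fading s0 w * mean_rx_power p loc s0 w / (interference p loc fading active w s0 + noise p)"

definition access_rate1 ::
  "net_params \<Rightarrow> (station \<Rightarrow> 'w \<Rightarrow> real ^ 2) \<Rightarrow> (station \<Rightarrow> 'w \<Rightarrow> real) \<Rightarrow> (nat \<Rightarrow> 'w \<Rightarrow> bool)
   \<Rightarrow> ('w \<Rightarrow> nat) \<Rightarrow> 'w \<Rightarrow> station \<Rightarrow> real" where
  "access_rate1 p loc fading active load1 w s0 =
     bandwidth p / real (load1 w) * log 2 (1 + SINR p loc fading active w s0)"

text \<open>The serving station is almost surely unique.\<close>

definition access_success1 ::
  "'w measure \<Rightarrow> net_params \<Rightarrow> (station \<Rightarrow> 'w \<Rightarrow> real ^ 2) \<Rightarrow> (station \<Rightarrow> 'w \<Rightarrow> real)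
   \<Rightarrow> (nat \<Rightarrow> nat \<Rightarrow> 'w \<Rightarrow> bool) \<Rightarrow> (nat \<Rightarrow> 'w \<Rightarrow> bool) \<Rightarrow> ('w \<Rightarrow> nat) \<Rightarrow> nat \<Rightarrow> real" where
  "access_success1 M p loc fading stores active load1 n =
     measure M {w \<in> space M. \<exists>j. is_serving p loc stores n w (MBS j) \<and>
                  rate_req p \<le> access_rate1 p loc fading active load1 w (MBS j)}"

end

theory Submission
  imports Defs
begin

text \<open>
  Let \<open>T r\<close> be the probability that the user is covered at threshold \<open>\<delta>\<close> by the macro tier and that some
  macro base station lies within distance \<open>r\<close>. If exactly one macro base station lies in the disc
  of radius \<open>b\<close>, at distance in \<open>(a, b]\<close>, it is the only macro station that can serve, and
  for fixed locations the probability of coverage is a product over all other stations that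
  decreases in the serving distance. The Laplace functional of the Poisson processes evaluates the mean of this
  product, hence \<open>T b - T a\<close> lies between \<open>m \<Lambda>(b)\<close> and \<open>m \<Lambda>(a) + m\<^sup>2\<close>, where
  \<open>m = \<pi> \<lambda>\<^sub>1 (b\<^sup>2 - a\<^sup>2)\<close> and \<open>m\<^sup>2\<close> bounds the probability of two stations in the ring. So
  \<open>T' z = 2 \<pi> \<lambda>\<^sub>1 z \<Lambda>(z)\<close>, and the fundamental theorem of calculus gives the integral for one
  threshold. The load is independent of everything else and takes the value \<open>l + 1\<close> with
  threshold \<open>delta1 p l\<close>.
\<close>

text \<open>The enumeration of the points is arbitrary, so the serving station has no fixed index
  and conditioning on its position would call for Palm calculus. Increments of \<open>T\<close>
  avoid this: they involve only a count on a ring and products over the remaining points, which the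
  clauses of \<open>poisson_process\<close> control. The helper process is never split into storing
  and non-storing parts. With locations frozen, storage, activity and fading are integrated out
  station by station; each helper then contributes one factor \<open>1 - helper_thinning\<close>,
  and the Laplace functional is applied to the whole process. The exponent 2/\<alpha> of the powers
  arises there, from rescaling lengths by the \<alpha>-th root of the power ratio. Two degenerate
  cases have to be excluded almost surely: a divergent interference sum, which \<open>infsum\<close>
  evaluates to 0, and zero interference without noise, where the division in \<open>SINR\<close>
  returns 0. The threshold \<open>delta1 p l\<close> is unbounded in \<open>l\<close>, so
  \<open>G_fun\<close> is needed outside the disc of convergence of the hypergeometric series; hence
  Euler's integral and analytic continuation.\<close>

section \<open>Planar integrals and special functions\<close>

lemma emeasure_disc_real2: "0 \<le> r \<Longrightarrow> emeasure lborel (cball (0 :: real ^ 2) r) = ennreal (pi * r\<^sup>2)"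
  by (simp add: emeasure_cball unit_ball_vol_2)

text \<open>The disc of radius \<open>b\<close> has area \<open>pi * b\<^sup>2\<close>, which is
  also the integral of \<open>2 * pi * s\<close> up to \<open>b\<close>, and half lines are an
  intersection stable generator. This stands in for a polar change of variables.\<close>

lemma distr_norm_real2:
  "distr lborel borel (norm :: real ^ 2 \<Rightarrow> real) =
     density lborel (\<lambda>s. ennreal (2 * pi * s) * indicator {0..} s)" (is "?M = ?N")
proof (rule measure_eqI_generator_eq[where E = "range atMost" and \<Omega> = UNIV and A = "\<lambda>i. {..real i}"])
  have M: "emeasure ?M {..b} = ennreal (if 0 \<le> b then pi * b\<^sup>2 else 0)" for b
  proof -
    have "norm -` {..b} \<inter> space lborel = cball (0 :: real ^ 2) b" by auto
    then show ?thesis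
      by (auto simp: emeasure_distr emeasure_disc_real2)
  qed
  have N: "emeasure ?N {..b} = ennreal (if 0 \<le> b then pi * b\<^sup>2 else 0)" for b
  proof (cases "0 \<le> b")
    case True
    have "emeasure ?N {..b} = (\<integral>\<^sup>+s. ennreal (2 * pi * s) * indicator {0..b} s \<partial>lborel)"
      by (subst emeasure_density) (auto intro!: nn_integral_cong split: split_indicator)
    also have "\<dots> = ennreal (pi * b\<^sup>2 - pi * 0\<^sup>2)"
      by (rule nn_integral_FTC_Icc)
         (use True in \<open>auto intro!: derivative_eq_intros simp: has_real_derivative_iff_has_vector_derivative[symmetric]\<close>)
    finally show ?thesis using True by simp
  next
    case False
    then show ?thesis
      by (subst emeasure_density) (auto simp: nn_integral_0_iff_AE split: split_indicator)
  qed
  show "Int_stable (range atMost :: real set set)"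
    by (auto simp: Int_stable_def intro!: image_eqI[of _ _ "min _ _"])
  show "range atMost \<subseteq> Pow (UNIV :: real set)" by simp
  show "emeasure ?M X = emeasure ?N X" if "X \<in> range atMost" for X
    using that M N by auto
  show "sets ?M = sigma_sets UNIV (range atMost)" "sets ?N = sigma_sets UNIV (range atMost)"
    by (simp_all add: borel_eq_atMost)
  show "range (\<lambda>i. {..real i}) \<subseteq> range atMost" by auto
  show "(\<Union>i. {..real i}) = UNIV" by (auto intro: real_arch_simple)
  show "emeasure ?M {..real i} \<noteq> \<infinity>" for i using M by simp
qed

lemma polar_real2:
  assumes [measurable]: "f \<in> borel_measurable borel"
  shows "(\<integral>\<^sup>+x. f (norm (x :: real ^ 2)) \<partial>lborel) = (\<integral>\<^sup>+s. ennreal (2 * pi * s) * f s * indicator {0<..} s \<partial>lborel)"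
proof -
  have "(\<integral>\<^sup>+x. f (norm (x :: real ^ 2)) \<partial>lborel) = (\<integral>\<^sup>+s. f s \<partial>distr lborel borel (norm :: real ^ 2 \<Rightarrow> real))"
    by (simp add: nn_integral_distr)
  also have "\<dots> = (\<integral>\<^sup>+s. ennreal (2 * pi * s) * indicator {0..} s * f s \<partial>lborel)"
    unfolding distr_norm_real2 by (rule nn_integral_density) auto
  also have "\<dots> = (\<integral>\<^sup>+s. ennreal (2 * pi * s) * f s * indicator {0<..} s \<partial>lborel)"
    by (auto intro!: nn_integral_cong split: split_indicator)
  finally show ?thesis .
qed

text \<open>Stated for \<open>f\<close> vanishing up to \<open>r\<close>, because path loss is
  integrated either over the whole plane (\<open>r = 0\<close>) or outside an exclusion
  disc.\<close>

lemma polar_real2_set_integral: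
  fixes f :: "real \<Rightarrow> real"
  assumes [measurable]: "f \<in> borel_measurable borel"
    and nonneg: "\<And>s. 0 < s \<Longrightarrow> 0 \<le> f s" and supp: "\<And>s. s \<le> r \<Longrightarrow> f s = 0" and r: "0 \<le> r"
    and int: "set_integrable lborel {r<..} (\<lambda>s. s * f s)"
  shows "has_bochner_integral lborel (\<lambda>x :: real ^ 2. f (norm x)) (2 * pi * (LBINT s:{r<..}. s * f s))"
proof (rule has_bochner_integral_nn_integral)
  show "AE x in lborel. 0 \<le> f (norm (x :: real ^ 2))"
    using nonneg supp r by (intro AE_I2) (metis less_eq_real_def norm_ge_zero not_le)
  show "0 \<le> 2 * pi * (LBINT s:{r<..}. s * f s)"
    using nonneg r by (auto simp: set_lebesgue_integral_def intro!: mult_nonneg_nonneg integral_nonneg_AE split: split_indicator)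
  have "(\<integral>\<^sup>+x. ennreal (f (norm (x :: real ^ 2))) \<partial>lborel)
      = (\<integral>\<^sup>+s. ennreal (2 * pi * s) * ennreal (f s) * indicator {0<..} s \<partial>lborel)"
    by (rule polar_real2) simp
  also have "\<dots> = (\<integral>\<^sup>+s. ennreal (2 * pi * (indicator {r<..} s *\<^sub>R (s * f s))) \<partial>lborel)"
    using nonneg supp r
    by (intro nn_integral_cong) (auto split: split_indicator simp: ennreal_mult[symmetric] mult_ac)
  also have "\<dots> = ennreal (LBINT s. 2 * pi * (indicator {r<..} s *\<^sub>R (s * f s)))"
    using nonneg r int unfolding set_integrable_def
    by (intro nn_integral_eq_integral integrable_mult_right AE_I2) (auto split: split_indicator)
  also have "\<dots> = ennreal (2 * pi * (LBINT s:{r<..}. s * f s))"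
    by (simp add: set_lebesgue_integral_def)
  finally show "(\<integral>\<^sup>+x. ennreal (f (norm (x :: real ^ 2))) \<partial>lborel) = ennreal (2 * pi * (LBINT s:{r<..}. s * f s))" .
qed simp

text \<open>One minus the Laplace transform of unit exponential fading, taken at
  \<open>c * norm x powr - \<alpha>\<close>: an interferer at \<open>x\<close> multiplies the
  coverage probability by \<open>1 - attenuation \<alpha> c x\<close>. At the origin the value is 0,
  since \<open>0 powr - \<alpha> = 0\<close>.\<close>

definition attenuation :: "real \<Rightarrow> real \<Rightarrow> real ^ 2 \<Rightarrow> real" where
  "attenuation \<alpha> c x = c * norm x powr - \<alpha> / (1 + c * norm x powr - \<alpha>)"

lemma attenuation_eq: "x \<noteq> 0 \<Longrightarrow> attenuation \<alpha> c x = c / (norm x powr \<alpha> + c)"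
  by (simp add: attenuation_def powr_minus divide_simps)

lemma attenuation_bounds:
  assumes "0 \<le> c" shows "0 \<le> attenuation \<alpha> c x" "attenuation \<alpha> c x \<le> 1"
proof -
  have "0 \<le> c * norm x powr - \<alpha>" using assms by simp
  then show "0 \<le> attenuation \<alpha> c x" "attenuation \<alpha> c x \<le> 1"
    by (simp_all add: attenuation_def divide_simps)
qed

lemma attenuation_mono:
  assumes "0 \<le> c" "c \<le> d" shows "attenuation \<alpha> c x \<le> attenuation \<alpha> d x"
proof -
  have "0 \<le> c * norm x powr - \<alpha>" "c * norm x powr - \<alpha> \<le> d * norm x powr - \<alpha>"
    using assms by (simp_all add: mult_right_mono)
  then show ?thesis by (simp add: attenuation_def divide_simps) (simp add: algebra_simps)
qed

lemma one_minus_attenuation: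
  assumes "0 \<le> c" shows "1 - attenuation \<alpha> c x = 1 / (1 + c * norm x powr - \<alpha>)"
proof -
  have "0 \<le> c * norm x powr - \<alpha>" using assms by simp
  then show ?thesis by (simp add: attenuation_def divide_simps)
qed

lemma borel_measurable_attenuation [measurable]: "attenuation \<alpha> c \<in> borel_measurable borel"
  unfolding attenuation_def by measurable


text \<open>The substitution \<open>s = r * (1 - v) powr e\<close> with
  \<open>e = - 1 / (\<alpha> - 2)\<close> maps the unit interval increasingly onto the half line
  beyond \<open>r\<close> and produces Euler's integral for the parameter
  \<open>b = 1 - 2 / \<alpha>\<close>, since
  \<open>1 / b = \<alpha> / (\<alpha> - 2)\<close>.\<close>

lemma pathloss_substitution_outside:
  fixes \<alpha> c r :: real
  assumes \<alpha>: "2 < \<alpha>" and c: "0 < c" and r: "0 < r"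
  shows "set_integrable lborel {r<..} (\<lambda>s. s * (c / (s powr \<alpha> + c)))" (is ?A)
    and "(LBINT s:{r<..}. s * (c / (s powr \<alpha> + c))) =
      r\<^sup>2 * (c / r powr \<alpha>) / (\<alpha> - 2) * (LBINT v:{0..1}. 1 / (1 + c / r powr \<alpha> * (1 - v) powr (\<alpha> / (\<alpha> - 2))))" (is ?B)
proof -
  define d where "d = c / r powr \<alpha>"
  have d: "0 < d" using c r by (simp add: d_def)
  have c_eq: "c = d * r powr \<alpha>" using r by (simp add: d_def)
  \<comment> \<open>With this exponent \<open>s powr (1 - \<alpha>) * ds\<close> becomes a constant
    multiple of \<open>dv\<close>, so the transformed integrand \<open>?h\<close> stays continuous
    up to both endpoints.\<close>
  define e where "e = - 1 / (\<alpha> - 2)"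
  have e: "e < 0" using \<alpha> by (simp add: e_def)
  have e1: "\<alpha> / (\<alpha> - 2) = 1 - 2 * e" and e2: "\<alpha> * e = 2 * e - 1" and e3: "1 / (\<alpha> - 2) = - e" 
    using \<alpha> by (simp_all add: e_def field_simps)
  let ?g = "\<lambda>v. r * (1 - v) powr e"
  let ?g' = "\<lambda>v. - r * e * (1 - v) powr (e - 1)"
  let ?f = "\<lambda>s. s * (c / (s powr \<alpha> + c))"
  let ?h = "\<lambda>v. r\<^sup>2 * d * - e * (1 / (1 + d * (1 - v) powr (1 - 2 * e)))"
  have fg: "?f (?g v) * ?g' v = ?h v" if "0 < v" "v < 1" for v
  proof -
    define y where "y = 1 - v"
    have y: "0 < y" using that by (simp add: y_def)
    have "(r * y powr e) powr \<alpha> = r powr \<alpha> * y powr (2 * e - 1)"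
      using r y by (simp add: powr_mult powr_powr e2 mult.commute[of e])
    then have "?f (r * y powr e) * (- r * e * y powr (e - 1)) =
       r * y powr e * (d * r powr \<alpha> / (r powr \<alpha> * y powr (2 * e - 1) + d * r powr \<alpha>)) * (- r * e * y powr (e - 1))"
      by (simp add: c_eq)
    also have "\<dots> = r\<^sup>2 * d * - e * (y powr e * y powr (e - 1)) / (y powr (2 * e - 1) + d)"
    proof -
      define Y where "Y = y powr (2 * e - 1)"
      define R where "R = r powr \<alpha>"
      have pos: "0 < R" "0 < Y + d" "0 < R * (Y + d)" using r d y by (simp_all add: R_def Y_def add_pos_pos)
      have "d * R / (R * Y + d * R) = d / (Y + d)"
        using pos by (simp add: field_simps)
      then show ?thesis
        unfolding Y_def[symmetric] R_def[symmetric] by (simp add: power2_eq_square)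
    qed
    also have "y powr e * y powr (e - 1) = y powr (2 * e - 1)"
      by (simp add: powr_add[symmetric])
    also have "r\<^sup>2 * d * - e * y powr (2 * e - 1) / (y powr (2 * e - 1) + d) = 
       r\<^sup>2 * d * - e * (1 / (1 + d / y powr (2 * e - 1)))"
      using y d by (simp add: divide_simps add_pos_pos)
    also have "d / y powr (2 * e - 1) = d * y powr (1 - 2 * e)"
      using powr_minus_divide[of y "2 * e - 1"] by simp
    finally show ?thesis by (simp add: y_def)
  qed
  have nz: "1 + d * z powr q \<noteq> 0" "z powr q + c \<noteq> 0" for z q :: real
    using d c powr_ge_zero[of z q] by (auto simp: add_nonneg_eq_0_iff)
  have cont0: "continuous_on {0..1} (\<lambda>v. (1 - v) powr (1 - 2 * e))"
    by (rule continuous_on_powr') (use e in \<open>auto intro!: continuous_intros\<close>)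
  have cont: "continuous_on {0..1} ?h"
    using cont0 nz by (intro continuous_on_mult continuous_on_const continuous_on_divide continuous_on_add) auto
  have int: "set_integrable lborel {0..1} ?h"
    by (rule borel_integrable_atLeastAtMost') (rule cont)
  have int': "set_integrable lborel {0<..<1} ?h"
    by (rule set_integrable_subset[OF int]) auto
  have ei: "einterval 0 1 = {0<..<1 :: real}"
    by (auto simp: einterval_def zero_ereal_def one_ereal_def)
  have ei2: "einterval (ereal r) \<infinity> = {r<..}"
    by (auto simp: einterval_def)
  have subst_prems: "0 < (1 :: ereal)"
    "\<And>x. 0 < ereal x \<Longrightarrow> ereal x < 1 \<Longrightarrow> DERIV ?g x :> ?g' x"
    "\<And>x. 0 < ereal x \<Longrightarrow> ereal x < 1 \<Longrightarrow> isCont ?f (?g x)"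
    "\<And>x. 0 < ereal x \<Longrightarrow> ereal x < 1 \<Longrightarrow> isCont ?g' x"
    "\<And>x. 0 < ereal x \<Longrightarrow> ereal x < 1 \<Longrightarrow> 0 \<le> ?f (?g x)"
    "\<And>x. 0 \<le> ereal x \<Longrightarrow> ereal x \<le> 1 \<Longrightarrow> 0 \<le> ?g' x"
    "((ereal \<circ> ?g \<circ> real_of_ereal) \<longlongrightarrow> ereal r) (at_right 0)"
    "((ereal \<circ> ?g \<circ> real_of_ereal) \<longlongrightarrow> \<infinity>) (at_left 1)"
    "set_integrable lborel (einterval 0 1) (\<lambda>x. ?f (?g x) * ?g' x)"
  proof -
    show "0 < (1 :: ereal)" by simp
    show "DERIV ?g x :> ?g' x" if "0 < ereal x" "ereal x < 1" for x
      using that by (auto intro!: derivative_eq_intros simp: one_ereal_def powr_diff)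
    show "isCont ?f (?g x)" if "0 < ereal x" "ereal x < 1" for x
      using that r by (intro continuous_intros nz) (auto simp: one_ereal_def)
    show "isCont ?g' x" if "0 < ereal x" "ereal x < 1" for x
      using that by (intro continuous_intros) (auto simp: one_ereal_def)
    show "0 \<le> ?f (?g x)" if "0 < ereal x" "ereal x < 1" for x
      using r c by simp
    show "0 \<le> ?g' x" if "0 \<le> ereal x" "ereal x \<le> 1" for x
      using r e by (simp add: mult_nonneg_nonneg mult_nonneg_nonpos mult_nonpos_nonneg)
    have "(?g \<longlongrightarrow> r) (at_right 0)"
      by (auto intro!: tendsto_eq_intros)
    then show "((ereal \<circ> ?g \<circ> real_of_ereal) \<longlongrightarrow> ereal r) (at_right 0)"
      by (simp add: zero_ereal_def ereal_tendsto_simps)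
    have "filterlim ?g at_top (at_left 1)"
      using r e by real_asymp
    then show "((ereal \<circ> ?g \<circ> real_of_ereal) \<longlongrightarrow> \<infinity>) (at_left 1)"
      by (simp add: one_ereal_def ereal_tendsto_simps)
    show "set_integrable lborel (einterval 0 1) (\<lambda>x. ?f (?g x) * ?g' x)"
      unfolding ei using int' by (rule set_integrable_cong[THEN iffD2, rotated -1]) (use fg in auto)
  qed
  have le01: "(0 :: ereal) \<le> 1" by (simp add: zero_ereal_def one_ereal_def)
  note * = interval_integral_substitution_nonneg[OF subst_prems]
  show ?A using *(1) unfolding ei2 .
  have "(LBINT s:{r<..}. ?f s) = (LBINT s=ereal r..\<infinity>. ?f s)"
    by (simp add: interval_lebesgue_integral_def ei2)
  also have "\<dots> = (LBINT v:{0<..<1}. ?f (?g v) * ?g' v)"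
    using *(2) unfolding interval_lebesgue_integral_le_eq[OF le01] ei .
  also have "\<dots> = (LBINT v:{0<..<1}. ?h v)"
    by (rule set_lebesgue_integral_cong) (use fg in auto)
  also have "\<dots> = (LBINT v:{0..1}. ?h v)"
  proof (rule set_integral_cong_set)
    show "AE v in lborel. (v \<in> {0..1 :: real}) = (v \<in> {0<..<1})"
      using AE_lborel_singleton[of "0 :: real"] AE_lborel_singleton[of "1 :: real"] by eventually_elim auto
  qed (auto simp: set_borel_measurable_def)
  also have "\<dots> = r\<^sup>2 * d * - e * (LBINT v:{0..1}. 1 / (1 + d * (1 - v) powr (1 - 2 * e)))"
    by (rule set_integral_mult_right)
  finally show ?B unfolding d_def[symmetric] e1 by (simp add: e3[symmetric] del: )
qed


text \<open>In the variable \<open>v = s powr \<alpha> / (s powr \<alpha> + c)\<close> the integrand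
  becomes that of the Beta integral; \<alpha> > 2 makes its second argument
  \<open>1 - 2 / \<alpha>\<close> positive.\<close>

lemma pathloss_substitution_whole:
  fixes \<alpha> c :: real
  assumes \<alpha>: "2 < \<alpha>" and c: "0 < c"
  shows "set_integrable lborel {0<..} (\<lambda>s. s * (c / (s powr \<alpha> + c)))" (is ?A)
    and "2 * (LBINT s:{0<..}. s * (c / (s powr \<alpha> + c))) = H_fun c \<alpha>" (is ?B)
proof -
  define q where "q = 1 / \<alpha>"
  have q: "0 < q" "2 * q < 1" and aq: "\<alpha> * q = 1" using \<alpha> by (auto simp: q_def field_simps)
  let ?g = "\<lambda>v. (c * v / (1 - v)) powr q"
  let ?g' = "\<lambda>v. if 0 < v \<and> v < 1 then q * (c * v / (1 - v)) powr (q - 1) * (c / (1 - v)\<^sup>2) else 0"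
  let ?f = "\<lambda>s. s * (c / (s powr \<alpha> + c))"
  let ?h = "\<lambda>v. q * c powr (2 * q) * (v powr (2 * q - 1) * (1 - v) powr (1 - 2 * q - 1))"
  have fg: "?f (?g v) * ?g' v = ?h v" if v: "0 < v" "v < 1" for v
  proof -
    define y where "y = 1 - v"
    have y: "0 < y" using that by (simp add: y_def)
    define u where "u = c * v / y"
    have u: "0 < u" using y v c by (simp add: u_def)
    have "(u powr q) powr \<alpha> = u" using u by (simp add: powr_powr aq mult.commute[of q])
    moreover have "u + c = c / y" using y c by (simp add: u_def y_def field_simps)
    ultimately have "?f (u powr q) * (q * u powr (q - 1) * (c / y\<^sup>2)) =
       u powr q * y * (q * u powr (q - 1) * (c / y\<^sup>2))"
      using c by simp
    also have "\<dots> = q * (u powr q * u powr (q - 1)) * (c / y)"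
      using y by (simp add: power2_eq_square field_simps)
    also have "u powr q * u powr (q - 1) = u powr (2 * q - 1)"
      by (simp add: powr_add[symmetric])
    also have "u powr (2 * q - 1) = c powr (2 * q - 1) * v powr (2 * q - 1) * (y powr (- 2 * q) * y)"
    proof -
      have "u powr (2 * q - 1) = c powr (2 * q - 1) * v powr (2 * q - 1) / y powr (2 * q - 1)"
        using c v y by (simp add: u_def powr_mult powr_divide)
      also have "\<dots> = c powr (2 * q - 1) * v powr (2 * q - 1) * y powr - (2 * q - 1)"
        by (subst powr_minus_divide) simp
      also have "- (2 * q - 1) = - 2 * q + 1" by simp
      also have "y powr (- 2 * q + 1) = y powr (- 2 * q) * y"
        using y by (simp only: powr_add) simp
      finally show ?thesis .
    qed
    also have "q * (c powr (2 * q - 1) * v powr (2 * q - 1) * (y powr (- 2 * q) * y)) * (c / y)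
       = q * (c powr (2 * q - 1) * c) * (v powr (2 * q - 1) * y powr (- 2 * q))"
      using y by (simp add: field_simps)
    also have "c powr (2 * q - 1) * c = c powr (2 * q)"
      using c by (simp add: powr_diff)
    finally show ?thesis using v by (simp add: y_def u_def)
  qed
  have nz: "z powr r + c \<noteq> 0" for z r :: real
    using c powr_ge_zero[of z r] by (auto simp: add_nonneg_eq_0_iff)
  have beta: "((\<lambda>v. v powr (2 * q - 1) * (1 - v) powr (1 - 2 * q - 1)) has_integral Beta (2 * q) (1 - 2 * q)) {0..1}"
    by (rule has_integral_Beta_real) (use q in auto)
  have bint: "set_integrable lborel {0..1} (\<lambda>v. v powr (2 * q - 1) * (1 - v) powr (1 - 2 * q - 1))"
    unfolding set_integrable_def
  proof (rule integrableI_nonneg)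
    show "(\<integral>\<^sup>+ x. ennreal (indicat_real {0..1} x *\<^sub>R (x powr (2 * q - 1) * (1 - x) powr (1 - 2 * q - 1))) \<partial>lborel) < \<infinity>"
    proof (subst nn_integral_has_integral_lborel)
      show "((\<lambda>x. indicat_real {0..1} x *\<^sub>R (x powr (2 * q - 1) * (1 - x) powr (1 - 2 * q - 1))) has_integral
              Beta (2 * q) (1 - 2 * q)) UNIV"
        by (rule has_integral_eq[OF _ beta[unfolded has_integral_restrict_UNIV[symmetric, of _ _ "{0..1}"]]]) auto
    qed auto
  qed auto
  have int': "set_integrable lborel {0<..<1} ?h"
    by (intro set_integrable_mult_right set_integrable_subset[OF bint]) auto
  have bval: "(LBINT v:{0<..<1}. v powr (2 * q - 1) * (1 - v) powr (1 - 2 * q - 1)) = Beta (2 * q) (1 - 2 * q)"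
  proof -
    have "((\<lambda>v. v powr (2 * q - 1) * (1 - v) powr (1 - 2 * q - 1)) has_integral Beta (2 * q) (1 - 2 * q)) {0<..<1}"
      using beta by (simp add: has_integral_Icc_iff_Ioo)
    moreover have "set_integrable lborel {0<..<1} (\<lambda>v. v powr (2 * q - 1) * (1 - v) powr (1 - 2 * q - 1))"
      by (rule set_integrable_subset[OF bint]) auto
    ultimately show ?thesis
      by (simp add: set_borel_integral_eq_integral(2) integral_unique)
  qed
  have ei: "einterval 0 1 = {0<..<1 :: real}"
    by (auto simp: einterval_def zero_ereal_def one_ereal_def)
  have ei2: "einterval 0 \<infinity> = {0<..}"
    by (auto simp: einterval_def)
  have subst_prems: "0 < (1 :: ereal)"
    "\<And>x. 0 < ereal x \<Longrightarrow> ereal x < 1 \<Longrightarrow> DERIV ?g x :> ?g' x"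
    "\<And>x. 0 < ereal x \<Longrightarrow> ereal x < 1 \<Longrightarrow> isCont ?f (?g x)"
    "\<And>x. 0 < ereal x \<Longrightarrow> ereal x < 1 \<Longrightarrow> isCont ?g' x"
    "\<And>x. 0 < ereal x \<Longrightarrow> ereal x < 1 \<Longrightarrow> 0 \<le> ?f (?g x)"
    "\<And>x. 0 \<le> ereal x \<Longrightarrow> ereal x \<le> 1 \<Longrightarrow> 0 \<le> ?g' x"
    "((ereal \<circ> ?g \<circ> real_of_ereal) \<longlongrightarrow> 0) (at_right 0)"
    "((ereal \<circ> ?g \<circ> real_of_ereal) \<longlongrightarrow> \<infinity>) (at_left 1)"
    "set_integrable lborel (einterval 0 1) (\<lambda>x. ?f (?g x) * ?g' x)"
  proof -
    show "0 < (1 :: ereal)" by simp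
    show "DERIV ?g x :> ?g' x" if "0 < ereal x" "ereal x < 1" for x
    proof -
      have x: "0 < x" "x < 1" using that by (auto simp: one_ereal_def)
      have "DERIV (\<lambda>v. c * v / (1 - v)) x :> c / (1 - x)\<^sup>2"
        using x by (auto intro!: derivative_eq_intros simp: field_simps power2_eq_square)
      from DERIV_fun_powr[OF this, of q] show ?thesis
        using x c by simp
    qed
    show "isCont ?f (?g x)" if "0 < ereal x" "ereal x < 1" for x
      using that c by (intro continuous_intros nz) (auto simp: one_ereal_def)
    show "isCont ?g' x" if "0 < ereal x" "ereal x < 1" for x
    proof -
      have x: "x \<in> {0<..<1}" using that by (auto simp: one_ereal_def)
      have "continuous_on {0<..<1} (\<lambda>v. q * (c * v / (1 - v)) powr (q - 1) * (c / (1 - v)\<^sup>2))"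
        using c by (intro continuous_intros) auto
      then have "continuous_on {0<..<1} ?g'"
        by (rule continuous_on_cong[THEN iffD1, rotated -1]) auto
      then show ?thesis using x by (simp add: continuous_on_eq_continuous_at)
    qed
    show "0 \<le> ?f (?g x)" if "0 < ereal x" "ereal x < 1" for x
      using c by simp
    show "0 \<le> ?g' x" if "0 \<le> ereal x" "ereal x \<le> 1" for x
      using q c by simp
    have "(?g \<longlongrightarrow> 0) (at_right 0)"
      using q c by real_asymp
    then show "((ereal \<circ> ?g \<circ> real_of_ereal) \<longlongrightarrow> 0) (at_right 0)"
      by (simp add: zero_ereal_def ereal_tendsto_simps)
    have "filterlim ?g at_top (at_left 1)"
      using q c by real_asymp
    then show "((ereal \<circ> ?g \<circ> real_of_ereal) \<longlongrightarrow> \<infinity>) (at_left 1)"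
      by (simp add: one_ereal_def ereal_tendsto_simps)
    show "set_integrable lborel (einterval 0 1) (\<lambda>x. ?f (?g x) * ?g' x)"
      unfolding ei using int' by (rule set_integrable_cong[THEN iffD2, rotated -1]) (use fg in auto)
  qed
  have le01: "(0 :: ereal) \<le> 1" by (simp add: zero_ereal_def one_ereal_def)
  note * = interval_integral_substitution_nonneg[OF subst_prems]
  show ?A using *(1) unfolding ei2 .
  have "(LBINT s:{0<..}. ?f s) = (LBINT s=0..\<infinity>. ?f s)"
    by (simp add: interval_lebesgue_integral_def ei2)
  also have "\<dots> = (LBINT v:{0<..<1}. ?f (?g v) * ?g' v)"
    using *(2) unfolding interval_lebesgue_integral_le_eq[OF le01] ei .
  also have "\<dots> = (LBINT v:{0<..<1}. ?h v)"
    by (rule set_lebesgue_integral_cong) (use fg in auto)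
  also have "\<dots> = q * c powr (2 * q) * Beta (2 * q) (1 - 2 * q)"
    by (subst bval[symmetric]) (rule set_integral_mult_right)
  finally show ?B by (simp add: H_fun_def q_def)
qed


section \<open>Euler's integral and the hypergeometric function on the slit plane\<close>

lemma integral_power_Beta_moment:
  assumes "0 < (b :: real)"
  shows "((\<lambda>v. ((1 - v) powr (1 / b)) ^ n) has_integral b / (b + n)) {0..1}"
proof -
  define e where "e = n / b + 1"
  have e: "0 < e" using assms by (simp add: e_def add_nonneg_pos)
  have "((\<lambda>v. ((1 - v) powr (1 / b)) ^ n) has_integral (- ((1 - 1) powr e / e)) - (- ((1 - 0) powr e / e))) {0..1}"
  proof (rule fundamental_theorem_of_calculus_interior)
    show "continuous_on {0..1} (\<lambda>v. - ((1 - v) powr e / e))"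
      using e by (intro continuous_on_minus continuous_on_divide continuous_on_powr') (auto intro!: continuous_intros)
    show "((\<lambda>v. - ((1 - v) powr e / e)) has_vector_derivative ((1 - x) powr (1 / b)) ^ n) (at x)" if "x \<in> {0<..<1}" for x
      unfolding has_real_derivative_iff_has_vector_derivative[symmetric]
      using that e by (auto intro!: derivative_eq_intros simp: powr_power e_def)
  qed simp
  moreover have "1 / e = b / (b + n)" using assms by (simp add: e_def field_simps)
  ultimately show ?thesis using e by simp
qed

text \<open>Keeps the denominator of Euler's integrand away from zero for every argument off the
  slit, which is what makes the integral a candidate for the analytic continuation.\<close>

lemma slit_plane_mult_neq_1:
  assumes "w \<in> - (complex_of_real ` {1..})" "t \<in> {0..1}"
  shows "1 - w * of_real t \<noteq> 0"
proof
  assume "1 - w * of_real t = 0"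
  then have eq: "w * of_real t = 1" by simp
  then have t: "t \<noteq> 0" by auto
  then have "w = of_real (1 / t)" using eq by (simp add: field_simps)
  moreover have "1 / t \<in> {1..}" using t assms(2) by simp
  ultimately show False using assms(1) by blast
qed

text \<open>A segment from 0 to \<open>w\<close> that met the slit would give
  \<open>w * t = 1\<close> for some \<open>t\<close> in the unit interval; so the slit plane is
  starlike about 0. Connectedness is what makes the function chosen in \<open>hyp2F1_fun\<close>
  unique there.\<close>

lemma slit_plane: "open (- (complex_of_real ` {1..}))" "connected (- (complex_of_real ` {1..}))"
  "0 \<in> - (complex_of_real ` {1..})"
proof -
  have eq: "complex_of_real ` {1..} = {z. Im z = 0} \<inter> {z. 1 \<le> Re z}"
    by (auto simp: complex_eq_iff image_iff)
  have "closed ({z. Im z = 0} \<inter> {z. 1 \<le> Re z})"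
    by (intro closed_Int closed_Collect_eq closed_Collect_le continuous_intros)
  then show "open (- (complex_of_real ` {1..}))" unfolding eq by (rule open_Compl)
  have "starlike (- (complex_of_real ` {1..}))"
    unfolding starlike_def
  proof (intro bexI ballI subsetI)
    fix w y assume w: "w \<in> - (complex_of_real ` {1..})" and "y \<in> closed_segment 0 w"
    then obtain u where u: "0 \<le> u" "u \<le> 1" "y = u *\<^sub>R w" by (auto simp: in_segment)
    show "y \<in> - (complex_of_real ` {1..})"
    proof
      assume "y \<in> complex_of_real ` {1..}"
      then obtain r where r: "1 \<le> r" "y = of_real r" by auto
      then have "w * of_real (u / r) = 1"
        using u by (simp add: scaleR_conv_of_real field_simps)
      then show False using slit_plane_mult_neq_1[OF w, of "u / r"] u r by auto
    qed
  qed auto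
  then show "connected (- (complex_of_real ` {1..}))" by (rule starlike_imp_connected)
qed auto

text \<open>
  Euler's integral for \<open>b \<integral> u powr (b - 1) / (1 - x * u) du\<close>, substituted by \<open>u = (1 - v) powr (1 / b)\<close>
  so that the integrand is bounded and depends holomorphically on \<open>x\<close>; the orientation of \<open>v\<close> makes
  the substitution in the path loss integral increasing.
\<close>

lemma hyp2F1_1_integral:
  assumes b: "0 < b" and x: "x < 1"
  shows "hyp2F1 1 b (1 + b) x = (LBINT v:{0..1}. 1 / (1 - x * (1 - v) powr (1 / b)))"
proof -
  let ?S = "- (complex_of_real ` {1..})"
  let ?h = "fps_hypergeo [1, complex_of_real b] [1 + of_real b] 1"
  define t where "t v = (1 - v) powr (1 / b)" for v
  have t: "t v \<in> {0..1}" if "v \<in> {0..1}" for v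
    using that b by (auto simp: t_def powr_le1)
  have cont_t: "continuous_on {0..1} t"
    unfolding t_def by (rule continuous_on_powr') (use b in \<open>auto intro!: continuous_intros\<close>)
  define F :: "complex \<Rightarrow> complex" where "F w = integral (cbox 0 1) (\<lambda>v. 1 / (1 - w * of_real (t v)))" for w
  have int: "(\<lambda>v. 1 / (1 - w * of_real (t v))) integrable_on cbox 0 1" if "w \<in> ?S" for w
    by (rule integrable_continuous)
       (use slit_plane_mult_neq_1[OF that] t cont_t in \<open>auto intro!: continuous_intros\<close>)
  \<comment> \<open>The Leibniz rule is applied on balls, which are convex, whereas the slit plane
    is not.\<close>
  have hol: "F holomorphic_on ?S"
    unfolding holomorphic_on_open[OF slit_plane(1)]
  proof
    fix w assume "w \<in> ?S"
    then obtain e where e: "0 < e" "ball w e \<subseteq> ?S" using slit_plane(1) openE by blast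
    have "F holomorphic_on ball w e"
      unfolding F_def
    proof (rule leibniz_rule_holomorphic[where fx = "\<lambda>w v. of_real (t v) / (1 - w * of_real (t v))\<^sup>2"])
      show "((\<lambda>w. 1 / (1 - w * of_real (t v))) has_field_derivative of_real (t v) / (1 - u * of_real (t v))\<^sup>2) (at u within ball w e)"
        if "u \<in> ball w e" "v \<in> cbox 0 1" for u v
      proof -
        have "1 - u * of_real (t v) \<noteq> 0" using that e t slit_plane_mult_neq_1[of u "t v"] by auto
        then show ?thesis
          by (auto intro!: derivative_eq_intros simp: power2_eq_square)
      qed
      show "(\<lambda>v. 1 / (1 - u * of_real (t v))) integrable_on cbox 0 1" if "u \<in> ball w e" for u
        using that e by (intro int) auto
      have "continuous_on (ball w e \<times> cbox 0 1) (\<lambda>x. t (snd x))"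
        by (rule continuous_on_compose2[OF cont_t]) (auto intro!: continuous_intros)
      then show "continuous_on (ball w e \<times> cbox 0 1) (\<lambda>(u, v). of_real (t v) / (1 - u * of_real (t v))\<^sup>2)"
        unfolding case_prod_unfold
        using slit_plane_mult_neq_1 t e by (intro continuous_intros) (auto simp: mem_Times_iff subset_iff)
    qed simp
    then show "\<exists>f'. (F has_field_derivative f') (at w)"
      using e(1) by (auto simp: holomorphic_on_open)
  qed
  \<comment> \<open>The integrand differs from a partial sum of the geometric series by
    \<open>y ^ N / (1 - y)\<close>, bounded uniformly in \<open>v\<close> because
    \<open>norm y \<le> norm w < 1\<close>. Termwise integration then needs only the moments of
    \<open>t\<close>.\<close>
  have sums: "(\<lambda>n. of_real (b / (b + n)) * w ^ n) sums F w" if w: "norm w < 1" for w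
  proof -
    have wS: "w \<in> ?S" using w by auto
    have bound: "norm (F w - (\<Sum>n<N. of_real (b / (b + n)) * w ^ n)) \<le> norm w ^ N / (1 - norm w)" for N
    proof -
      have "((\<lambda>v. 1 / (1 - w * of_real (t v)) - (\<Sum>n<N. of_real (t v ^ n) * w ^ n)) has_integral
              F w - (\<Sum>n<N. of_real (b / (b + n)) * w ^ n)) (cbox 0 1)"
        unfolding F_def using int[OF wS] integral_power_Beta_moment[OF b]
        by (intro has_integral_diff has_integral_sum has_integral_mult_left has_integral_of_real integrable_integral)
           (auto simp: t_def)
      moreover have "norm (1 / (1 - w * of_real (t v)) - (\<Sum>n<N. of_real (t v ^ n) * w ^ n)) \<le> norm w ^ N / (1 - norm w)"
        if "v \<in> cbox 0 1" for v
      proof -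
        define y where "y = w * of_real (t v)"
        have tv: "0 \<le> t v" "t v \<le> 1" using t[of v] that by auto
        have y: "norm y \<le> norm w" using tv by (simp add: y_def norm_mult mult_left_le)
        have ne: "1 - y \<noteq> 0" "y \<noteq> 1" using slit_plane_mult_neq_1[OF wS t[of v]] that by (auto simp: y_def)
        have "(\<Sum>n<N. of_real (t v ^ n) * w ^ n) = (\<Sum>n<N. y ^ n)"
          by (simp add: y_def power_mult_distrib mult.commute)
        also have "\<dots> = (1 - y ^ N) / (1 - y)"
          using ne by (simp add: sum_gp_strict)
        finally have "1 / (1 - y) - (\<Sum>n<N. of_real (t v ^ n) * w ^ n) = y ^ N / (1 - y)"
          by (simp add: diff_divide_distrib)
        moreover have "1 - norm w \<le> norm (1 - y)"
          using norm_triangle_ineq2[of 1 y] y by simp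
        ultimately show ?thesis
          using w y unfolding y_def[symmetric] by (auto simp: norm_divide norm_power intro!: frac_le power_mono)
      qed
      ultimately have "norm (F w - (\<Sum>n<N. of_real (b / (b + real n)) * w ^ n)) \<le> norm w ^ N / (1 - norm w) * measure lborel (cbox 0 (1 :: real))"
        using w by (intro has_integral_bound[where f = "\<lambda>v. 1 / (1 - w * of_real (t v)) - (\<Sum>n<N. of_real (t v ^ n) * w ^ n)"]) auto
      then show ?thesis by simp
    qed
    have "(\<lambda>N. norm w ^ N / (1 - norm w)) \<longlonglongrightarrow> 0"
      using w by (intro tendsto_divide_zero LIMSEQ_power_zero) auto
    then have "(\<lambda>N. F w - (\<Sum>n<N. of_real (b / (b + n)) * w ^ n)) \<longlonglongrightarrow> 0"
      by (rule Lim_null_comparison[OF always_eventually[OF allI[OF bound]]])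
    from tendsto_diff[OF tendsto_const this, of "F w"] show ?thesis by (simp add: sums_def)
  qed
  \<comment> \<open>The moments of \<open>t\<close> are the hypergeometric coefficients: the 1 among
    the upper parameters cancels the factorial, and the quotient of the other two Pochhammer symbols
    telescopes to \<open>b / (b + n)\<close>.\<close>
  have coeff: "of_real (b / (b + n)) = fps_nth ?h n" for n
  proof -
    have nz: "pochhammer (1 + complex_of_real b) n \<noteq> 0" 
      using b by (auto simp: pochhammer_eq_0_iff dest!: arg_cong[of _ _ Re])
    have "complex_of_real b * pochhammer (1 + of_real b) n = pochhammer (of_real b) n * (of_real b + of_nat n)"
      using pochhammer_rec[of "complex_of_real b" n] pochhammer_rec'[of "complex_of_real b" n]
      by (simp add: add.commute mult.commute)
    moreover have "complex_of_real b + of_nat n \<noteq> 0" using b by (auto simp: complex_eq_iff)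
    ultimately show ?thesis
      using nz by (simp add: pochhammer_fact[symmetric] field_simps)
  qed
  have "eventually (\<lambda>w. (\<lambda>n. fps_nth ?h n * w ^ n) sums F w) (nhds 0)"
    by (rule eventually_nhds_in_open[of "ball 0 1", THEN eventually_mono])
       (use sums in \<open>simp_all only: coeff, auto\<close>)
  then have exp: "F has_fps_expansion ?h" by (rule has_fps_expansionI)
  \<comment> \<open>\<open>F\<close> witnesses that the choice in \<open>hyp2F1_fun\<close> is not
    void. Whatever function is chosen agrees with \<open>F\<close> near 0, hence on the whole slit
    plane by the identity theorem.\<close>
  have "hyp2F1_fun 1 (of_real b) (1 + of_real b) holomorphic_on ?S \<and>
     hyp2F1_fun 1 (of_real b) (1 + of_real b) has_fps_expansion ?h"
    unfolding hyp2F1_fun_def by (rule someI[of _ F]) (use hol exp in auto)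
  moreover define g where "g = hyp2F1_fun 1 (of_real b) (1 + of_real b)"
  ultimately have g: "g holomorphic_on ?S" "g has_fps_expansion ?h" by auto
  have "eventually (\<lambda>w. g w - F w = 0) (nhds 0)"
    using g(2) exp unfolding has_fps_expansion_def by (auto elim: eventually_elim2)
  then obtain U where U: "open U" "0 \<in> U" "\<And>w. w \<in> U \<Longrightarrow> g w - F w = 0"
    by (auto simp: eventually_nhds)
  have xS: "complex_of_real x \<in> ?S" using x by auto
  have "g (of_real x) - F (of_real x) = 0"
  proof (rule analytic_continuation[where f = "\<lambda>w. g w - F w" and S = ?S and U = "U \<inter> ?S" and \<xi> = 0])
    show "0 islimpt U \<inter> ?S"
      using U slit_plane by (intro interior_limit_point) (auto simp: interior_open open_Int)
  qed (use g hol slit_plane U xS in \<open>auto intro!: holomorphic_intros\<close>)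
  then have "hyp2F1 1 b (1 + b) x = Re (F (of_real x))"
    by (simp add: hyp2F1_def g_def)
  also have "F (of_real x) = of_real (integral {0..1} (\<lambda>v. 1 / (1 - x * t v)))"
  proof -
    have "1 - x * t v \<noteq> 0" if "v \<in> {0..1}" for v
      using slit_plane_mult_neq_1[OF xS t[OF that]] by (metis of_real_1 of_real_diff of_real_mult of_real_0)
    then have "(\<lambda>v. 1 / (1 - x * t v)) integrable_on {0..1}"
      by (intro integrable_continuous_interval continuous_intros cont_t) auto
    then have "((\<lambda>v. complex_of_real (1 / (1 - x * t v))) has_integral of_real (integral {0..1} (\<lambda>v. 1 / (1 - x * t v)))) {0..1}"
      by (intro has_integral_of_real integrable_integral)
    then show ?thesis by (auto simp: F_def intro!: integral_unique)
  qed
  also have "Re (of_real (integral {0..1} (\<lambda>v. 1 / (1 - x * t v)))) = (LBINT v:{0..1}. 1 / (1 - x * t v))"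
  proof -
    have "1 - x * t v \<noteq> 0" if "v \<in> {0..1}" for v
      using slit_plane_mult_neq_1[OF xS t[OF that]] by (metis of_real_1 of_real_diff of_real_mult of_real_0)
    then have "set_integrable lborel {0..1} (\<lambda>v. 1 / (1 - x * t v))"
      by (intro borel_integrable_atLeastAtMost' continuous_intros cont_t) auto
    then show ?thesis by (simp add: set_borel_integral_eq_integral)
  qed
  finally show ?thesis by (simp add: t_def)
qed

text \<open>The case of interferers at arbitrary distance: helpers that do not store the content may
  be closer than the serving station. This is the source of \<open>H_fun\<close>.\<close>

lemma attenuation_bochner:
  assumes "2 < \<alpha>" "0 < c"
  shows "has_bochner_integral lborel (attenuation \<alpha> c) (pi * H_fun c \<alpha>)"
proof -
  have int: "set_integrable lborel {0<..} (\<lambda>s. s * (if 0 < s then c / (s powr \<alpha> + c) else 0))"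
    using pathloss_substitution_whole(1)[OF assms] by (rule set_integrable_cong[THEN iffD1, rotated -1]) auto
  have "has_bochner_integral lborel (\<lambda>x :: real ^ 2. (if 0 < norm x then c / (norm x powr \<alpha> + c) else 0))
     (2 * pi * (LBINT s:{0<..}. s * (if 0 < s then c / (s powr \<alpha> + c) else 0)))"
    using assms int
    by (intro polar_real2_set_integral) auto
  also have "2 * pi * (LBINT s:{0<..}. s * (if 0 < s then c / (s powr \<alpha> + c) else 0)) =
     pi * (2 * (LBINT s:{0<..}. s * (c / (s powr \<alpha> + c))))"
    by (simp, rule set_lebesgue_integral_cong) auto
  also have "\<dots> = pi * H_fun c \<alpha>" by (simp only: pathloss_substitution_whole(2)[OF assms])
  also have "(\<lambda>x :: real ^ 2. if 0 < norm x then c / (norm x powr \<alpha> + c) else 0) = attenuation \<alpha> c"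
    by (auto simp: attenuation_eq fun_eq_iff) (simp add: attenuation_def)
  finally show ?thesis .
qed

text \<open>The case of stations able to serve: they interfere only from beyond an exclusion radius.
  By scaling, the integral depends on \<open>c\<close> only through
  \<open>c / r powr \<alpha>\<close>, which equals the threshold in the applications.\<close>

lemma attenuation_outside_bochner:
  assumes \<alpha>: "2 < \<alpha>" and c: "0 < c" and r: "0 < r"
  shows "has_bochner_integral lborel (\<lambda>x. if r < norm x then attenuation \<alpha> c x else 0)
     (pi * r\<^sup>2 * G_fun (c / r powr \<alpha>) \<alpha>)"
proof -
  have int: "set_integrable lborel {r<..} (\<lambda>s. s * (if r < s then c / (s powr \<alpha> + c) else 0))"
    using pathloss_substitution_outside(1)[OF assms] by (rule set_integrable_cong[THEN iffD1, rotated -1]) auto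
  have "has_bochner_integral lborel (\<lambda>x :: real ^ 2. (if r < norm x then c / (norm x powr \<alpha> + c) else 0))
     (2 * pi * (LBINT s:{r<..}. s * (if r < s then c / (s powr \<alpha> + c) else 0)))"
    using assms int
    by (intro polar_real2_set_integral) auto
  also have "(LBINT s:{r<..}. s * (if r < s then c / (s powr \<alpha> + c) else 0)) = (LBINT s:{r<..}. s * (c / (s powr \<alpha> + c)))"
    by (rule set_lebesgue_integral_cong) auto
  also have "\<dots> = r\<^sup>2 * (c / r powr \<alpha>) / (\<alpha> - 2) * hyp2F1 1 (1 - 2 / \<alpha>) (1 + (1 - 2 / \<alpha>)) (- (c / r powr \<alpha>))"
  proof (subst hyp2F1_1_integral)
    have "0 \<le> c / r powr \<alpha>" using c by simp
    then show "- (c / r powr \<alpha>) < 1" by linarith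
    show "0 < 1 - 2 / \<alpha>" using \<alpha> by (simp add: field_simps) 
    have "1 / (1 - 2 / \<alpha>) = \<alpha> / (\<alpha> - 2)" using \<alpha> by (simp add: field_simps)
    then show "(LBINT s:{r<..}. s * (c / (s powr \<alpha> + c))) = r\<^sup>2 * (c / r powr \<alpha>) / (\<alpha> - 2) *
      (LBINT v:{0..1}. 1 / (1 - - (c / r powr \<alpha>) * (1 - v) powr (1 / (1 - 2 / \<alpha>))))"
      by (subst pathloss_substitution_outside(2)[OF assms]) simp
  qed
  also have "2 * pi * \<dots> = pi * r\<^sup>2 * G_fun (c / r powr \<alpha>) \<alpha>"
    by (simp add: G_fun_def)
  also have "(\<lambda>x :: real ^ 2. if r < norm x then c / (norm x powr \<alpha> + c) else 0) =
      (\<lambda>x. if r < norm x then attenuation \<alpha> c x else 0)"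
    using r by (auto simp: fun_eq_iff intro!: attenuation_eq[symmetric])
  finally show ?thesis .
qed

section \<open>Poisson processes\<close>

text \<open>For factors in the unit interval the partial products decrease, so their infimum is the
  infinite product. It always exists, also where the product diverges to 0 or a factor 0 encodes a
  forbidden point.\<close>

definition inf_prod :: "(nat \<Rightarrow> real) \<Rightarrow> real" where
  "inf_prod a = (INF m. \<Prod>j<m. a j)"

lemma decseq_prod_lessThan:
  assumes "\<And>j. 0 \<le> a j" "\<And>j. a j \<le> (1 :: real)"
  shows "decseq (\<lambda>m. \<Prod>j<m. a j)"
  unfolding decseq_Suc_iff using assms by (auto intro!: mult_right_le_one_le prod_nonneg)

lemma bdd_below_prod_lessThan:
  assumes "\<And>j. 0 \<le> (a j :: real)"
  shows "bdd_below (range (\<lambda>m. \<Prod>j<m. a j))"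
  using assms by (auto intro!: bdd_belowI[of _ 0] prod_nonneg)

lemma tendsto_inf_prod:
  assumes "\<And>j. 0 \<le> a j" "\<And>j. a j \<le> 1"
  shows "(\<lambda>m. \<Prod>j<m. a j) \<longlonglongrightarrow> inf_prod a"
  unfolding inf_prod_def using assms
  by (intro LIMSEQ_decseq_INF bdd_below_prod_lessThan decseq_prod_lessThan)

lemma inf_prod_le:
  assumes "\<And>j. 0 \<le> a j" shows "inf_prod a \<le> (\<Prod>j<m. a j)"
  unfolding inf_prod_def using assms by (intro cINF_lower bdd_below_prod_lessThan) auto

lemma inf_prod_bounds:
  assumes "\<And>j. 0 \<le> a j" shows "0 \<le> inf_prod a" "inf_prod a \<le> 1"
  using assms inf_prod_le[of a 0]
  by (auto simp: inf_prod_def intro!: cINF_greatest prod_nonneg)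

lemma inf_prod_mono:
  assumes "\<And>j. 0 \<le> a j" "\<And>j. a j \<le> b j"
  shows "inf_prod a \<le> inf_prod b"
  unfolding inf_prod_def using assms
  by (intro cINF_mono bdd_below_prod_lessThan) (auto intro!: exI prod_mono)

lemma inf_prod_eq_finite:
  assumes "\<And>j. 0 \<le> a j" "\<And>j. a j \<le> 1" "finite J" "\<And>j. j \<notin> J \<Longrightarrow> a j = 1"
  shows "inf_prod a = (\<Prod>j\<in>J. a j)"
proof (rule LIMSEQ_unique[OF tendsto_inf_prod tendsto_eventually])
  obtain m where m: "J \<subseteq> {..<m}"
    using finite_nat_bounded[OF \<open>finite J\<close>] by auto
  show "eventually (\<lambda>m. (\<Prod>j<m. a j) = (\<Prod>j\<in>J. a j)) sequentially"
    using eventually_ge_at_top[of m]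
  proof eventually_elim
    case (elim n)
    then have "J \<subseteq> {..<n}" using m by auto
    then show ?case using assms by (intro prod.mono_neutral_right) auto
  qed
qed (use assms in auto)

text \<open>The lower estimate is monotonicity. For the upper one a single finite partial product
  close to the infimum suffices, so no uniform control of the tails is required.\<close>

lemma tendsto_inf_prod_approx:
  assumes le: "\<And>n j. a j \<le> b n j" and b: "\<And>n j. b n j \<le> 1" and a: "\<And>j. 0 \<le> a j"
    and lim: "\<And>j. (\<lambda>n. b n j) \<longlonglongrightarrow> a j"
  shows "(\<lambda>n. inf_prod (b n)) \<longlonglongrightarrow> inf_prod a"
proof (rule order_tendstoI)
  have b0: "0 \<le> b n j" for n j using le a order_trans by blast
  fix y
  { assume "y < inf_prod a"
    then show "eventually (\<lambda>n. y < inf_prod (b n)) sequentially"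
      using inf_prod_mono[of a "b _"] a le by (intro always_eventually) (auto intro: less_le_trans) }
  { assume "inf_prod a < y"
    then obtain m where "(\<Prod>j<m. a j) < y"
      unfolding inf_prod_def using a by (subst (asm) cINF_less_iff) (auto intro!: bdd_below_prod_lessThan)
    moreover have "(\<lambda>n. \<Prod>j<m. b n j) \<longlonglongrightarrow> (\<Prod>j<m. a j)" by (intro tendsto_intros lim)
    ultimately have "eventually (\<lambda>n. (\<Prod>j<m. b n j) < y) sequentially"
      by (intro order_tendstoD)
    then show "eventually (\<lambda>n. inf_prod (b n) < y) sequentially"
      by (rule eventually_mono) (auto intro: le_less_trans[OF inf_prod_le] b0) }
qed

lemma borel_measurable_inf_prod [measurable]:
  assumes [measurable]: "\<And>j. (\<lambda>x. a x j) \<in> borel_measurable M"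
    and "\<And>x j. 0 \<le> a x j" "\<And>x j. a x j \<le> 1"
  shows "(\<lambda>x. inf_prod (a x)) \<in> borel_measurable M"
  by (rule borel_measurable_LIMSEQ_real[where u = "\<lambda>m x. \<Prod>j<m. a x j"])
     (auto intro!: tendsto_inf_prod assms)

text \<open>The bound ranges over the naturals so that summability becomes a countable combination
  of measurable conditions.\<close>

lemma summable_iff_partial_sums_bounded:
  assumes "\<And>j. 0 \<le> (g j :: real)"
  shows "summable g \<longleftrightarrow> (\<exists>C :: nat. \<forall>m. (\<Sum>j<m. g j) \<le> real C)"
proof
  assume "summable g"
  moreover obtain C where "suminf g \<le> real C" using real_arch_simple by blast
  ultimately show "\<exists>C :: nat. \<forall>m. (\<Sum>j<m. g j) \<le> real C"
    using sum_le_suminf[of g] assms by (meson finite_lessThan order_trans)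
next
  assume "\<exists>C :: nat. \<forall>m. (\<Sum>j<m. g j) \<le> real C"
  then obtain C where "(\<Sum>j<m. g j) \<le> real C" for m by blast
  from this[of "Suc _"] show "summable g"
    using assms by (intro bounded_imp_summable[where B = "real C"]) (auto simp: lessThan_Suc_atMost[symmetric] simp del: sum.lessThan_Suc)
qed

lemma pred_summable_nonneg [measurable]:
  assumes [measurable]: "\<And>j. (\<lambda>x. g x j) \<in> borel_measurable M" and "\<And>x j. 0 \<le> (g x j :: real)"
  shows "Measurable.pred M (\<lambda>x. summable (g x))"
  using assms(2) by (subst summable_iff_partial_sums_bounded) measurable

section \<open>Laplace functional and almost sure summability for Poisson processes\<close>

context prob_space begin

lemma poisson_processD:
  assumes "poisson_process \<mu> X"
  shows "random_variable borel (X j)"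
    and "B \<in> sets borel \<Longrightarrow> bounded B \<Longrightarrow> AE w in M. finite {j. X j w \<in> B}"
    and "B \<in> sets borel \<Longrightarrow> bounded B \<Longrightarrow> prob {w \<in> space M. num_points X B w = k} =
              (\<mu> * measure lborel B) ^ k / fact k * exp (- (\<mu> * measure lborel B))"
    and "(\<And>i. i < (m :: nat) \<Longrightarrow> C i \<in> sets borel) \<Longrightarrow> (\<And>i. i < m \<Longrightarrow> bounded (C i)) \<Longrightarrow>
      disjoint_family_on C {..<m} \<Longrightarrow> indep_vars (\<lambda>_. count_space UNIV) (\<lambda>i. num_points X (C i)) {..<m}"
proof -
  note PP = assms[unfolded poisson_process_def]
  show "random_variable borel (X j)" using PP by simp
  show "AE w in M. finite {j. X j w \<in> B}" if "B \<in> sets borel" "bounded B"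
    using PP[THEN conjunct2, THEN conjunct1] that by simp
  show "prob {w \<in> space M. num_points X B w = k} = (\<mu> * measure lborel B) ^ k / fact k * exp (- (\<mu> * measure lborel B))"
    if "B \<in> sets borel" "bounded B"
    using PP[THEN conjunct2, THEN conjunct1] that by simp
  show "indep_vars (\<lambda>_. count_space UNIV) (\<lambda>i. num_points X (C i)) {..<m}"
    if "\<And>i. i < m \<Longrightarrow> C i \<in> sets borel" "\<And>i. i < m \<Longrightarrow> bounded (C i)" "disjoint_family_on C {..<m}"
    using PP[THEN conjunct2, THEN conjunct2, rule_format, of m C] that by simp
qed

text \<open>Measurability of a count is contained in the independence clause, applied to a family
  consisting of one set.\<close>

lemma poisson_num_points_measurable:
  assumes "poisson_process \<mu> X" "B \<in> sets borel" "bounded B"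
  shows "num_points X B \<in> measurable M (count_space UNIV)"
proof -
  have "indep_vars (\<lambda>_. count_space UNIV) (\<lambda>i. num_points X B) {..<1::nat}"
    using assms by (intro poisson_processD(4)[where C = "\<lambda>_. B" and m = 1]) (auto simp: disjoint_family_on_def)
  then show ?thesis by (simp add: indep_vars_def)
qed

lemma nn_integral_nat_valued:
  assumes [measurable]: "N \<in> measurable M (count_space (UNIV :: nat set))"
  shows "(\<integral>\<^sup>+w. g (N w) \<partial>M) = (\<Sum>k. g k * emeasure M {w \<in> space M. N w = k})"
proof -
  have "(\<integral>\<^sup>+w. g (N w) \<partial>M) = (\<integral>\<^sup>+w. (\<Sum>k. g k * indicator {w \<in> space M. N w = k} w) \<partial>M)"
  proof (rule nn_integral_cong)
    fix w assume "w \<in> space M"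
    then have "(\<Sum>k. g k * indicator {w \<in> space M. N w = k} w) = (\<Sum>k\<in>{N w}. g k * indicator {w \<in> space M. N w = k} w)"
      by (intro suminf_finite) auto
    then show "g (N w) = (\<Sum>k. g k * indicator {w \<in> space M. N w = k} w)"
      using \<open>w \<in> space M\<close> by simp
  qed
  also have "\<dots> = (\<Sum>k. g k * emeasure M {w \<in> space M. N w = k})"
    by (subst nn_integral_suminf) (auto simp: nn_integral_cmult_indicator)
  finally show ?thesis .
qed

text \<open>This is the probability generating function of a Poisson count, evaluated at
  \<open>1 - c\<close>.\<close>

lemma poisson_expectation_power:
  assumes PP: "poisson_process \<mu> X" and \<mu>: "0 \<le> \<mu>" and B: "B \<in> sets borel" "bounded B" and c: "0 \<le> c" "c \<le> 1"
  shows "expectation (\<lambda>w. (1 - c) ^ num_points X B w) = exp (- (\<mu> * (c * measure lborel B)))"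
proof -
  note [measurable] = poisson_num_points_measurable[OF PP B]
  define m where "m = \<mu> * measure lborel B"
  have m: "0 \<le> m" using \<mu> by (simp add: m_def)
  have "(\<integral>\<^sup>+w. ennreal ((1 - c) ^ num_points X B w) \<partial>M) =
      (\<Sum>k. ennreal ((1 - c) ^ k) * emeasure M {w \<in> space M. num_points X B w = k})"
    by (rule nn_integral_nat_valued) measurable
  also have "\<dots> = (\<Sum>k. ennreal (exp (- m) * (((1 - c) * m) ^ k /\<^sub>R fact k)))"
  proof (rule suminf_cong)
    fix k
    have "(1 - c) ^ k * (m ^ k / fact k * exp (- m)) = exp (- m) * (((1 - c) * m) ^ k /\<^sub>R fact k)"
      by (simp add: power_mult_distrib divide_inverse)
    then show "ennreal ((1 - c) ^ k) * emeasure M {w \<in> space M. num_points X B w = k} =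
        ennreal (exp (- m) * (((1 - c) * m) ^ k /\<^sub>R fact k))"
      using c m by (simp add: emeasure_eq_measure poisson_processD(3)[OF PP B] m_def[symmetric] ennreal_mult[symmetric])
  qed
  also have "\<dots> = ennreal (exp (- m) * exp ((1 - c) * m))"
    using c m by (intro suminf_ennreal_eq sums_mult exp_converges) auto
  also have "exp (- m) * exp ((1 - c) * m) = exp (- (\<mu> * (c * measure lborel B)))"
    by (simp add: exp_add[symmetric] m_def algebra_simps)
  finally have *: "(\<integral>\<^sup>+w. ennreal ((1 - c) ^ num_points X B w) \<partial>M) = ennreal (exp (- (\<mu> * (c * measure lborel B))))" .
  show ?thesis
    using c by (subst integral_eq_nn_integral) (auto simp: *)
qed

text \<open>For a simple function on disjoint sets the product consists of powers
  \<open>(1 - c i) ^ N\<close> of the counts, which are independent by definition of the process.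
  The test function \<open>\<phi>\<close> keeps the count on a further disjoint set
  \<open>D\<close>; later \<open>D\<close> is the ring that holds the serving station.\<close>

lemma poisson_functional_simple:
  assumes PP: "poisson_process \<mu> X" and \<mu>: "0 \<le> \<mu>"
    and D: "D \<in> sets borel" "bounded D" and \<phi>: "\<And>k. \<bar>\<phi> k\<bar> \<le> (1 :: real)"
    and B: "\<And>i. i < m \<Longrightarrow> B i \<in> sets borel" "\<And>i. i < m \<Longrightarrow> bounded (B i)" "\<And>i. i < m \<Longrightarrow> B i \<inter> D = {}"
      "\<And>i i'. i < m \<Longrightarrow> i' < m \<Longrightarrow> i \<noteq> i' \<Longrightarrow> B i \<inter> B i' = {}"
    and c: "\<And>i. i < (m :: nat) \<Longrightarrow> 0 \<le> c i" "\<And>i. i < m \<Longrightarrow> c i \<le> 1"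
  shows "expectation (\<lambda>w. \<phi> (num_points X D w) * inf_prod (\<lambda>j. 1 - (\<Sum>i<m. c i * indicator (B i) (X j w)))) =
    expectation (\<lambda>w. \<phi> (num_points X D w)) * exp (- (\<mu> * (\<Sum>i<m. c i * measure lborel (B i))))"
proof -
  let ?s = "\<lambda>x. \<Sum>i<m. c i * indicator (B i) x"
  have s_in: "?s x = c i" if "i < m" "x \<in> B i" for x i
  proof -
    have "?s x = (\<Sum>k\<in>{i}. c k * indicator (B k) x)"
      using that B(4) by (intro sum.mono_neutral_right) (auto split: split_indicator)
    then show ?thesis using that by simp
  qed
  have s_out: "?s x = 0" if "\<And>i. i < m \<Longrightarrow> x \<notin> B i" for x
    using that by (intro sum.neutral) auto
  have s_bd: "0 \<le> ?s x" "?s x \<le> 1" for x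
    using s_in[of _ x] s_out[of x] c by (cases "\<exists>i<m. x \<in> B i"; force)+
  \<comment> \<open>Index \<open>m\<close> carries \<open>D\<close>, so that the independence clause
    is used once for all \<open>m + 1\<close> sets.\<close>
  define C where "C i = (if i < m then B i else D)" for i
  define Y where "Y i w = (if i < m then (1 - c i) ^ num_points X (C i) w else \<phi> (num_points X (C i) w))" for i w
  have C: "C i \<in> sets borel" "bounded (C i)" for i using B D by (auto simp: C_def)
  note [measurable] = poisson_num_points_measurable[OF PP C]
  have "indep_vars (\<lambda>_. count_space UNIV) (\<lambda>i. num_points X (C i)) {..<Suc m}"
    using B C by (intro poisson_processD(4)[OF PP]) (auto simp: disjoint_family_on_def C_def less_Suc_eq)
  from indep_vars_compose2[OF this, of "\<lambda>i k. if i < m then (1 - c i) ^ k else \<phi> k" "\<lambda>_. borel"]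
  have indep: "indep_vars (\<lambda>_. borel) Y {..<Suc m}"
    by (simp add: Y_def[abs_def])
  have intY: "integrable M (Y i)" for i
  proof (rule integrable_const_bound[where B = 1])
    show "AE w in M. norm (Y i w) \<le> 1"
      using c[of i] \<phi> by (auto simp: Y_def power_abs intro!: power_le_one)
  qed (simp add: Y_def[abs_def])
  \<comment> \<open>Finiteness lets the infinite product collapse to a finite one; on an infinite
    index set \<open>num_points\<close> would be 0 and the power would be 1.\<close>
  have "AE w in M. \<forall>i\<in>{..<m}. finite {j. X j w \<in> B i}"
    using B by (intro AE_finite_allI poisson_processD(2)[OF PP]) auto
  then have "AE w in M. inf_prod (\<lambda>j. 1 - ?s (X j w)) = (\<Prod>i<m. Y i w)"
  proof eventually_elim
    case (elim w)
    let ?J = "\<lambda>i. {j. X j w \<in> B i}"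
    have "inf_prod (\<lambda>j. 1 - ?s (X j w)) = (\<Prod>j\<in>(\<Union>i\<in>{..<m}. ?J i). 1 - ?s (X j w))"
      using elim s_bd s_out by (intro inf_prod_eq_finite) auto
    also have "\<dots> = (\<Prod>i<m. \<Prod>j\<in>?J i. 1 - ?s (X j w))"
      using elim B(4) by (intro prod.UNION_disjoint) fastforce+
    also have "\<dots> = (\<Prod>i<m. Y i w)"
    proof (rule prod.cong)
      fix i assume i: "i \<in> {..<m}"
      have "(\<Prod>j\<in>?J i. 1 - ?s (X j w)) = (\<Prod>j\<in>?J i. 1 - c i)"
        by (intro prod.cong refl arg_cong2[where f = minus] s_in) (use i in auto)
      then show "(\<Prod>j\<in>?J i. 1 - ?s (X j w)) = Y i w"
        using i by (simp only: prod_constant) (simp add: Y_def C_def num_points_def)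
    qed simp
    finally show ?case .
  qed
  then have "expectation (\<lambda>w. \<phi> (num_points X D w) * inf_prod (\<lambda>j. 1 - ?s (X j w))) = expectation (\<lambda>w. \<Prod>i<Suc m. Y i w)"
  proof (intro integral_cong_AE)
    have [measurable]: "X j \<in> borel_measurable M" for j by (rule poisson_processD(1)[OF PP])
    have s_meas: "(\<lambda>w. ?s (X j w)) \<in> borel_measurable M" for j
    proof (intro borel_measurable_sum borel_measurable_times borel_measurable_const)
      fix i assume "i \<in> {..<m}"
      then have "indicator (B i) \<in> borel_measurable borel" using B by simp
      from measurable_compose[OF \<open>X j \<in> borel_measurable M\<close> this]
      show "(\<lambda>w. indicator (B i) (X j w) :: real) \<in> borel_measurable M" .
    qed
    show "(\<lambda>w. \<phi> (num_points X D w) * inf_prod (\<lambda>j. 1 - ?s (X j w))) \<in> borel_measurable M"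
    proof (intro borel_measurable_times borel_measurable_inf_prod borel_measurable_diff borel_measurable_const s_meas)
      show "(\<lambda>w. \<phi> (num_points X D w)) \<in> borel_measurable M"
        using poisson_num_points_measurable[OF PP D] by measurable
      show "0 \<le> 1 - ?s (X j w)" "1 - ?s (X j w) \<le> 1" for j w
        using s_bd[of "X j w"] by linarith+
    qed
    show "(\<lambda>w. \<Prod>i<Suc m. Y i w) \<in> borel_measurable M"
      unfolding Y_def by simp
  qed (auto simp: Y_def C_def)
  also have "\<dots> = (\<Prod>i<Suc m. expectation (Y i))"
    by (intro indep_vars_lebesgue_integral indep intY) auto
  also have "\<dots> = (\<Prod>i<m. exp (- (\<mu> * (c i * measure lborel (B i))))) * expectation (\<lambda>w. \<phi> (num_points X D w))"
  proof -
    have "expectation (Y i) = exp (- (\<mu> * (c i * measure lborel (B i))))" if "i < m" for i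
      using that B c by (simp add: Y_def[abs_def] C_def poisson_expectation_power[OF PP \<mu>])
    moreover have "expectation (Y m) = expectation (\<lambda>w. \<phi> (num_points X D w))"
      by (simp add: Y_def[abs_def] C_def)
    ultimately show ?thesis by simp
  qed
  also have "(\<Prod>i<m. exp (- (\<mu> * (c i * measure lborel (B i))))) = exp (- (\<mu> * (\<Sum>i<m. c i * measure lborel (B i))))"
    by (simp add: exp_sum[symmetric] sum_negf sum_distrib_left)
  finally show ?thesis by (simp add: mult.commute)
qed

text \<open>
  The Laplace functional, written with \<open>1 - f\<close> in place of \<open>exp (- f)\<close> so that \<open>f = 1\<close> encodes a void event.
\<close>

lemma poisson_functional:
  assumes PP: "poisson_process \<mu> X" and \<mu>: "0 \<le> \<mu>"
    and D: "D \<in> sets borel" "bounded D" and \<phi>: "\<And>k. \<bar>\<phi> k\<bar> \<le> (1 :: real)"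
    and f: "integrable lborel f" "\<And>x. 0 \<le> f x" "\<And>x. f x \<le> 1" "\<And>x. x \<in> D \<Longrightarrow> f x = 0"
  shows "expectation (\<lambda>w. \<phi> (num_points X D w) * inf_prod (\<lambda>j. 1 - f (X j w))) =
    expectation (\<lambda>w. \<phi> (num_points X D w)) * exp (- (\<mu> * (\<integral>x. f x \<partial>lborel)))"
proof -
  have f_meas [measurable]: "f \<in> borel_measurable borel" using f(1) by simp
  have [measurable]: "X j \<in> borel_measurable M" for j by (rule poisson_processD(1)[OF PP])
  note [measurable] = poisson_num_points_measurable[OF PP D]
  obtain u where u: "incseq u" "\<And>i. simple_function borel (u i)" "\<And>x. bdd_above (range (\<lambda>i. u i x))"
      "\<And>i x. 0 \<le> u i x" "f = (SUP i. u i)"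
    using borel_measurable_implies_simple_function_sequence_real[OF f_meas f(2)] by blast
  have f_eq: "f x = (SUP i. u i x)" for x
    unfolding u(5) using u(3) by (subst Sup_fun_def) (simp add: image_image)
  have u_le: "u i x \<le> f x" for i x
    unfolding f_eq by (rule cSUP_upper) (use u(3) in auto)
  have u_lim: "(\<lambda>i. u i x) \<longlonglongrightarrow> f x" for x
    unfolding f_eq using u(1,3) by (intro LIMSEQ_incseq_SUP) (auto simp: incseq_def le_fun_def)
  have u_meas [measurable]: "u i \<in> borel_measurable borel" for i
    using u(2) borel_measurable_simple_function by blast
  \<comment> \<open>The cutoff to a ball of radius \<open>n\<close> makes all level sets bounded, as
    the clauses of \<open>poisson_process\<close> require.\<close>
  define g where "g n x = u n x * indicator (cball 0 (real n)) x" for n x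
  have g_meas [measurable]: "g n \<in> borel_measurable borel" for n
    unfolding g_def[abs_def] by (intro borel_measurable_times u_meas borel_measurable_indicator) auto
  have g_le: "g n x \<le> f x" and g_nonneg: "0 \<le> g n x" for n x
    using u_le[of n x] u(4)[of n x] f(2)[of x] by (auto simp: g_def split: split_indicator)
  have g_le1: "g n x \<le> 1" for n x using g_le f(3) order_trans by blast
  have g_lim: "(\<lambda>n. g n x) \<longlonglongrightarrow> f x" for x
  proof -
    obtain n0 where "norm x \<le> real n0" using real_arch_simple by blast
    then have "eventually (\<lambda>n. u n x = g n x) sequentially"
      by (intro eventually_sequentiallyI[of n0]) (auto simp: g_def)
    with u_lim show ?thesis by (rule Lim_transform_eventually)
  qed
  have step: "expectation (\<lambda>w. \<phi> (num_points X D w) * inf_prod (\<lambda>j. 1 - g n (X j w))) =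
    expectation (\<lambda>w. \<phi> (num_points X D w)) * exp (- (\<mu> * (\<integral>x. g n x \<partial>lborel)))" for n
  proof -
    have fin: "finite (range (u n))" using u(2)[of n] by (simp add: simple_function_def)
    define m where "m = card (range (u n))"
    obtain h where h: "bij_betw h {..<m} (range (u n))"
      using ex_bij_betw_nat_finite[OF fin] by (auto simp: m_def lessThan_atLeast0)
    \<comment> \<open>Removing \<open>D\<close> from the level sets changes nothing, because
      \<open>f\<close> and hence \<open>g n\<close> vanish there; it provides the disjointness from
      \<open>D\<close> that the simple case asks for.\<close>
    define B where "B i = {x \<in> cball 0 (real n) - D. u n x = h i}" for i
    have B_meas [measurable]: "B i \<in> sets borel" for i
    proof -
      have "B i = (cball 0 (real n) - D) \<inter> (u n -` {h i} \<inter> space borel)" by (auto simp: B_def)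
      also have "\<dots> \<in> sets borel"
        using D(1) by (intro sets.Int sets.Diff measurable_sets[OF u_meas]) auto
      finally show ?thesis .
    qed
    have B_bdd: "bounded (B i)" for i
      by (rule bounded_subset[OF bounded_cball[of 0 "real n"]]) (auto simp: B_def)
    have h_range: "h i \<in> range (u n)" if "i < m" for i using h that by (auto simp: bij_betw_def)
    have g_eq: "g n x = (\<Sum>i<m. h i * indicator (B i) x)" for x
    proof (cases "x \<in> cball 0 (real n) - D")
      case True
      obtain i where i: "i < m" "u n x = h i"
        using h by (metis bij_betw_def imageE lessThan_iff rangeI)
      have "(\<Sum>k<m. h k * indicator (B k) x) = (\<Sum>k\<in>{i}. h k * indicator (B k) x)"
        using i h by (intro sum.mono_neutral_right) (auto simp: B_def bij_betw_def inj_on_def split: split_indicator)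
      with True i show ?thesis by (simp add: g_def B_def)
    next
      case False
      then have "g n x = 0" using f(4)[of x] g_le[of n x] g_nonneg[of n x] by (auto simp: g_def)
      moreover have "(\<Sum>k<m. h k * indicator (B k) x) = 0" using False by (intro sum.neutral) (auto simp: B_def)
      ultimately show ?thesis by simp
    qed
    have "expectation (\<lambda>w. \<phi> (num_points X D w) * inf_prod (\<lambda>j. 1 - (\<Sum>i<m. h i * indicator (B i) (X j w)))) =
      expectation (\<lambda>w. \<phi> (num_points X D w)) * exp (- (\<mu> * (\<Sum>i<m. h i * measure lborel (B i))))"
    proof (rule poisson_functional_simple[OF PP \<mu> D \<phi>])
      show "B i \<inter> B i' = {}" if "i < m" "i' < m" "i \<noteq> i'" for i i'
        using h that by (auto simp: B_def bij_betw_def inj_on_def)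
      show "0 \<le> h i" "h i \<le> 1" if "i < m" for i
        using h_range[OF that] u(4) u_le f(3) order_trans by fastforce+
    qed (use B_meas B_bdd in \<open>auto simp: B_def\<close>)
    moreover have "(\<integral>x. g n x \<partial>lborel) = (\<Sum>i<m. h i * measure lborel (B i))"
    proof -
      have "integrable lborel (indicator (B i) :: real ^ 2 \<Rightarrow> real)" for i
        using emeasure_bounded_finite[OF B_bdd[of i]] by (intro integrable_real_indicator) (auto simp: less_top)
      then show ?thesis
        unfolding g_eq by (subst Bochner_Integration.integral_sum) (auto intro!: integrable_mult_right)
    qed
    ultimately show ?thesis unfolding g_eq by simp
  qed
  have "(\<lambda>n. expectation (\<lambda>w. \<phi> (num_points X D w) * inf_prod (\<lambda>j. 1 - g n (X j w)))) \<longlonglongrightarrow>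
      expectation (\<lambda>w. \<phi> (num_points X D w) * inf_prod (\<lambda>j. 1 - f (X j w)))"
  proof (rule integral_dominated_convergence[where w = "\<lambda>_. 1"])
    show "(\<lambda>w. \<phi> (num_points X D w) * inf_prod (\<lambda>j. 1 - f (X j w))) \<in> borel_measurable M"
      by (intro borel_measurable_times borel_measurable_inf_prod) (use f in auto)
    show "(\<lambda>w. \<phi> (num_points X D w) * inf_prod (\<lambda>j. 1 - g n (X j w))) \<in> borel_measurable M" for n
      by (intro borel_measurable_times borel_measurable_inf_prod) (use g_le1 g_nonneg in auto)
    show "AE w in M. (\<lambda>n. \<phi> (num_points X D w) * inf_prod (\<lambda>j. 1 - g n (X j w))) \<longlonglongrightarrow>
        \<phi> (num_points X D w) * inf_prod (\<lambda>j. 1 - f (X j w))"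
      by (intro always_eventually allI tendsto_mult_left tendsto_inf_prod_approx tendsto_diff tendsto_const g_lim)
         (use g_le g_nonneg f in auto)
    show "AE w in M. norm (\<phi> (num_points X D w) * inf_prod (\<lambda>j. 1 - g n (X j w))) \<le> 1" for n
    proof (rule AE_I2)
      fix w
      have "0 \<le> inf_prod (\<lambda>j. 1 - g n (X j w))" "inf_prod (\<lambda>j. 1 - g n (X j w)) \<le> 1"
        by (intro inf_prod_bounds; use g_le1 in simp)+
      then show "norm (\<phi> (num_points X D w) * inf_prod (\<lambda>j. 1 - g n (X j w))) \<le> 1"
        using \<phi> by (auto simp: abs_mult intro!: mult_le_one)
    qed
  qed simp
  moreover have "(\<lambda>n. \<integral>x. g n x \<partial>lborel) \<longlonglongrightarrow> (\<integral>x. f x \<partial>lborel)"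
    by (rule integral_dominated_convergence[where w = f])
       (use f(1) g_lim g_le g_nonneg in auto)
  then have "(\<lambda>n. expectation (\<lambda>w. \<phi> (num_points X D w)) * exp (- (\<mu> * (\<integral>x. g n x \<partial>lborel)))) \<longlonglongrightarrow>
     expectation (\<lambda>w. \<phi> (num_points X D w)) * exp (- (\<mu> * (\<integral>x. f x \<partial>lborel)))"
    by (intro tendsto_intros)
  ultimately show ?thesis unfolding step by (rule LIMSEQ_unique)
qed

lemma poisson_functional_plain:
  assumes PP: "poisson_process \<mu> X" and \<mu>: "0 \<le> \<mu>"
    and f: "integrable lborel f" "\<And>x. 0 \<le> f x" "\<And>x. f x \<le> 1"
  shows "expectation (\<lambda>w. inf_prod (\<lambda>j. 1 - f (X j w))) = exp (- (\<mu> * (\<integral>x. f x \<partial>lborel)))"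
  using poisson_functional[OF PP \<mu>, of "{}" "\<lambda>_. 1" f] f by (simp add: prob_space)

text \<open>
  Where the sum diverges, the product of the factors \<open>1 - s * f\<close> vanishes for every \<open>s > 0\<close>, while its
  mean tends to 1 as \<open>s\<close> tends to 0.
\<close>

lemma poisson_sum_finite:
  fixes f :: "real ^ 2 \<Rightarrow> real"
  assumes PP: "poisson_process \<mu> X" and \<mu>: "0 \<le> \<mu>"
    and f: "integrable lborel f" "\<And>x. 0 \<le> f x" "\<And>x. f x \<le> 1"
  shows "AE w in M. summable (\<lambda>j. f (X j w))"
proof -
  have f_meas [measurable]: "f \<in> borel_measurable borel" using f(1) by simp
  have X_meas [measurable]: "X j \<in> borel_measurable M" for j by (rule poisson_processD(1)[OF PP])
  define A where "A = {w \<in> space M. \<not> summable (\<lambda>j. f (X j w))}"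
  have A [measurable]: "A \<in> sets M"
  proof -
    have "Measurable.pred M (\<lambda>w. summable (\<lambda>j. f (X j w)))"
      using pred_summable_nonneg[of "\<lambda>w j. f (X j w)" M] f(2) by simp
    then show ?thesis unfolding A_def by measurable
  qed
  have le: "prob A \<le> 1 - exp (- (\<mu> * (s * (\<integral>x. f x \<partial>lborel))))" if s: "0 < s" "s \<le> 1" for s
  proof -
    have sf: "0 \<le> s * f x" "s * f x \<le> 1" for x
      using s f(2,3)[of x] by (auto intro: mult_le_one)
    let ?P = "\<lambda>w. inf_prod (\<lambda>j. 1 - s * f (X j w))"
    have P: "0 \<le> ?P w" "?P w \<le> 1" for w
      by (intro inf_prod_bounds; use sf in simp)+
    have P_meas [measurable]: "?P \<in> borel_measurable M"
      by (intro borel_measurable_inf_prod) (use sf in auto)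
    have "?P w = 0" if "w \<in> A" for w
    proof -
      have "\<not> summable (\<lambda>j. f (X j w))" using that by (simp add: A_def)
      have "?P w \<le> exp (- (s * real C))" for C
      proof -
        obtain m where m: "real C < (\<Sum>j<m. f (X j w))"
          using \<open>\<not> summable _\<close> f(2) by (subst (asm) summable_iff_partial_sums_bounded) (auto simp: not_le)
        have "?P w \<le> (\<Prod>j<m. 1 - s * f (X j w))" by (rule inf_prod_le) (use sf in simp)
        also have "\<dots> \<le> (\<Prod>j<m. exp (- (s * f (X j w))))"
          using sf exp_ge_add_one_self[of "- (s * f (X _ w))"] by (intro prod_mono) auto
        also have "\<dots> = exp (- (s * (\<Sum>j<m. f (X j w))))"
          by (simp add: exp_sum[symmetric] sum_negf sum_distrib_left)
        also have "\<dots> \<le> exp (- (s * real C))" using m s by simp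
        finally show ?thesis .
      qed
      moreover have "(\<lambda>C. exp (- (s * real C))) \<longlonglongrightarrow> 0" using s by real_asymp
      ultimately have "?P w \<le> 0" by (intro LIMSEQ_le_const[of _ 0 "?P w"]) auto
      with P show ?thesis by (simp add: antisym)
    qed
    then have "expectation ?P \<le> expectation (\<lambda>w. 1 - indicator A w)"
      using P by (intro integral_mono integrable_const_bound[where B = 1]) (auto split: split_indicator)
    moreover have "expectation ?P = exp (- (\<mu> * (s * (\<integral>x. f x \<partial>lborel))))"
      using poisson_functional_plain[OF PP \<mu>, of "\<lambda>x. s * f x"] f(1) sf by simp
    moreover have "expectation (\<lambda>w. 1 - indicator A w) = 1 - prob A"
    proof -
      have "integrable M (indicator A :: 'a \<Rightarrow> real)"
        by (rule integrable_const_bound[where B = 1]) (auto split: split_indicator)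
      then show ?thesis using A by (simp add: prob_space)
    qed
    ultimately show ?thesis by simp
  qed
  have "((\<lambda>s. 1 - exp (- (\<mu> * (s * (\<integral>x. f x \<partial>lborel))))) \<longlongrightarrow> 1 - exp (- (\<mu> * (0 * (\<integral>x. f x \<partial>lborel))))) (at_right 0)"
    by (intro tendsto_intros)
  then have "prob A \<le> 1 - exp (- (\<mu> * (0 * (\<integral>x. f x \<partial>lborel))))"
    by (rule tendsto_lowerbound) (use le in \<open>auto simp: eventually_at_right_field intro!: exI[of _ 1]\<close>)
  then have "prob A = 0" by (simp add: measure_le_0_iff)
  then show ?thesis
    using A by (subst AE_iff_measurable[OF A]) (auto simp: A_def emeasure_eq_measure)
qed

end

section \<open>Measurability and independent sources\<close>

lemma all_station: "(\<forall>s. P s) \<longleftrightarrow> (\<forall>j. P (MBS j)) \<and> (\<forall>j. P (Helper j))"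
  by (metis station.exhaust)

lemma UNIV_station: "UNIV = range MBS \<union> range Helper"
  by (auto simp: image_iff) (metis station.exhaust)

lemma nat_summable_on_real_iff: "(f :: nat \<Rightarrow> real) summable_on UNIV \<longleftrightarrow> summable (\<lambda>j. \<bar>f j\<bar>)"
  by (subst summable_on_iff_abs_summable_on_real) (simp add: summable_on_UNIV_nonneg_real_iff)

text \<open>The unordered sum over stations is reduced to two ordinary series, whose convergence and
  value are measurable.\<close>

lemma station_summable_on_iff:
  fixes t :: "station \<Rightarrow> real"
  shows "t summable_on UNIV \<longleftrightarrow> summable (\<lambda>j. \<bar>t (MBS j)\<bar>) \<and> summable (\<lambda>j. \<bar>t (Helper j)\<bar>)"
proof -
  have "t summable_on UNIV \<longleftrightarrow> t summable_on range MBS \<and> t summable_on range Helper"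
    unfolding UNIV_station
    using summable_on_Un_disjoint[of t "range MBS" "range Helper"]
      summable_on_subset_banach[of t "range MBS \<union> range Helper" "range MBS"]
      summable_on_subset_banach[of t "range MBS \<union> range Helper" "range Helper"]
    by auto
  also have "\<dots> \<longleftrightarrow> (t \<circ> MBS) summable_on UNIV \<and> (t \<circ> Helper) summable_on UNIV"
    by (simp add: summable_on_reindex inj_def)
  finally show ?thesis by (simp add: nat_summable_on_real_iff)
qed

lemma station_infsum:
  fixes t :: "station \<Rightarrow> real"
  assumes "summable (\<lambda>j. \<bar>t (MBS j)\<bar>)" "summable (\<lambda>j. \<bar>t (Helper j)\<bar>)"
  shows "infsum t UNIV = (\<Sum>j. t (MBS j)) + (\<Sum>j. t (Helper j))"
proof -
  have "infsum t UNIV = infsum t (range MBS) + infsum t (range Helper)"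
    unfolding UNIV_station
  proof (rule infsum_Un_disjoint)
    show "t summable_on range MBS" "t summable_on range Helper"
      using assms by (simp_all add: summable_on_reindex inj_def nat_summable_on_real_iff)
  qed auto
  also have "\<dots> = infsum (t \<circ> MBS) UNIV + infsum (t \<circ> Helper) UNIV"
    by (simp add: infsum_reindex inj_def)
  also have "infsum (t \<circ> MBS) UNIV = (\<Sum>j. t (MBS j))"
    using norm_summable_imp_has_sum[of "t \<circ> MBS" "\<Sum>j. t (MBS j)"] summable_rabs_cancel[OF assms(1)] assms(1)
    by (intro infsumI) (simp add: summable_sums comp_def)
  also have "infsum (t \<circ> Helper) UNIV = (\<Sum>j. t (Helper j))"
    using norm_summable_imp_has_sum[of "t \<circ> Helper" "\<Sum>j. t (Helper j)"] summable_rabs_cancel[OF assms(2)] assms(2)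
    by (intro infsumI) (simp add: summable_sums comp_def)
  finally show ?thesis .
qed

definition interferer :: "(nat \<Rightarrow> 'w \<Rightarrow> bool) \<Rightarrow> 'w \<Rightarrow> station \<Rightarrow> station \<Rightarrow> bool" where
  "interferer active w s0 s \<longleftrightarrow> s \<noteq> s0 \<and> transmits active w s"

lemma interference_eq_infsum:
  "interference p loc fading active w s0 =
     infsum (\<lambda>s. of_bool (interferer active w s0 s) * (fading s w * mean_rx_power p loc s w)) UNIV"
  unfolding interference_def
  by (rule infsum_cong_neutral) (auto simp: interferer_def)

text \<open>The branch 0 is the value of \<open>infsum\<close> on a family that is not summable.
  Spelling it out makes the interference measurable on the whole sample space rather than only
  almost everywhere.\<close>

lemma interference_eq:
  fixes p loc fading active w s0
  defines "t \<equiv> \<lambda>s. of_bool (interferer active w s0 s) * (fading s w * mean_rx_power p loc s w)"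
  shows "interference p loc fading active w s0 =
    (if summable (\<lambda>j. \<bar>t (MBS j)\<bar>) \<and> summable (\<lambda>j. \<bar>t (Helper j)\<bar>)
     then (\<Sum>j. t (MBS j)) + (\<Sum>j. t (Helper j)) else 0)"
  unfolding interference_eq_infsum t_def[symmetric]
  using station_infsum[of t] station_summable_on_iff[of t] infsum_not_exists[of t UNIV] by auto

lemma measurable_mean_rx_power:
  assumes [measurable]: "loc s \<in> borel_measurable N"
  shows "(\<lambda>w. mean_rx_power p loc s w) \<in> borel_measurable N"
  unfolding mean_rx_power_def by measurable

lemma measurable_interferer:
  assumes [measurable]: "\<And>j. Measurable.pred N (active j)"
  shows "Measurable.pred N (\<lambda>w. interferer active w s0 s)"
  unfolding interferer_def by (cases s) simp_all

text \<open>The fading of \<open>s0\<close> is left out of the assumptions so that the interference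
  is measurable with respect to all other sources, hence independent of the fading of the serving
  station.\<close>

lemma measurable_interference:
  assumes [measurable]: "\<And>s. loc s \<in> borel_measurable N" "\<And>j. Measurable.pred N (active j)"
    and fading: "\<And>s. s \<noteq> s0 \<Longrightarrow> fading s \<in> borel_measurable N"
  shows "(\<lambda>w. interference p loc fading active w s0) \<in> borel_measurable N"
proof -
  have t: "(\<lambda>w. of_bool (interferer active w s0 s) * (fading s w * mean_rx_power p loc s w)) \<in> borel_measurable N" for s
  proof (cases "s = s0")
    case False
    note [measurable] = fading[OF False] measurable_interferer[where N = N and active = active] measurable_mean_rx_power[where N = N and loc = loc]
    show ?thesis by measurable
  qed (simp add: interferer_def)
  have "Measurable.pred N (\<lambda>w. summable (\<lambda>j. \<bar>of_bool (interferer active w s0 (h j)) *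
      (fading (h j) w * mean_rx_power p loc (h j) w)\<bar>))" for h :: "nat \<Rightarrow> station"
    by (rule pred_summable_nonneg) (use t in auto)
  then show ?thesis
    unfolding interference_eq
    by (intro measurable_If borel_measurable_add borel_measurable_suminf t predE pred_intros_logic(3)) simp_all
qed

lemma pred_is_serving:
  assumes [measurable]: "\<And>s. loc s \<in> borel_measurable N" "\<And>j. Measurable.pred N (stores j n)"
  shows "Measurable.pred N (\<lambda>w. is_serving p loc stores n w s0)"
proof -
  note [measurable] = measurable_mean_rx_power[where N = N and loc = loc]
  have [measurable]: "Measurable.pred N (\<lambda>w. can_serve stores n w s)" for s by (cases s) simp_all
  show ?thesis unfolding is_serving_def all_station by measurable
qed

lemma measurable_SINR:
  assumes [measurable]: "\<And>s. loc s \<in> borel_measurable N" "\<And>j. Measurable.pred N (active j)"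
    "\<And>s. fading s \<in> borel_measurable N"
  shows "(\<lambda>w. SINR p loc fading active w s0) \<in> borel_measurable N"
proof -
  note [measurable] = measurable_mean_rx_power[where N = N and loc = loc] measurable_interference[where N = N and loc = loc and active = active and fading = fading]
  show ?thesis unfolding SINR_def by measurable
qed

text \<open>Access success with the load taken out: for load \<open>l + 1\<close> the rate
  requirement is the condition on the SINR with \<open>\<delta> = delta1 p l\<close>.\<close>

definition covered ::
  "net_params \<Rightarrow> (station \<Rightarrow> 'w \<Rightarrow> real ^ 2) \<Rightarrow> (station \<Rightarrow> 'w \<Rightarrow> real) \<Rightarrow> (nat \<Rightarrow> nat \<Rightarrow> 'w \<Rightarrow> bool)
     \<Rightarrow> (nat \<Rightarrow> 'w \<Rightarrow> bool) \<Rightarrow> nat \<Rightarrow> real \<Rightarrow> 'w \<Rightarrow> bool" where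
  "covered p loc fading stores active n \<delta> w \<longleftrightarrow>
     (\<exists>j. is_serving p loc stores n w (MBS j) \<and> \<delta> \<le> SINR p loc fading active w (MBS j))"

lemma pred_covered:
  assumes [measurable]: "\<And>s. loc s \<in> borel_measurable N" "\<And>j. Measurable.pred N (active j)"
    "\<And>s. fading s \<in> borel_measurable N" "\<And>j. Measurable.pred N (stores j n)"
  shows "Measurable.pred N (covered p loc fading stores active n \<delta>)"
proof -
  note [measurable] = measurable_SINR[where N = N and loc = loc and active = active and fading = fading] pred_is_serving[where N = N and loc = loc and stores = stores]
  show ?thesis unfolding covered_def[abs_def] by measurable
qed

section \<open>Splitting a sample point along disjoint groups of independent sources\<close>

context prob_space begin

text \<open>A group of sources is represented by the sigma-algebra it generates on the given sample
  space, so that no product space has to be built for the model.\<close>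

definition src_algebra :: "('s \<Rightarrow> 'a set set) \<Rightarrow> 's set \<Rightarrow> 'a measure" where
  "src_algebra F K = sigma (space M) (\<Union>s\<in>K. F s)"

context
  fixes F :: "'s \<Rightarrow> 'a set set"
  assumes indep: "indep_sets F UNIV" and stable: "\<And>s. Int_stable (F s)"
begin

lemma indep_subset_events: "F s \<subseteq> events"
  using indep by (auto simp: indep_sets_def)

lemma space_src_algebra [simp]: "space (src_algebra F K) = space M"
  by (simp add: src_algebra_def space_measure_of_conv)

lemma sets_src_algebra: "sets (src_algebra F K) = sigma_sets (space M) (\<Union>s\<in>K. F s)"
  unfolding src_algebra_def using indep_subset_events sets.sets_into_space by (intro sets_measure_of) blast

lemma sets_src_algebra_subset: "sets (src_algebra F K) \<subseteq> events"
  unfolding sets_src_algebra using indep_subset_events by (intro sets.sigma_sets_subset) auto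

lemma measurable_src_algebraD: "f \<in> measurable (src_algebra F K) N \<Longrightarrow> f \<in> measurable M N"
  using sets_src_algebra_subset[of K] by (auto simp: measurable_def)

lemma measurable_src_algebraI:
  assumes "f \<in> space M \<rightarrow> space N" "sets (vimage_algebra (space M) f N) \<subseteq> F s" "s \<in> K"
  shows "f \<in> measurable (src_algebra F K) N"
proof (rule measurableI)
  fix A assume "A \<in> sets N"
  then have "f -` A \<inter> space M \<in> F s" using assms(2) in_vimage_algebra by blast
  then show "f -` A \<inter> space (src_algebra F K) \<in> sets (src_algebra F K)"
    using assms(3) by (auto simp: sets_src_algebra)
qed (use assms in auto)

lemma indep_src_algebra:
  assumes "disjoint_family_on I J"
  shows "indep_sets (\<lambda>j. sets (src_algebra F (I j))) J"
  unfolding sets_src_algebra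
  using indep_sets_mono_index[OF subset_UNIV indep] stable assms by (intro indep_sets_collect_sigma) auto

lemma indep_vars_src_algebra:
  assumes "disjoint_family_on I J" "\<And>j. j \<in> J \<Longrightarrow> X j \<in> measurable (src_algebra F (I j)) (N j)"
  shows "indep_vars N X J"
  unfolding indep_vars_def2
proof (intro conjI ballI)
  show "X j \<in> measurable M (N j)" if "j \<in> J" for j
    using assms(2)[OF that] by (rule measurable_src_algebraD)
  show "indep_sets (\<lambda>j. {X j -` A \<inter> space M |A. A \<in> sets (N j)}) J"
    using indep_src_algebra[OF assms(1)]
  proof (rule indep_sets_mono_sets)
    show "{X j -` A \<inter> space M |A. A \<in> sets (N j)} \<subseteq> sets (src_algebra F (I j))" if "j \<in> J" for j
      using measurable_sets[OF assms(2)[OF that]] by auto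
  qed
qed

lemma indep_var_src_algebra:
  assumes "K1 \<inter> K2 = {}" "X \<in> measurable (src_algebra F K1) S" "Y \<in> measurable (src_algebra F K2) T"
  shows "indep_var S X T Y"
  unfolding indep_var_def using assms
  by (intro indep_vars_src_algebra[where I = "case_bool K1 K2"])
     (auto simp: disjoint_family_on_def split: bool.split)

text \<open>
  Independence lets one evaluate disjoint groups of sources at two separate sample points.
\<close>

lemma nn_integral_src_algebra:
  assumes K: "K1 \<inter> K2 = {}"
    and f: "case_prod f \<in> borel_measurable (src_algebra F K1 \<Otimes>\<^sub>M src_algebra F K2)"
  shows "(\<integral>\<^sup>+w. f w w \<partial>M) = (\<integral>\<^sup>+w1. \<integral>\<^sup>+w2. f w1 w2 \<partial>M \<partial>M)"
proof -
  let ?S = "src_algebra F K1" and ?T = "src_algebra F K2"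
  note [measurable] = f
  have id: "(\<lambda>w. w) \<in> measurable M (src_algebra F K)" for K
    using sets_src_algebra_subset by (auto simp: measurable_def)
  note [measurable] = id
  \<comment> \<open>The identity map serves as a random variable for either sigma-algebra.
    Independence of its two versions says that the law of the diagonal \<open>(w, w)\<close> is the
    product measure.\<close>
  have "indep_var ?S (\<lambda>w. w) ?T (\<lambda>w. w)"
    by (rule indep_var_src_algebra[OF K]) simp_all
  then have eq: "distr M ?S (\<lambda>w. w) \<Otimes>\<^sub>M distr M ?T (\<lambda>w. w) = distr M (?S \<Otimes>\<^sub>M ?T) (\<lambda>w. (w, w))"
    by (simp add: indep_var_distribution_eq)
  interpret T: prob_space "distr M ?T (\<lambda>w. w)" by (rule prob_space_distr) simp
  have "(\<integral>\<^sup>+w. f w w \<partial>M) = (\<integral>\<^sup>+x. case_prod f x \<partial>distr M (?S \<Otimes>\<^sub>M ?T) (\<lambda>w. (w, w)))"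
    by (subst nn_integral_distr) simp_all
  also have "\<dots> = (\<integral>\<^sup>+w1. \<integral>\<^sup>+w2. f w1 w2 \<partial>distr M ?T (\<lambda>w. w) \<partial>distr M ?S (\<lambda>w. w))"
    unfolding eq[symmetric] by (subst T.nn_integral_fst[symmetric]) simp_all
  also have "\<dots> = (\<integral>\<^sup>+w1. \<integral>\<^sup>+w2. f w1 w2 \<partial>distr M ?T (\<lambda>w. w) \<partial>M)"
    by (subst nn_integral_distr) simp_all
  also have "\<dots> = (\<integral>\<^sup>+w1. \<integral>\<^sup>+w2. f w1 w2 \<partial>M \<partial>M)"
  proof (rule nn_integral_cong)
    fix w1 assume w1: "w1 \<in> space M"
    have "f w1 \<in> borel_measurable ?T"
      using measurable_Pair2[OF f, of w1] w1 by simp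
    then show "(\<integral>\<^sup>+w2. f w1 w2 \<partial>distr M ?T (\<lambda>w. w)) = (\<integral>\<^sup>+w2. f w1 w2 \<partial>M)"
      by (subst nn_integral_distr) simp_all
  qed
  finally show ?thesis .
qed

lemma prob_src_algebra:
  assumes K: "K1 \<inter> K2 = {}"
    and P: "Measurable.pred (src_algebra F K1 \<Otimes>\<^sub>M src_algebra F K2) (case_prod P)"
  shows "ennreal (prob {w \<in> space M. P w w}) = (\<integral>\<^sup>+w1. ennreal (prob {w2 \<in> space M. P w1 w2}) \<partial>M)"
proof -
  let ?f = "\<lambda>w1 w2. indicator {x. P (fst x) (snd x)} (w1, w2) :: ennreal"
  have id: "(\<lambda>w. w) \<in> measurable M (src_algebra F K)" for K
    using sets_src_algebra_subset by (auto simp: measurable_def)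
  have sec: "Measurable.pred M (P w1)" if "w1 \<in> space M" for w1
    using measurable_Pair2[OF P, of w1] that by (auto intro: measurable_src_algebraD)
  have diag: "Measurable.pred M (\<lambda>w. P w w)"
    using measurable_compose[OF measurable_Pair[OF id id] P] by simp
  have "case_prod ?f \<in> borel_measurable (src_algebra F K1 \<Otimes>\<^sub>M src_algebra F K2)"
    using P by (simp add: case_prod_unfold)
  from nn_integral_src_algebra[OF K this]
  have "(\<integral>\<^sup>+w. indicator {w \<in> space M. P w w} w \<partial>M) = (\<integral>\<^sup>+w1. \<integral>\<^sup>+w2. indicator {w2 \<in> space M. P w1 w2} w2 \<partial>M \<partial>M)"
    by (auto simp: indicator_def cong: nn_integral_cong_simp)
  also have "\<dots> = (\<integral>\<^sup>+w1. ennreal (prob {w2 \<in> space M. P w1 w2}) \<partial>M)"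
    using sec by (intro nn_integral_cong) (simp add: emeasure_eq_measure)
  finally show ?thesis using diag by (simp add: emeasure_eq_measure)
qed

lemma expectation_prod_src_algebra:
  assumes K: "K1 \<inter> K2 = {}"
    and X: "X \<in> borel_measurable (src_algebra F K1)" "integrable M X"
    and Y: "Y \<in> borel_measurable (src_algebra F K2)" "integrable M (Y :: 'a \<Rightarrow> real)"
  shows "expectation (\<lambda>w. X w * Y w) = expectation X * expectation Y"
  using indep_var_src_algebra[OF K X(1) Y(1)] X(2) Y(2) by (rule indep_var_lebesgue_integral)

end

end

section \<open>Thinning functions\<close>

lemma AE_norm_neq_real2: "AE x in lborel. norm (x :: real ^ 2) \<noteq> r"
proof -
  have "(\<integral>\<^sup>+x. indicator {r} (norm (x :: real ^ 2)) \<partial>lborel) = (\<integral>\<^sup>+s. ennreal (2 * pi * s) * indicator {r} s * indicator {0<..} s \<partial>lborel)"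
    by (rule polar_real2) simp
  also have "\<dots> = 0"
  proof (subst nn_integral_0_iff_AE)
    show "AE s in lborel. ennreal (2 * pi * s) * indicator {r} s * indicator {0<..} s = 0"
      using AE_lborel_singleton[of r] by eventually_elim simp
  qed simp
  finally have "AE x in lborel. indicator {r} (norm (x :: real ^ 2)) = (0 :: ennreal)"
    by (subst (asm) nn_integral_0_iff_AE) auto
  then show ?thesis by (rule eventually_mono) (auto split: split_indicator_asm)
qed

lemma measure_disc_real2: "0 \<le> r \<Longrightarrow> measure lborel (cball (0 :: real ^ 2) r) = pi * r\<^sup>2"
  using emeasure_disc_real2[of r] by (simp add: measure_def)

lemma measure_ring_real2:
  assumes "0 \<le> a" "a \<le> b"
  shows "measure lborel (cball (0 :: real ^ 2) b - cball 0 a) = pi * (b\<^sup>2 - a\<^sup>2)"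
  using assms by (subst measure_Diff) (auto simp: measure_disc_real2 emeasure_disc_real2 algebra_simps)

lemma disc_bochner:
  assumes "0 \<le> r" shows "has_bochner_integral lborel (\<lambda>x :: real ^ 2. if norm x \<le> r then 1 else 0) (pi * r\<^sup>2)"
proof -
  have "has_bochner_integral lborel (indicator (cball (0 :: real ^ 2) r) :: _ \<Rightarrow> real) (measure lborel (cball (0 :: real ^ 2) r))"
    using assms by (intro has_bochner_integral_real_indicator) (auto simp: emeasure_disc_real2)
  also have "(indicator (cball (0 :: real ^ 2) r) :: _ \<Rightarrow> real) = (\<lambda>x. if norm x \<le> r then 1 else 0)"
    by (auto simp: fun_eq_iff)
  finally show ?thesis using assms by (simp add: measure_disc_real2)
qed

text \<open>
  Value 1 empties the disc of radius \<open>a\<close>; value 0 on the ring spares the serving station, which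
  does not interfere.
\<close>

definition macro_thinning :: "real \<Rightarrow> real \<Rightarrow> real \<Rightarrow> real \<Rightarrow> real \<Rightarrow> real ^ 2 \<Rightarrow> real" where
  "macro_thinning \<alpha> \<delta> a b z x = (if norm x \<le> a then 1 else if norm x \<le> b then 0 else attenuation \<alpha> (\<delta> * z powr \<alpha>) x)"

lemma macro_thinning_bounds:
  "0 \<le> \<delta> \<Longrightarrow> 0 \<le> macro_thinning \<alpha> \<delta> a b z x" "0 \<le> \<delta> \<Longrightarrow> macro_thinning \<alpha> \<delta> a b z x \<le> 1"
  by (auto simp: macro_thinning_def attenuation_bounds)

lemma borel_measurable_macro_thinning [measurable]: "macro_thinning \<alpha> \<delta> a b z \<in> borel_measurable borel"
  unfolding macro_thinning_def[abs_def] by measurable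

lemma macro_thinning_mono:
  assumes "0 \<le> \<delta>" "0 \<le> z" "z \<le> z'" "0 < \<alpha>"
  shows "macro_thinning \<alpha> \<delta> a b z x \<le> macro_thinning \<alpha> \<delta> a b z' x"
  using assms by (auto simp: macro_thinning_def intro!: attenuation_mono mult_left_mono powr_mono2)

lemma macro_thinning_integrable:
  assumes "2 < \<alpha>" "0 < \<delta>" "0 < z" "0 \<le> a"
  shows "integrable lborel (macro_thinning \<alpha> \<delta> a b z)"
proof (rule Bochner_Integration.integrable_bound)
  have c: "0 < \<delta> * z powr \<alpha>" using assms by simp
  show "integrable lborel (\<lambda>x :: real ^ 2. (if norm x \<le> a then 1 else 0) + attenuation \<alpha> (\<delta> * z powr \<alpha>) x)"
    using disc_bochner[OF assms(4)] attenuation_bochner[OF assms(1) c]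
    by (intro Bochner_Integration.integrable_add) (auto simp: has_bochner_integral_iff)
  show "AE x in lborel. norm (macro_thinning \<alpha> \<delta> a b z x) \<le> norm ((if norm x \<le> a then 1 else 0) + attenuation \<alpha> (\<delta> * z powr \<alpha>) x)"
    using c attenuation_bounds(1)[of "\<delta> * z powr \<alpha>" \<alpha>] by (intro AE_I2) (auto simp: macro_thinning_def)
qed measurable

text \<open>At \<open>z = b\<close> attenuation is integrated exactly from radius \<open>b\<close>
  on, so the value is exact. At \<open>z = a\<close> the term with \<open>G_fun\<close> also counts
  attenuation over the ring, where the thinning is 0; as attenuation is at most 1, the excess is at
  most the area of the ring.\<close>

lemma macro_thinning_integral:
  assumes \<alpha>: "2 < \<alpha>" and \<delta>: "0 < \<delta>" and ab: "0 < a" "a < b"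
  shows "(\<integral>x. macro_thinning \<alpha> \<delta> a b b x \<partial>lborel) = pi * a\<^sup>2 + pi * b\<^sup>2 * G_fun \<delta> \<alpha>" (is ?A)
    and "pi * a\<^sup>2 + pi * a\<^sup>2 * G_fun \<delta> \<alpha> - pi * (b\<^sup>2 - a\<^sup>2) \<le> (\<integral>x. macro_thinning \<alpha> \<delta> a b a x \<partial>lborel)" (is ?B)
proof -
  have "has_bochner_integral lborel
      (\<lambda>x :: real ^ 2. (if norm x \<le> a then 1 else 0) + (if b < norm x then attenuation \<alpha> (\<delta> * b powr \<alpha>) x else 0))
      (pi * a\<^sup>2 + pi * b\<^sup>2 * G_fun (\<delta> * b powr \<alpha> / b powr \<alpha>) \<alpha>)"
    using assms by (intro has_bochner_integral_add disc_bochner attenuation_outside_bochner) auto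
  moreover have "(\<lambda>x :: real ^ 2. (if norm x \<le> a then 1 else 0) + (if b < norm x then attenuation \<alpha> (\<delta> * b powr \<alpha>) x else 0)) =
      macro_thinning \<alpha> \<delta> a b b"
    using ab by (auto simp: fun_eq_iff macro_thinning_def)
  ultimately show ?A using ab by (simp add: has_bochner_integral_iff)
  have h: "has_bochner_integral lborel
      (\<lambda>x :: real ^ 2. (if norm x \<le> a then 1 else 0) + (if a < norm x then attenuation \<alpha> (\<delta> * a powr \<alpha>) x else 0) -
         ((if norm x \<le> b then 1 else 0) - (if norm x \<le> a then 1 else 0)))
      (pi * a\<^sup>2 + pi * a\<^sup>2 * G_fun (\<delta> * a powr \<alpha> / a powr \<alpha>) \<alpha> - (pi * b\<^sup>2 - pi * a\<^sup>2))"
    using assms by (intro has_bochner_integral_add has_bochner_integral_diff disc_bochner attenuation_outside_bochner) auto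
  have "pi * a\<^sup>2 + pi * a\<^sup>2 * G_fun (\<delta> * a powr \<alpha> / a powr \<alpha>) \<alpha> - (pi * b\<^sup>2 - pi * a\<^sup>2) \<le> (\<integral>x. macro_thinning \<alpha> \<delta> a b a x \<partial>lborel)"
    unfolding has_bochner_integral_integral_eq[OF h, symmetric]
  proof (rule integral_mono)
    show "integrable lborel (macro_thinning \<alpha> \<delta> a b a)" using assms by (intro macro_thinning_integrable) auto
    show "integrable lborel (\<lambda>x :: real ^ 2. (if norm x \<le> a then 1 else 0) + (if a < norm x then attenuation \<alpha> (\<delta> * a powr \<alpha>) x else 0) -
         ((if norm x \<le> b then 1 else 0) - (if norm x \<le> a then 1 else 0)))"
      using h by (simp add: has_bochner_integral_iff)
    show "(if norm x \<le> a then 1 else 0) + (if a < norm x then attenuation \<alpha> (\<delta> * a powr \<alpha>) x else 0) -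
         ((if norm x \<le> b then 1 else 0) - (if norm x \<le> a then 1 else 0)) \<le> macro_thinning \<alpha> \<delta> a b a x" for x :: "real ^ 2"
      using ab \<delta> attenuation_bounds[of "\<delta> * a powr \<alpha>" \<alpha> x] by (auto simp: macro_thinning_def)
  qed
  then show ?B using ab by (simp add: algebra_simps)
qed

text \<open>Complement of the factor of one helper at \<open>y\<close> after averaging its marks: a
  helper stronger than a macro station at distance \<open>z\<close> must not store the content, and
  whether it stores or not it interferes when active. The attenuation constant is the threshold over
  the serving power, times the helper power.\<close>

definition helper_thinning :: "net_params \<Rightarrow> real \<Rightarrow> real \<Rightarrow> real ^ 2 \<Rightarrow> real" where
  "helper_thinning p \<delta> z y = 1 -
     (if power2 p * norm y powr - alpha p \<le> power1 p * z powr - alpha p then 1 else 1 - p_Lp p) *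
     (1 - p_active p * attenuation (alpha p) (\<delta> * z powr alpha p * (power2 p / power1 p)) y)"

lemma borel_measurable_helper_thinning [measurable]: "helper_thinning p \<delta> z \<in> borel_measurable borel"
  unfolding helper_thinning_def[abs_def] by measurable

lemma helper_thinning_bounds:
  assumes "valid_params p" "0 \<le> \<delta>" "0 \<le> p_Lp p" "p_Lp p \<le> 1" "0 \<le> p_active p" "p_active p \<le> 1"
  shows "0 \<le> helper_thinning p \<delta> z y" "helper_thinning p \<delta> z y \<le> 1"
proof -
  let ?A = "attenuation (alpha p) (\<delta> * z powr alpha p * (power2 p / power1 p)) y"
  have "0 \<le> ?A" "?A \<le> 1" using assms by (auto intro!: attenuation_bounds simp: valid_params_def)
  then have "0 \<le> 1 - p_active p * ?A" "1 - p_active p * ?A \<le> 1"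
    using assms by (auto intro: mult_le_one)
  then show "0 \<le> helper_thinning p \<delta> z y" "helper_thinning p \<delta> z y \<le> 1"
    using assms by (auto simp: helper_thinning_def intro: mult_le_one)
qed

lemma helper_thinning_mono:
  assumes v: "valid_params p" and \<delta>: "0 \<le> \<delta>" and z: "0 < z" "z \<le> z'"
    and pr: "0 \<le> p_Lp p" "p_Lp p \<le> 1" "0 \<le> p_active p" "p_active p \<le> 1"
  shows "helper_thinning p \<delta> z y \<le> helper_thinning p \<delta> z' y"
proof -
  let ?A = "\<lambda>z. attenuation (alpha p) (\<delta> * z powr alpha p * (power2 p / power1 p)) y"
  have "0 \<le> ?A z'" "?A z' \<le> 1" using v \<delta> by (auto intro!: attenuation_bounds simp: valid_params_def)
  then have 1: "0 \<le> 1 - p_active p * ?A z'" using pr by (auto intro: mult_le_one)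
  have "?A z \<le> ?A z'"
    using v \<delta> z by (intro attenuation_mono mult_right_mono mult_left_mono powr_mono2) (auto simp: valid_params_def)
  then have 2: "1 - p_active p * ?A z' \<le> 1 - p_active p * ?A z" using pr by (simp add: mult_left_mono)
  have "power1 p * z' powr - alpha p \<le> power1 p * z powr - alpha p"
    using v z by (intro mult_left_mono powr_mono2') (auto simp: valid_params_def)
  then have 3: "(if power2 p * norm y powr - alpha p \<le> power1 p * z' powr - alpha p then 1 else 1 - p_Lp p)
      \<le> (if power2 p * norm y powr - alpha p \<le> power1 p * z powr - alpha p then 1 else 1 - p_Lp p)"
    using pr by auto
  have 4: "0 \<le> (if power2 p * norm y powr - alpha p \<le> power1 p * z powr - alpha p then 1 else 1 - p_Lp p)"
    using pr by auto
  show ?thesis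
    unfolding helper_thinning_def by (rule diff_left_mono, rule mult_mono; fact)
qed

text \<open>The thinning is a mixture. With weight \<open>1 - p_Lp p\<close> the helper does not
  store and interferes from anywhere, which gives \<open>H_fun\<close>; with weight
  \<open>p_Lp p\<close> it is excluded from a disc and interferes from outside, which gives the 1
  and \<open>G_fun\<close>. Both integrals scale with the squared radius of that disc, hence the
  exponent 2/\<alpha> in \<open>\<rho>\<close>.\<close>

lemma helper_thinning_bochner:
  assumes v: "valid_params p" and \<delta>: "0 < \<delta>" and z: "0 < z"
  defines "\<rho> \<equiv> (power2 p / power1 p) powr (2 / alpha p)"
  shows "has_bochner_integral lborel (helper_thinning p \<delta> z)
    (pi * z\<^sup>2 * \<rho> * ((1 - p_Lp p) * p_active p * H_fun \<delta> (alpha p) + p_Lp p * (1 + p_active p * G_fun \<delta> (alpha p))))"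
proof -
  let ?\<alpha> = "alpha p"
  have pp: "2 < ?\<alpha>" "0 < power1 p" "0 < power2 p" using v by (auto simp: valid_params_def)
  define c where "c = \<delta> * z powr ?\<alpha> * (power2 p / power1 p)"
  \<comment> \<open>At distance \<open>r\<close> a helper has the same mean received power as a
    macro station at distance \<open>z\<close>.\<close>
  define r where "r = z * (power2 p / power1 p) powr (1 / ?\<alpha>)"
  have c: "0 < c" using \<delta> z pp by (simp add: c_def)
  have r: "0 < r" using z pp by (simp add: r_def)
  have r2: "r\<^sup>2 = z\<^sup>2 * \<rho>"
    by (simp add: r_def \<rho>_def power_mult_distrib power2_eq_square[of "_ powr _"] powr_add[symmetric])
  have r\<alpha>: "r powr ?\<alpha> = z powr ?\<alpha> * (power2 p / power1 p)"
    using z pp by (simp add: r_def powr_mult powr_powr)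
  have cr: "c / r powr ?\<alpha> = \<delta>" using z pp unfolding r\<alpha> by (simp add: c_def)
  have Hc: "H_fun c ?\<alpha> = z\<^sup>2 * \<rho> * H_fun \<delta> ?\<alpha>"
  proof -
    have "(\<delta> * z powr ?\<alpha> * w) powr (2 / ?\<alpha>) = \<delta> powr (2 / ?\<alpha>) * z\<^sup>2 * w powr (2 / ?\<alpha>)" if "0 < w" for w
      using that z pp \<delta> by (simp add: powr_mult powr_powr)
    from this[of "power2 p / power1 p"] show ?thesis using pp by (simp add: H_fun_def c_def \<rho>_def)
  qed
  have "has_bochner_integral lborel (\<lambda>y :: real ^ 2. (1 - p_Lp p) * p_active p * attenuation ?\<alpha> c y +
      p_Lp p * ((if norm y \<le> r then 1 else 0) + p_active p * (if r < norm y then attenuation ?\<alpha> c y else 0)))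
    ((1 - p_Lp p) * p_active p * (pi * H_fun c ?\<alpha>) + p_Lp p * (pi * r\<^sup>2 + p_active p * (pi * r\<^sup>2 * G_fun (c / r powr ?\<alpha>) ?\<alpha>)))"
    using pp c r by (intro has_bochner_integral_add has_bochner_integral_mult_right attenuation_bochner disc_bochner attenuation_outside_bochner) auto
  also have "(1 - p_Lp p) * p_active p * (pi * H_fun c ?\<alpha>) + p_Lp p * (pi * r\<^sup>2 + p_active p * (pi * r\<^sup>2 * G_fun (c / r powr ?\<alpha>) ?\<alpha>)) =
    pi * z\<^sup>2 * \<rho> * ((1 - p_Lp p) * p_active p * H_fun \<delta> ?\<alpha> + p_Lp p * (1 + p_active p * G_fun \<delta> ?\<alpha>))"
    unfolding cr Hc r2 by (simp add: algebra_simps)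
  finally show ?thesis
  proof (rule has_bochner_integral_cong_AE[THEN iffD1, rotated -1])
    show "AE y in lborel. (1 - p_Lp p) * p_active p * attenuation ?\<alpha> c y +
      p_Lp p * ((if norm y \<le> r then 1 else 0) + p_active p * (if r < norm y then attenuation ?\<alpha> c y else 0)) = helper_thinning p \<delta> z y"
      \<comment> \<open>Two null sets are discarded: the circle of radius \<open>r\<close>, where
        the received powers tie, and the origin, where \<open>0 powr\<close> is 0 and the helper
        would count as the weakest instead of the strongest.\<close>
      using AE_norm_neq_real2[of r] AE_norm_neq_real2[of 0]
    proof eventually_elim
      case (elim y)
      have y: "0 < norm y" using elim by simp
      have "power2 p * norm y powr - ?\<alpha> \<le> power1 p * z powr - ?\<alpha> \<longleftrightarrow> z powr ?\<alpha> * (power2 p / power1 p) \<le> norm y powr ?\<alpha>"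
        using y z pp by (simp add: powr_minus field_simps)
      also have "\<dots> \<longleftrightarrow> r powr ?\<alpha> \<le> norm y powr ?\<alpha>" by (simp add: r\<alpha>)
      also have "\<dots> \<longleftrightarrow> r \<le> norm y"
      proof
        assume le: "r powr ?\<alpha> \<le> norm y powr ?\<alpha>"
        show "r \<le> norm y"
        proof (rule ccontr)
          assume "\<not> r \<le> norm y"
          then have "norm y powr ?\<alpha> < r powr ?\<alpha>" using pp by (intro powr_less_mono2) auto
          with le show False by simp
        qed
      next
        assume "r \<le> norm y"
        then show "r powr ?\<alpha> \<le> norm y powr ?\<alpha>" using r pp by (intro powr_mono2) auto
      qed
      finally show ?case using elim(1) unfolding helper_thinning_def c_def[symmetric] by (auto simp: algebra_simps)
    qed
  qed auto
qed

section \<open>Coverage for fixed locations\<close>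

text \<open>A factor 0 at bad indices lets one product carry both a constraint on all stations and
  their total interference.\<close>

lemma inf_prod_exp_indicator:
  assumes "summable u" "\<And>k. 0 \<le> (u k :: real)"
  shows "inf_prod (\<lambda>k. (if bad k then 0 else 1) * exp (- u k)) = (if \<exists>k. bad k then 0 else exp (- suminf u))"
proof (rule LIMSEQ_unique[OF tendsto_inf_prod])
  show "0 \<le> (if bad j then 0 else 1) * exp (- u j)" "(if bad j then 0 else 1) * exp (- u j) \<le> 1" for j
    using assms(2) by auto
  show "(\<lambda>m. \<Prod>k<m. (if bad k then 0 else 1) * exp (- u k)) \<longlonglongrightarrow> (if \<exists>k. bad k then 0 else exp (- suminf u))"
  proof (cases "\<exists>k. bad k")
    case True
    then obtain k where k: "bad k" by blast
    have "eventually (\<lambda>m. (\<Prod>k<m. (if bad k then 0 else 1) * exp (- u k)) = 0) sequentially"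
      using eventually_gt_at_top[of k] by eventually_elim (use k in \<open>auto simp: prod_zero_iff\<close>)
    then show ?thesis using True by (simp add: tendsto_eventually)
  next
    case False
    then have "(\<Prod>k<m. (if bad k then 0 else 1) * exp (- u k)) = exp (- (\<Sum>k<m. u k))" for m
      by (simp add: exp_sum[symmetric] sum_negf)
    moreover have "(\<lambda>m. exp (- (\<Sum>k<m. u k))) \<longlonglongrightarrow> exp (- suminf u)"
      by (intro tendsto_exp tendsto_minus summable_LIMSEQ assms)
    ultimately show ?thesis using False by simp
  qed
qed

lemma inf_prod_exp:
  assumes "summable u" "\<And>k. 0 \<le> (u k :: real)"
  shows "inf_prod (\<lambda>k. exp (- u k)) = exp (- suminf u)"
  using inf_prod_exp_indicator[OF assms, of "\<lambda>_. False"] by simp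

context prob_space begin

lemma exponential_nonneg_AE:
  assumes "distributed M lborel X (exponential_density 1)"
  shows "AE w in M. 0 < X w"
proof -
  have "X \<in> borel_measurable M" using assms by (simp add: distributed_def)
  then show ?thesis
    using exponential_distributedD_gt[OF assms, of 0] by (subst prob_Collect_eq_1[symmetric]) auto
qed

lemma exponential_tail:
  assumes D: "distributed M lborel X (exponential_density 1)" and a: "0 \<le> a"
  shows "prob {w \<in> space M. a \<le> X w} = exp (- a)"
proof -
  have [measurable]: "X \<in> borel_measurable M" using D by (simp add: distributed_def)
  have "emeasure M (X -` {a} \<inter> space M) = (\<integral>\<^sup>+x. ennreal (exponential_density 1 x) * indicator {a} x \<partial>lborel)"
    by (rule distributed_emeasure[OF D]) simp
  also have "\<dots> = 0"
    using AE_lborel_singleton[of a] by (subst nn_integral_0_iff_AE) (auto elim: eventually_mono)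
  finally have "AE w in M. X w \<noteq> a"
    by (subst AE_iff_measurable[where N = "X -` {a} \<inter> space M"]) auto
  then have "prob {w \<in> space M. a \<le> X w} = prob {w \<in> space M. a < X w}"
    by (intro finite_measure_eq_AE) (auto elim!: eventually_mono)
  also have "\<dots> = exp (- a)"
    using exponential_distributedD_gt[OF D a] by simp
  finally show ?thesis .
qed

text \<open>\<open>max 0\<close> is inserted because the fading is positive only almost surely,
  while the factors of \<open>inf_prod\<close> have to lie in the unit interval at every sample
  point.\<close>

lemma exponential_laplace:
  assumes D: "distributed M lborel X (exponential_density 1)" and s: "0 \<le> s"
  shows "expectation (\<lambda>w. exp (- (s * max 0 (X w)))) = 1 / (1 + s)"
proof -
  have [measurable]: "X \<in> borel_measurable M" using D by (simp add: distributed_def)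
  have "(\<integral>\<^sup>+w. ennreal (exp (- (s * max 0 (X w)))) \<partial>M)
      = (\<integral>\<^sup>+x. exponential_density 1 x * ennreal (exp (- (s * max 0 x))) \<partial>lborel)"
    by (rule distributed_nn_integral[OF D, symmetric]) simp
  also have "\<dots> = (\<integral>\<^sup>+x. ennreal (1 / (1 + s)) * ennreal (exponential_density (1 + s) x) \<partial>lborel)"
  proof (rule nn_integral_cong)
    fix x :: real
    show "ennreal (exponential_density 1 x) * ennreal (exp (- (s * max 0 x))) = ennreal (1 / (1 + s)) * ennreal (exponential_density (1 + s) x)"
    proof (cases "x < 0")
      case False
      then have "exp (- x) * exp (- (s * max 0 x)) = exp (- x * (1 + s))"
        by (simp add: exp_add[symmetric] algebra_simps)
      also have "\<dots> = 1 / (1 + s) * ((1 + s) * exp (- x * (1 + s)))"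
        using s by simp
      finally show ?thesis
        using s False by (simp add: exponential_density_def ennreal_mult[symmetric])
    qed (simp add: exponential_density_def)
  qed
  also have "\<dots> = ennreal (1 / (1 + s))"
  proof -
    interpret P: prob_space "density lborel (exponential_density (1 + s))"
      by (rule prob_space_exponential_density) (use s in simp)
    have "(\<integral>\<^sup>+x. ennreal (exponential_density (1 + s) x) \<partial>lborel) = 1"
      using P.emeasure_space_1 by (simp add: emeasure_density)
    then show ?thesis by (simp add: nn_integral_cmult)
  qed
  finally show ?thesis using s by (subst integral_eq_nn_integral) auto
qed

lemma exponential_nn_mean:
  assumes D: "distributed M lborel X (exponential_density 1)"
  shows "(\<integral>\<^sup>+w. ennreal (max 0 (X w)) \<partial>M) = 1"
proof -
  have [measurable]: "X \<in> borel_measurable M" using D by (simp add: distributed_def)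
  have pos: "AE w in M. 0 < X w" by (rule exponential_nonneg_AE[OF D])
  have "expectation X = 1" using exponential_distributed_expectation[OF _ D] by simp
  then have "integrable M X" using not_integrable_integral_eq[of M X] by auto
  then have "(\<integral>\<^sup>+w. ennreal (X w) \<partial>M) = 1"
    using pos \<open>expectation X = 1\<close> by (subst nn_integral_eq_integral) (auto elim: eventually_mono)
  moreover have "(\<integral>\<^sup>+w. ennreal (max 0 (X w)) \<partial>M) = (\<integral>\<^sup>+w. ennreal (X w) \<partial>M)"
    using pos by (intro nn_integral_cong_AE) (auto elim!: eventually_mono)
  ultimately show ?thesis by simp
qed

lemma bernoulli_expectation:
  fixes f :: "bool \<Rightarrow> real"
  assumes b: "0 \<le> b" "b \<le> 1" and [measurable]: "X \<in> measurable M (count_space UNIV)"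
    and D: "distr M (count_space UNIV) X = measure_pmf (bernoulli_pmf b)"
  shows "expectation (\<lambda>w. f (X w)) = f True * b + f False * (1 - b)"
proof -
  have "expectation (\<lambda>w. f (X w)) = (\<integral>x. f x \<partial>distr M (count_space UNIV) X)"
    by (simp add: integral_distr)
  also have "\<dots> = f True * b + f False * (1 - b)" unfolding D using b by simp
  finally show ?thesis .
qed

end

lemma p_Lp_bounds:
  assumes "valid_params p" shows "0 \<le> p_Lp p" "p_Lp p \<le> 1"
proof -
  have *: "num_first p < num_contents p" "num_cached p \<le> num_contents p - num_first p"
    using assms by (auto simp: valid_params_def)
  then have "real (num_cached p) \<le> real (num_contents p) - real (num_first p)" by linarith
  with * show "0 \<le> p_Lp p" "p_Lp p \<le> 1" by (auto simp: p_Lp_def divide_simps)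
qed

lemma Q_Lp_nonneg:
  assumes "valid_params p" shows "0 \<le> Q_Lp p"
proof -
  let ?a = "\<lambda>k. real k powr - zipf p"
  have "(\<Sum>n = 1..num_first p. ?a n) \<le> (\<Sum>n = 1..num_contents p. ?a n)"
    using assms by (intro sum_mono2) (auto simp: valid_params_def)
  moreover have "0 \<le> (\<Sum>n = 1..num_contents p. ?a n)" by (intro sum_nonneg) simp
  ultimately have "(\<Sum>n = 1..num_first p. ?a n) / (\<Sum>n = 1..num_contents p. ?a n) \<le> 1"
    by (auto simp: divide_le_eq_1 less_le)
  then show ?thesis by (simp add: Q_Lp_def Q_Mp_def request_prob_def sum_divide_distrib)
qed

lemma p_active_bounds:
  assumes v: "valid_params p" shows "0 \<le> p_active p" "p_active p \<le> 1"
proof -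
  have "0 \<le> p_Lp p * lambda2 p * power2 p powr (2 / alpha p)"
    using p_Lp_bounds[OF v] v by (simp add: valid_params_def)
  moreover have "0 < lambda1 p * power1 p powr (2 / alpha p)"
    using v by (auto simp: valid_params_def)
  ultimately have "A_Lp1 p \<le> 1" by (simp add: A_Lp1_def divide_simps)
  then have "0 \<le> A2 p" using Q_Lp_nonneg[OF v] by (simp add: A2_def A_Lp2_def)
  then have "1 \<le> 1 + A2 p * lambda_u p / (3.5 * lambda2 p)" using v by (simp add: valid_params_def)
  then have "(1 + A2 p * lambda_u p / (3.5 * lambda2 p)) powr (- 3.5) \<le> 1 powr (- 3.5)"
    by (intro powr_mono2') auto
  then show "0 \<le> p_active p" "p_active p \<le> 1" by (auto simp: p_active_def)
qed

context cache_network begin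

lemma valid: "2 < alpha p" "0 < lambda1 p" "0 < lambda2 p" "0 < power1 p" "0 < power2 p" "0 < bandwidth p"
  "0 < rate_req p" "0 \<le> noise p"
  using params by (auto simp: valid_params_def)

context
  fixes n assumes n: "n \<in> second_group p"
begin

definition src :: "source set \<Rightarrow> 'w measure" where
  "src = src_algebra (source_events M loc fading stores active load1 n)"

lemma Int_stable_source_events: "Int_stable (source_events M loc fading stores active load1 n s)"
  by (cases s) (simp_all add: sets.Int_stable)

lemmas space_src [simp] = space_src_algebra[OF independence[OF n] Int_stable_source_events, folded src_def]
lemmas measurable_from_src = measurable_src_algebraD[OF independence[OF n] Int_stable_source_events, folded src_def]
lemmas measurable_srcI = measurable_src_algebraI[OF independence[OF n] Int_stable_source_events, folded src_def]
lemmas indep_vars_src = indep_vars_src_algebra[OF independence[OF n] Int_stable_source_events, folded src_def]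
lemmas prob_src = prob_src_algebra[OF independence[OF n] Int_stable_source_events, folded src_def]
lemmas expectation_prod_src = expectation_prod_src_algebra[OF independence[OF n] Int_stable_source_events, folded src_def]

lemma loc_MBS_src: "MBS_locs \<in> K \<Longrightarrow> loc (MBS j) \<in> borel_measurable (src K)"
  by (rule measurable_compose[OF measurable_srcI[where s = MBS_locs] measurable_component_singleton[of j UNIV], where f = "\<lambda>w j. loc (MBS j) w"])
     (auto simp: space_PiM)

lemma loc_Helper_src: "Helper_locs \<in> K \<Longrightarrow> loc (Helper j) \<in> borel_measurable (src K)"
  by (rule measurable_compose[OF measurable_srcI[where s = Helper_locs] measurable_component_singleton[of j UNIV], where f = "\<lambda>w j. loc (Helper j) w"])
     (auto simp: space_PiM)

lemma loc_src: "MBS_locs \<in> K \<Longrightarrow> Helper_locs \<in> K \<Longrightarrow> loc s \<in> borel_measurable (src K)"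
  by (cases s) (auto intro: loc_MBS_src loc_Helper_src)

lemma fading_src: "Fading s \<in> K \<Longrightarrow> fading s \<in> borel_measurable (src K)"
  by (rule measurable_srcI[where s = "Fading s"]) auto

lemma stores_src: "Storing j \<in> K \<Longrightarrow> stores j n \<in> measurable (src K) (count_space UNIV)"
  by (rule measurable_srcI[where s = "Storing j"]) auto

lemma active_src: "Activity j \<in> K \<Longrightarrow> active j \<in> measurable (src K) (count_space UNIV)"
  by (rule measurable_srcI[where s = "Activity j"]) auto

lemma load1_src: "Load \<in> K \<Longrightarrow> load1 \<in> measurable (src K) (count_space UNIV)"
  by (rule measurable_srcI[where s = Load]) auto

lemma loc_measurable [measurable]: "loc s \<in> borel_measurable M"
  by (rule measurable_from_src[OF loc_src[of UNIV]]) auto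

lemma fading_measurable [measurable]: "fading s \<in> borel_measurable M"
  by (rule measurable_from_src[OF fading_src[of _ UNIV]]) auto

lemma stores_measurable [measurable]: "stores j n \<in> measurable M (count_space UNIV)"
  using n by (rule storing_measurable)

declare activity_measurable [measurable] load1_measurable [measurable]

lemma fading_pos_AE: "AE w in M. \<forall>s. 0 < fading s w"
  unfolding all_station AE_conj_iff AE_all_countable by (auto intro: exponential_nonneg_AE fading_law)

text \<open>Fading has mean 1, so the faded series has the finite expectation
  \<open>suminf u\<close> and therefore converges almost surely.\<close>

lemma summable_faded_AE:
  assumes "summable u" "\<And>j. 0 \<le> u j"
  shows "AE w in M. summable (\<lambda>j. max 0 (fading (h j) w) * u j)"
proof -
  have "(\<integral>\<^sup>+w. (\<Sum>j. ennreal (max 0 (fading (h j) w) * u j)) \<partial>M) = (\<Sum>j. (\<integral>\<^sup>+w. ennreal (max 0 (fading (h j) w) * u j) \<partial>M))"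
    by (rule nn_integral_suminf) simp
  also have "\<dots> = (\<Sum>j. ennreal (u j))"
    using assms by (intro suminf_cong) (simp add: ennreal_mult nn_integral_multc exponential_nn_mean[OF fading_law, simplified])
  also have "\<dots> < \<infinity>" using assms by (simp add: suminf_ennreal2 less_top[symmetric])
  finally have "AE w in M. (\<Sum>j. ennreal (max 0 (fading (h j) w) * u j)) \<noteq> \<infinity>"
    by (intro nn_integral_PInf_AE) auto
  then show ?thesis
    by (rule eventually_mono) (rule summable_suminf_not_top, use assms in auto)
qed

text \<open>All randomness attached to a station apart from its location. These groups are disjoint
  for distinct stations, so functions of them are independent across stations.\<close>

definition mark_sources :: "station \<Rightarrow> source set" where
  "mark_sources s = (case s of MBS i \<Rightarrow> {Fading (MBS i)} | Helper k \<Rightarrow> {Fading (Helper k), Storing k, Activity k})"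

text \<open>Independence gives the identity for finite partial products, and dominated convergence
  with bound 1 carries it to the limit on both sides.\<close>

lemma expectation_inf_prod_stations:
  assumes Z: "\<And>s w. 0 \<le> Z s w" "\<And>s w. Z s w \<le> (1 :: real)" "\<And>s. Z s \<in> borel_measurable (src (mark_sources s))"
  shows "expectation (\<lambda>w. inf_prod (\<lambda>i. Z (MBS i) w) * inf_prod (\<lambda>k. Z (Helper k) w)) =
    inf_prod (\<lambda>i. expectation (Z (MBS i))) * inf_prod (\<lambda>k. expectation (Z (Helper k)))"
proof (rule LIMSEQ_unique)
  have [measurable]: "Z s \<in> borel_measurable M" for s using Z(3) by (rule measurable_from_src)
  have int: "integrable M (Z s)" for s
    using Z by (intro integrable_const_bound[where B = 1]) auto
  have EZ: "0 \<le> expectation (Z s)" "expectation (Z s) \<le> 1" for s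
    using Z int by (auto intro!: integral_nonneg integral_le_const)
  have indep: "indep_vars (\<lambda>_. borel) Z UNIV"
    by (rule indep_vars_src[where I = mark_sources])
       (auto simp: disjoint_family_on_def mark_sources_def Z(3)[unfolded mark_sources_def] split: station.splits)
  let ?P = "\<lambda>m w. (\<Prod>i<m. Z (MBS i) w) * (\<Prod>k<m. Z (Helper k) w)"
  have P: "expectation (?P m) = (\<Prod>i<m. expectation (Z (MBS i))) * (\<Prod>k<m. expectation (Z (Helper k)))" for m
  proof -
    have split: "(\<Prod>s\<in>MBS ` {..<m} \<union> Helper ` {..<m}. f s) = (\<Prod>i<m. f (MBS i)) * (\<Prod>k<m. f (Helper k))"
      for f :: "station \<Rightarrow> real"
      by (subst prod.union_disjoint) (auto simp: prod.reindex inj_on_def)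
    have "expectation (\<lambda>w. \<Prod>s\<in>MBS ` {..<m} \<union> Helper ` {..<m}. Z s w) = (\<Prod>s\<in>MBS ` {..<m} \<union> Helper ` {..<m}. expectation (Z s))"
      by (intro indep_vars_lebesgue_integral int indep_vars_subset[OF indep]) auto
    then show ?thesis unfolding split .
  qed
  show "(\<lambda>m. expectation (?P m)) \<longlonglongrightarrow> expectation (\<lambda>w. inf_prod (\<lambda>i. Z (MBS i) w) * inf_prod (\<lambda>k. Z (Helper k) w))"
  proof (rule integral_dominated_convergence[where w = "\<lambda>_. 1"])
    show "AE w in M. (\<lambda>m. ?P m w) \<longlonglongrightarrow> inf_prod (\<lambda>i. Z (MBS i) w) * inf_prod (\<lambda>k. Z (Helper k) w)"
      using Z by (intro AE_I2 tendsto_mult tendsto_inf_prod) auto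
    show "AE w in M. norm (?P m w) \<le> 1" for m
      using Z by (intro AE_I2) (auto simp: abs_mult abs_prod intro!: mult_le_one prod_le_1 prod_nonneg)
    show "(\<lambda>w. inf_prod (\<lambda>i. Z (MBS i) w) * inf_prod (\<lambda>k. Z (Helper k) w)) \<in> borel_measurable M"
      using Z by (intro borel_measurable_times borel_measurable_inf_prod) auto
  qed auto
  show "(\<lambda>m. expectation (?P m)) \<longlonglongrightarrow> inf_prod (\<lambda>i. expectation (Z (MBS i))) * inf_prod (\<lambda>k. expectation (Z (Helper k)))"
    unfolding P using EZ by (intro tendsto_mult tendsto_inf_prod) auto
qed

text \<open>Given everything else, exponential fading of the serving station turns the SINR
  condition into the probability \<open>exp (- (t * V))\<close>. Its exponent is a sum over
  stations, so the mean factorizes by independence of the marks. The hypothesis \<open>near\<close>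
  makes \<open>j0\<close> the only macro candidate, and the summability hypotheses keep the
  interference finite.\<close>

lemma coverage_given_locations:
  fixes L :: "station \<Rightarrow> real ^ 2"
  defines "m \<equiv> \<lambda>s. tx_power p s * norm (L s) powr - alpha p"
  assumes \<delta>: "0 < \<delta>" and pos: "0 < norm (L (MBS j0))"
    and near: "\<And>i. i \<noteq> j0 \<Longrightarrow> norm (L (MBS j0)) < norm (L (MBS i))"
    and sum1: "summable (\<lambda>i. norm (L (MBS i)) powr - alpha p)"
    and sum2: "summable (\<lambda>k. norm (L (Helper k)) powr - alpha p)"
  defines "t \<equiv> \<delta> / m (MBS j0)"
  shows "prob {w \<in> space M. covered p (\<lambda>s _. L s) fading stores active n \<delta> w} =
    exp (- (t * noise p)) *
    (inf_prod (\<lambda>i. if i = j0 then 1 else 1 / (1 + t * m (MBS i))) *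
     inf_prod (\<lambda>k. (if m (Helper k) \<le> m (MBS j0) then 1 else 1 - p_Lp p) *
        (1 - p_active p + p_active p / (1 + t * m (Helper k)))))"
proof -
  have m_eq: "mean_rx_power p (\<lambda>s _. L s) s w = m s" for s and w :: 'w
    by (simp add: mean_rx_power_def m_def)
  have m_nonneg: "0 \<le> m s" for s using valid by (cases s) (auto simp: m_def)
  have m0: "0 < m (MBS j0)" using pos valid by (simp add: m_def)
  have t: "0 < t" using \<delta> m0 by (simp add: t_def)
  have m_less: "m (MBS i) < m (MBS j0)" if "i \<noteq> j0" for i
    using near[OF that] pos valid by (simp add: m_def powr_less_mono2_neg)
  have m_other: "0 < m (MBS i)" if "i \<noteq> j0" for i
  proof -
    have "0 < norm (L (MBS i))" using near[OF that] pos by linarith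
    then show ?thesis using valid by (simp add: m_def)
  qed
  have summ: "summable (\<lambda>i. m (MBS i))" "summable (\<lambda>k. m (Helper k))"
    using sum1 sum2 by (auto simp: m_def intro: summable_mult)
  define V where "V w = interference p (\<lambda>s _. L s) fading active w (MBS j0) + noise p" for w
  define S where "S w \<longleftrightarrow> (\<forall>k. stores k n w \<longrightarrow> m (Helper k) \<le> m (MBS j0))" for w
  define u where "u i w = (if i = j0 then 0 else t * m (MBS i) * max 0 (fading (MBS i) w))" for i w
  define v where "v k w = (if active k w then t * m (Helper k) * max 0 (fading (Helper k) w) else 0)" for k w
  have uv: "0 \<le> u i w" "0 \<le> v k w" for i k w using t m_nonneg by (auto simp: u_def v_def)
  have good: "AE w in M. summable (\<lambda>i. u i w) \<and> summable (\<lambda>k. v k w) \<and>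
      t * V w = (\<Sum>i. u i w) + (\<Sum>k. v k w) + t * noise p \<and> 0 < V w \<and> (\<forall>s. 0 < fading s w)"
    using fading_pos_AE summable_faded_AE[OF summ(1) m_nonneg, of MBS] summable_faded_AE[OF summ(2) m_nonneg, of Helper]
  proof eventually_elim
    case (elim w)
    define r where "r s = of_bool (interferer active w (MBS j0) s) * (fading s w * mean_rx_power p (\<lambda>s _. L s) s w)" for s
    have r_nonneg: "0 \<le> r s" for s using elim m_nonneg by (auto simp: r_def m_eq intro: mult_nonneg_nonneg less_imp_le)
    have fad: "max 0 (fading s w) = fading s w" for s using elim by (simp add: max_def less_imp_le)
    have u_eq: "u i w = t * r (MBS i)" for i by (auto simp: u_def r_def m_eq interferer_def fad)
    have v_eq: "v k w = t * r (Helper k)" for k by (auto simp: v_def r_def m_eq interferer_def fad)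
    have r1: "summable (\<lambda>i. r (MBS i))"
      by (rule summable_comparison_test'[OF elim(2)]) (use m_nonneg r_nonneg elim(1) in \<open>auto simp: r_def m_eq fad intro: mult_nonneg_nonneg less_imp_le\<close>)
    have r2: "summable (\<lambda>k. r (Helper k))"
      by (rule summable_comparison_test'[OF elim(3)]) (use m_nonneg r_nonneg elim(1) in \<open>auto simp: r_def m_eq fad intro: mult_nonneg_nonneg less_imp_le\<close>)
    have I: "interference p (\<lambda>s _. L s) fading active w (MBS j0) = (\<Sum>i. r (MBS i)) + (\<Sum>k. r (Helper k))"
      unfolding interference_eq r_def[symmetric] using r1 r2 r_nonneg by simp
    \<comment> \<open>The noise may be 0, so positivity of \<open>V\<close> must come from
      interference. Any macro station other than \<open>j0\<close> provides it, since macro stations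
      always transmit.\<close>
    define i where "i = Suc j0"
    have "0 < r (MBS i)" using elim(1) m_other[of i] by (simp add: r_def m_eq interferer_def i_def)
    then have "0 < (\<Sum>i. r (MBS i))" by (intro suminf_pos2[OF r1]) (auto simp: r_nonneg)
    moreover have "0 \<le> (\<Sum>k. r (Helper k))" by (intro suminf_nonneg r2 r_nonneg)
    ultimately have "0 < V w" using valid by (simp add: V_def I)
    moreover have "t * V w = (\<Sum>i. u i w) + (\<Sum>k. v k w) + t * noise p"
      unfolding u_eq v_eq V_def I using r1 r2 by (simp add: suminf_mult distrib_left)
    ultimately show ?case using r1 r2 elim(1) unfolding u_eq v_eq by (simp add: summable_mult)
  qed
  \<comment> \<open>Neither \<open>V\<close> nor \<open>S\<close> involves the fading of
    \<open>j0\<close>, so that fading can be integrated first with the other sources held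
    fixed.\<close>
  have V_meas: "V \<in> borel_measurable (src (- {Fading (MBS j0)}))"
    unfolding V_def[abs_def]
    by (intro borel_measurable_add measurable_interference active_src fading_src) auto
  have S_meas: "Measurable.pred (src (- {Fading (MBS j0)})) S"
  proof -
    have [measurable]: "Measurable.pred (src (- {Fading (MBS j0)})) (stores k n)" for k
      by (rule stores_src) simp
    show ?thesis unfolding S_def[abs_def] by measurable
  qed
  note [measurable] = measurable_from_src[OF V_meas] measurable_from_src[OF S_meas]
  have serving: "is_serving p (\<lambda>s _. L s) stores n w (MBS i) \<longleftrightarrow> i = j0 \<and> S w" for i w
  proof
    assume s: "is_serving p (\<lambda>s _. L s) stores n w (MBS i)"
    then have "m (MBS j0) \<le> m (MBS i)" by (auto simp: is_serving_def m_eq)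
    then have "i = j0" using m_less[of i] by (cases "i = j0") auto
    with s show "i = j0 \<and> S w" by (auto simp: is_serving_def m_eq S_def)
  next
    assume "i = j0 \<and> S w"
    moreover have "m (MBS j) \<le> m (MBS j0)" for j using m_less[of j] by (cases "j = j0") auto
    ultimately show "is_serving p (\<lambda>s _. L s) stores n w (MBS i)"
      by (auto simp: is_serving_def all_station m_eq S_def)
  qed
  have cov_meas: "Measurable.pred M (covered p (\<lambda>s _. L s) fading stores active n \<delta>)"
    by (rule pred_covered) auto
  have "prob {w \<in> space M. covered p (\<lambda>s _. L s) fading stores active n \<delta> w} =
     prob {w \<in> space M. S w \<and> t * V w \<le> fading (MBS j0) w}"
  proof (rule finite_measure_eq_AE)
    show "AE w in M. (w \<in> {w \<in> space M. covered p (\<lambda>s _. L s) fading stores active n \<delta> w}) =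
       (w \<in> {w \<in> space M. S w \<and> t * V w \<le> fading (MBS j0) w})"
      using good
    proof eventually_elim
      case (elim w)
      have "\<delta> \<le> SINR p (\<lambda>s _. L s) fading active w (MBS j0) \<longleftrightarrow> \<delta> * V w \<le> fading (MBS j0) w * m (MBS j0)"
        using elim by (simp add: SINR_def V_def[symmetric] m_eq pos_le_divide_eq)
      also have "\<dots> \<longleftrightarrow> t * V w \<le> fading (MBS j0) w"
        using m0 by (simp add: t_def pos_divide_le_eq)
      finally show ?case by (auto simp: covered_def serving)
    qed
  qed (use cov_meas in measurable)
  also have "ennreal \<dots> = (\<integral>\<^sup>+w1. ennreal (prob {w2 \<in> space M. S w1 \<and> t * V w1 \<le> fading (MBS j0) w2}) \<partial>M)"
  proof (rule prob_src[of "- {Fading (MBS j0)}" "{Fading (MBS j0)}"])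
    note [measurable] = V_meas S_meas fading_src[of "MBS j0" "{Fading (MBS j0)}", simplified]
    show "Measurable.pred (src (- {Fading (MBS j0)}) \<Otimes>\<^sub>M src {Fading (MBS j0)}) (\<lambda>(w1, w2). S w1 \<and> t * V w1 \<le> fading (MBS j0) w2)"
      by measurable
  qed simp
  also have "\<dots> = (\<integral>\<^sup>+w. ennreal (of_bool (S w) * exp (- (t * V w))) \<partial>M)"
    using good
  proof (intro nn_integral_cong_AE, eventually_elim)
    case (elim w)
    have "0 \<le> t * V w" by (rule mult_nonneg_nonneg) (use elim t in simp_all)
    then show ?case by (cases "S w") (simp_all add: exponential_tail[OF fading_law])
  qed
  also have "\<dots> = ennreal (expectation (\<lambda>w. of_bool (S w) * exp (- (t * V w))))"
  proof (rule nn_integral_eq_integral)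
    show "integrable M (\<lambda>w. of_bool (S w) * exp (- (t * V w)))"
    proof (rule integrable_const_bound[where B = 1])
      show "AE w in M. norm (of_bool (S w) * exp (- (t * V w))) \<le> 1"
        using good
      proof (rule eventually_mono)
        fix w assume w: "summable (\<lambda>i. u i w) \<and> summable (\<lambda>k. v k w) \<and>
          t * V w = (\<Sum>i. u i w) + (\<Sum>k. v k w) + t * noise p \<and> 0 < V w \<and> (\<forall>s. 0 < fading s w)"
        have "0 \<le> t * V w" by (rule mult_nonneg_nonneg) (use w t in simp_all)
        then show "norm (of_bool (S w) * exp (- (t * V w))) \<le> 1" by simp
      qed
    qed simp
  qed auto
  finally have prob_eq: "prob {w \<in> space M. covered p (\<lambda>s _. L s) fading stores active n \<delta> w} =
     expectation (\<lambda>w. of_bool (S w) * exp (- (t * V w)))"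
    by (simp add: ennreal_inj integral_nonneg)
  \<comment> \<open>A storing helper stronger than \<open>j0\<close> violates \<open>S\<close>;
    giving it the factor 0 absorbs the indicator of \<open>S\<close> into the product over
    helpers.\<close>
  define Z where "Z s w = (case s of MBS i \<Rightarrow> exp (- u i w)
     | Helper k \<Rightarrow> (if stores k n w \<and> m (MBS j0) < m (Helper k) then 0 else 1) * exp (- v k w))" for s w
  have Z01: "0 \<le> Z s w" "Z s w \<le> 1" for s w
    using uv by (cases s; simp add: Z_def)+
  have "expectation (\<lambda>w. of_bool (S w) * exp (- (t * V w))) =
     expectation (\<lambda>w. exp (- (t * noise p)) * (inf_prod (\<lambda>i. Z (MBS i) w) * inf_prod (\<lambda>k. Z (Helper k) w)))"
  proof (rule integral_cong_AE)
    show "AE w in M. of_bool (S w) * exp (- (t * V w)) =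
       exp (- (t * noise p)) * (inf_prod (\<lambda>i. Z (MBS i) w) * inf_prod (\<lambda>k. Z (Helper k) w))"
      using good
    proof eventually_elim
      case (elim w)
      have "inf_prod (\<lambda>i. Z (MBS i) w) = exp (- (\<Sum>i. u i w))"
        unfolding Z_def using elim uv by (simp add: inf_prod_exp)
      moreover have "inf_prod (\<lambda>k. Z (Helper k) w) = (if \<exists>k. stores k n w \<and> m (MBS j0) < m (Helper k) then 0 else exp (- (\<Sum>k. v k w)))"
        unfolding Z_def using elim uv inf_prod_exp_indicator[of "\<lambda>k. v k w"] by simp
      moreover have "S w \<longleftrightarrow> \<not> (\<exists>k. stores k n w \<and> m (MBS j0) < m (Helper k))"
        by (auto simp: S_def not_less)
      moreover have "exp (- (t * V w)) = exp (- (t * noise p)) * (exp (- (\<Sum>i. u i w)) * exp (- (\<Sum>k. v k w)))"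
        using elim by (simp add: exp_add[symmetric])
      ultimately show ?case by simp
    qed
    have [measurable]: "Z s \<in> borel_measurable M" for s
      unfolding Z_def[abs_def] u_def v_def by (cases s) simp_all
    show "(\<lambda>w. exp (- (t * noise p)) * (inf_prod (\<lambda>i. Z (MBS i) w) * inf_prod (\<lambda>k. Z (Helper k) w))) \<in> borel_measurable M"
      by (intro borel_measurable_times borel_measurable_const borel_measurable_inf_prod Z01) simp_all
    show "(\<lambda>w. of_bool (S w) * exp (- (t * V w))) \<in> borel_measurable M" by simp
  qed
  also have "\<dots> = exp (- (t * noise p)) * (inf_prod (\<lambda>i. expectation (Z (MBS i))) * inf_prod (\<lambda>k. expectation (Z (Helper k))))"
  proof -
    have "Z s \<in> borel_measurable (src (mark_sources s))" for s
    proof (cases s)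
      case (MBS i)
      have [measurable]: "fading (MBS i) \<in> borel_measurable (src (mark_sources (MBS i)))"
        by (rule fading_src) (simp add: mark_sources_def)
      show ?thesis unfolding Z_def[abs_def] u_def MBS by simp
    next
      case (Helper k)
      have [measurable]: "fading (Helper k) \<in> borel_measurable (src (mark_sources (Helper k)))"
        by (rule fading_src) (simp add: mark_sources_def)
      have [measurable]: "Measurable.pred (src (mark_sources (Helper k))) (stores k n)" "Measurable.pred (src (mark_sources (Helper k))) (active k)"
        by (intro stores_src active_src; simp add: mark_sources_def)+
      show ?thesis unfolding Z_def[abs_def] v_def Helper by simp
    qed
    then show ?thesis
      using expectation_inf_prod_stations[of Z] Z01 by simp
  qed
  finally have fin: "expectation (\<lambda>w. of_bool (S w) * exp (- (t * V w))) =
     exp (- (t * noise p)) * (inf_prod (\<lambda>i. expectation (Z (MBS i))) * inf_prod (\<lambda>k. expectation (Z (Helper k))))" .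
  have E1: "expectation (Z (MBS i)) = (if i = j0 then 1 else 1 / (1 + t * m (MBS i)))" for i
    using exponential_laplace[OF fading_law, of "t * m (MBS i)"] t m_nonneg
    by (simp add: Z_def[abs_def] u_def prob_space)
  have E2: "expectation (Z (Helper k)) = (if m (Helper k) \<le> m (MBS j0) then 1 else 1 - p_Lp p) *
        (1 - p_active p + p_active p / (1 + t * m (Helper k)))" for k
  proof -
    \<comment> \<open>The three marks of a helper separate: \<open>?a\<close> is the storage
      constraint, and \<open>?b * ?c\<close> is the loss from interference, present only if the
      helper is active.\<close>
    let ?a = "\<lambda>w. if stores k n w \<and> m (MBS j0) < m (Helper k) then 0 else 1 :: real"
    let ?b = "\<lambda>w. of_bool (active k w) :: real"
    let ?c = "\<lambda>w. 1 - exp (- (t * m (Helper k) * max 0 (fading (Helper k) w)))"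
    have [measurable]: "fading (Helper k) \<in> borel_measurable (src {Fading (Helper k)})"
      "fading (Helper k) \<in> borel_measurable (src {Fading (Helper k), Activity k})"
      "Measurable.pred (src {Storing k}) (stores k n)" "Measurable.pred (src {Activity k}) (active k)"
      "Measurable.pred (src {Fading (Helper k), Activity k}) (active k)"
      by (auto intro!: stores_src active_src fading_src)
    have c01: "0 \<le> ?c w" "?c w \<le> 1" for w using t m_nonneg by simp_all
    have bc01: "0 \<le> ?b w * ?c w" "?b w * ?c w \<le> 1" for w using c01[of w] by (cases "active k w"; simp)+
    have bdd: "integrable M f" if "f \<in> borel_measurable M" "\<And>w. 0 \<le> f w" "\<And>w. f w \<le> 1" for f :: "'w \<Rightarrow> real"
      using that by (intro integrable_const_bound[where B = 1]) auto
    have int: "integrable M ?a" "integrable M ?b" "integrable M ?c" "integrable M (\<lambda>w. ?b w * ?c w)"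
      "integrable M (\<lambda>w. 1 - ?b w * ?c w)"
      by (intro bdd c01 bc01; use bc01 in simp)+
    have "expectation (Z (Helper k)) = expectation (\<lambda>w. ?a w * (1 - ?b w * ?c w))"
      by (intro Bochner_Integration.integral_cong) (auto simp: Z_def v_def)
    also have "\<dots> = expectation ?a * expectation (\<lambda>w. 1 - ?b w * ?c w)"
      by (rule expectation_prod_src[of "{Storing k}" "{Fading (Helper k), Activity k}"]) (use int in auto)
    also have "expectation (\<lambda>w. 1 - ?b w * ?c w) = 1 - expectation (\<lambda>w. ?b w * ?c w)"
      by (subst Bochner_Integration.integral_diff) (use int in \<open>simp_all add: prob_space\<close>)
    also have "expectation (\<lambda>w. ?b w * ?c w) = expectation ?b * expectation ?c"
      by (rule expectation_prod_src[of "{Activity k}" "{Fading (Helper k)}"]) (use int in auto)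
    also have "expectation ?b = p_active p"
      using bernoulli_expectation[OF p_active_bounds[OF params] activity_measurable activity_law, of of_bool k] by simp
    also have "expectation ?c = 1 - 1 / (1 + t * m (Helper k))"
    proof -
      have "integrable M (\<lambda>w. exp (- (t * m (Helper k) * max 0 (fading (Helper k) w))))"
        using t m_nonneg by (intro integrable_const_bound[where B = 1]) auto
      then show ?thesis
        using exponential_laplace[OF fading_law, of "t * m (Helper k)" "Helper k"] t m_nonneg by (simp add: prob_space)
    qed
    also have "expectation ?a = (if m (Helper k) \<le> m (MBS j0) then 1 else 1 - p_Lp p)"
      using bernoulli_expectation[OF p_Lp_bounds[OF params] storing_measurable[OF n] storing_law[OF n],
          of "\<lambda>b. if b \<and> m (MBS j0) < m (Helper k) then 0 else 1" k] by (simp add: not_le[symmetric])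
    finally show ?thesis by (simp add: algebra_simps)
  qed
  show ?thesis unfolding prob_eq fin E1 E2 ..
qed

end
end

section \<open>Averaging over the locations\<close>

text \<open>Coverage depends on the data only through their values at the sample point. This permits
  freezing the locations at one point while the remaining sources are read at another.\<close>

lemma covered_cong:
  assumes "\<And>s. loc s w = loc' s w'" "\<And>s. fading s w = fading' s w'"
    "\<And>j. stores j n w = stores' j n w'" "\<And>j. active j w = active' j w'"
  shows "covered p loc fading stores active n \<delta> w \<longleftrightarrow> covered p loc' fading' stores' active' n \<delta> w'"
proof -
  have m: "mean_rx_power p loc s w = mean_rx_power p loc' s w'" for s by (simp add: mean_rx_power_def assms)
  have c: "can_serve stores n w s \<longleftrightarrow> can_serve stores' n w' s" for s by (cases s) (simp_all add: assms)
  have t: "transmits active w s \<longleftrightarrow> transmits active' w' s" for s by (cases s) (simp_all add: assms)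
  show ?thesis
    by (simp add: covered_def is_serving_def SINR_def interference_def m c t assms)
qed

text \<open>The path loss itself is not integrable near the origin, so the Poisson argument is run
  on the bounded function \<open>attenuation \<alpha> 1\<close>. Once its terms are below 1/2, the
  path loss is below 1 and at most twice the attenuation.\<close>

lemma summable_powr_if_attenuation:
  assumes "summable (\<lambda>i. attenuation \<alpha> 1 (x i))"
  shows "summable (\<lambda>i. norm (x i) powr - \<alpha>)"
proof -
  let ?v = "\<lambda>i. norm (x i) powr - \<alpha>"
  have "(\<lambda>i. attenuation \<alpha> 1 (x i)) \<longlonglongrightarrow> 0" using assms by (rule summable_LIMSEQ_zero)
  then have "eventually (\<lambda>i. attenuation \<alpha> 1 (x i) < 1 / 2) sequentially" by (rule order_tendstoD) simp
  then have "eventually (\<lambda>i. norm (?v i) \<le> 2 * attenuation \<alpha> 1 (x i)) sequentially"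
  proof eventually_elim
    case (elim i)
    have "0 \<le> ?v i" by simp
    with elim have "?v i < 1" by (simp add: attenuation_def divide_simps split: if_splits)
    then have "?v i * ?v i \<le> ?v i" by (intro mult_left_le) auto
    then show ?case by (simp add: attenuation_def divide_simps add_pos_nonneg algebra_simps)
  qed
  then show ?thesis by (rule summable_comparison_test_ev) (intro summable_mult assms)
qed

context cache_network begin

definition single_macro :: "real \<Rightarrow> real \<Rightarrow> 'w \<Rightarrow> bool" where
  "single_macro a b w \<longleftrightarrow> (\<exists>j. a < norm (loc (MBS j) w) \<and> norm (loc (MBS j) w) \<le> b \<and>
     (\<forall>i. i \<noteq> j \<longrightarrow> b < norm (loc (MBS i) w)))"

text \<open>On \<open>single_macro a b\<close>, with \<open>z\<close> the true serving distance,
  this is the coverage probability given the locations. Decoupling \<open>z\<close> from the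
  locations allows the comparison with \<open>z = a\<close> and \<open>z = b\<close>, where the mean
  over the locations can be computed.\<close>

definition thinned_survival :: "real \<Rightarrow> real \<Rightarrow> real \<Rightarrow> real \<Rightarrow> 'w \<Rightarrow> real" where
  "thinned_survival \<delta> a b z w = exp (- (\<delta> * z powr alpha p / power1 p * noise p)) *
     (inf_prod (\<lambda>i. 1 - macro_thinning (alpha p) \<delta> a b z (loc (MBS i) w)) *
      inf_prod (\<lambda>k. 1 - helper_thinning p \<delta> z (loc (Helper k) w)))"

text \<open>This is \<Lambda> of the overview. The probability that no macro station is closer than
  \<open>z\<close> is already inside, as the summand 1 of \<open>zeta1 p\<close>.\<close>

definition coverage_density :: "real \<Rightarrow> real \<Rightarrow> real" where
  "coverage_density \<delta> z = exp (- (z powr alpha p * inverse (power1 p) * \<delta> * noise p)) *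
     exp (- (pi * lambda1 p * z\<^sup>2 * (xi1 p * G_fun \<delta> (alpha p) + varsigma1 p * H_fun \<delta> (alpha p) + zeta1 p)))"

lemmas prob_bounds = p_Lp_bounds[OF params] p_active_bounds[OF params]

lemma helper_bounds: "0 \<le> \<delta> \<Longrightarrow> 0 \<le> helper_thinning p \<delta> z y" "0 \<le> \<delta> \<Longrightarrow> helper_thinning p \<delta> z y \<le> 1"
  using helper_thinning_bounds[OF params _ prob_bounds] by auto

lemma thinned_survival_antimono:
  assumes "0 \<le> \<delta>" "0 < z" "z \<le> z'"
  shows "thinned_survival \<delta> a b z' w \<le> thinned_survival \<delta> a b z w"
proof -
  have "\<delta> * z powr alpha p / power1 p * noise p \<le> \<delta> * z' powr alpha p / power1 p * noise p"
    using assms valid by (intro mult_right_mono divide_right_mono mult_left_mono powr_mono2) auto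
  then show ?thesis
    unfolding thinned_survival_def using assms valid
    by (intro mult_mono inf_prod_mono diff_left_mono macro_thinning_mono helper_thinning_mono[OF params] prob_bounds
        mult_nonneg_nonneg inf_prod_bounds)
       (auto simp: macro_thinning_bounds helper_bounds)
qed

lemma interference_summable_AE:
  "AE w in M. summable (\<lambda>i. norm (loc (MBS i) w) powr - alpha p) \<and> summable (\<lambda>k. norm (loc (Helper k) w) powr - alpha p)"
proof -
  have att: "integrable lborel (attenuation (alpha p) 1)" "\<And>x. 0 \<le> attenuation (alpha p) 1 x" "\<And>x. attenuation (alpha p) 1 x \<le> 1"
    using attenuation_bochner[OF valid(1), of 1] attenuation_bounds[of 1 "alpha p"] by (auto simp: has_bochner_integral_iff)
  have "AE w in M. summable (\<lambda>i. attenuation (alpha p) 1 (loc (MBS i) w))"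
    using valid by (intro poisson_sum_finite[OF MBS_process] att) auto
  moreover have "AE w in M. summable (\<lambda>i. attenuation (alpha p) 1 (loc (Helper i) w))"
    using valid by (intro poisson_sum_finite[OF Helper_process] att) auto
  ultimately show ?thesis by eventually_elim (simp add: summable_powr_if_attenuation)
qed

context
  fixes n assumes n: "n \<in> second_group p"
begin

declare loc_measurable [OF n, measurable] fading_measurable [OF n, measurable] stores_measurable [OF n, measurable]
  activity_measurable [measurable] load1_measurable [measurable]

abbreviation cov :: "real \<Rightarrow> 'w \<Rightarrow> bool" where
  "cov \<equiv> covered p loc fading stores active n"

lemma cov_measurable [measurable]: "Measurable.pred M (cov \<delta>)"
  by (rule pred_covered) auto

lemma single_macro_src: "Measurable.pred (src n {MBS_locs}) (single_macro a b)"
proof -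
  note [measurable] = loc_MBS_src[OF n, of "{MBS_locs}", simplified]
  show ?thesis unfolding single_macro_def[abs_def] by measurable
qed

lemma single_macro_measurable [measurable]: "Measurable.pred M (single_macro a b)"
  using single_macro_src by (rule measurable_from_src[OF n])

text \<open>The probability equals \<open>thinned_survival\<close> at the actual serving distance,
  which lies between \<open>a\<close> and \<open>b\<close>; antitonicity in the distance gives both
  bounds.\<close>

lemma coverage_single_macro:
  assumes \<delta>: "0 < \<delta>" and a: "0 < a" and U: "single_macro a b w"
    and s: "summable (\<lambda>i. norm (loc (MBS i) w) powr - alpha p)" "summable (\<lambda>k. norm (loc (Helper k) w) powr - alpha p)"
  shows "thinned_survival \<delta> a b b w \<le> prob {w2 \<in> space M. covered p (\<lambda>s _. loc s w) fading stores active n \<delta> w2}"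
    and "prob {w2 \<in> space M. covered p (\<lambda>s _. loc s w) fading stores active n \<delta> w2} \<le> thinned_survival \<delta> a b a w"
proof -
  obtain j where j: "a < norm (loc (MBS j) w)" "norm (loc (MBS j) w) \<le> b" "\<And>i. i \<noteq> j \<Longrightarrow> b < norm (loc (MBS i) w)"
    using U unfolding single_macro_def by blast
  define z where "z = norm (loc (MBS j) w)"
  define t where "t = \<delta> / (power1 p * z powr - alpha p)"
  have z: "0 < z" "a < z" "z \<le> b" using j a by (auto simp: z_def)
  have t_eq: "t = \<delta> * z powr alpha p / power1 p" using z valid by (simp add: t_def powr_minus field_simps)
  have "prob {w2 \<in> space M. covered p (\<lambda>s _. loc s w) fading stores active n \<delta> w2} =
    exp (- (t * noise p)) *
    (inf_prod (\<lambda>i. if i = j then 1 else 1 / (1 + t * (power1 p * norm (loc (MBS i) w) powr - alpha p))) *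
     inf_prod (\<lambda>k. (if power2 p * norm (loc (Helper k) w) powr - alpha p \<le> power1 p * z powr - alpha p then 1 else 1 - p_Lp p) *
        (1 - p_active p + p_active p / (1 + t * (power2 p * norm (loc (Helper k) w) powr - alpha p)))))"
  proof -
    have pos: "0 < norm (loc (MBS j) w)" using j a by linarith
    have near: "norm (loc (MBS j) w) < norm (loc (MBS i) w)" if "i \<noteq> j" for i
      using j(2) j(3)[OF that] by linarith
    show ?thesis
      unfolding t_def z_def
      by (rule coverage_given_locations[OF n \<delta>, where L = "\<lambda>s. loc s w" and ?j0.0 = j, OF pos near s, unfolded tx_power.simps])
  qed
  \<comment> \<open>Station \<open>j\<close> lies in the ring, where the thinning is 0, and every
    other macro station lies beyond \<open>b\<close>, where it is the attenuation.\<close>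
  also have "(\<lambda>i. if i = j then 1 else 1 / (1 + t * (power1 p * norm (loc (MBS i) w) powr - alpha p))) =
      (\<lambda>i. 1 - macro_thinning (alpha p) \<delta> a b z (loc (MBS i) w))"
  proof
    fix i
    have "1 - attenuation (alpha p) (\<delta> * z powr alpha p) (loc (MBS i) w) = 1 / (1 + t * (power1 p * norm (loc (MBS i) w) powr - alpha p))"
      using \<delta> valid by (subst one_minus_attenuation) (auto simp: t_eq)
    then show "(if i = j then 1 else 1 / (1 + t * (power1 p * norm (loc (MBS i) w) powr - alpha p))) =
       1 - macro_thinning (alpha p) \<delta> a b z (loc (MBS i) w)"
      using j(1,2) j(3)[of i] by (auto simp: macro_thinning_def)
  qed
  also have "(\<lambda>k. (if power2 p * norm (loc (Helper k) w) powr - alpha p \<le> power1 p * z powr - alpha p then 1 else 1 - p_Lp p) *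
        (1 - p_active p + p_active p / (1 + t * (power2 p * norm (loc (Helper k) w) powr - alpha p)))) =
      (\<lambda>k. 1 - helper_thinning p \<delta> z (loc (Helper k) w))"
  proof
    fix k
    let ?c = "\<delta> * z powr alpha p * (power2 p / power1 p)"
    have "1 - p_active p + p_active p / (1 + ?c * norm (loc (Helper k) w) powr - alpha p) =
        1 - p_active p * attenuation (alpha p) ?c (loc (Helper k) w)"
    proof -
      have "1 - attenuation (alpha p) ?c (loc (Helper k) w) = 1 / (1 + ?c * norm (loc (Helper k) w) powr - alpha p)"
        using \<delta> valid by (intro one_minus_attenuation) auto
      then have "p_active p / (1 + ?c * norm (loc (Helper k) w) powr - alpha p) =
          p_active p * (1 - attenuation (alpha p) ?c (loc (Helper k) w))"
        by (simp only:) simp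
      then show ?thesis by (simp only: right_diff_distrib)
    qed
    moreover have "t * (power2 p * norm (loc (Helper k) w) powr - alpha p) = ?c * norm (loc (Helper k) w) powr - alpha p"
      by (simp add: t_eq)
    ultimately show "(if power2 p * norm (loc (Helper k) w) powr - alpha p \<le> power1 p * z powr - alpha p then 1 else 1 - p_Lp p) *
        (1 - p_active p + p_active p / (1 + t * (power2 p * norm (loc (Helper k) w) powr - alpha p))) =
      1 - helper_thinning p \<delta> z (loc (Helper k) w)"
      by (simp add: helper_thinning_def)
  qed
  finally have eq: "prob {w2 \<in> space M. covered p (\<lambda>s _. loc s w) fading stores active n \<delta> w2} = thinned_survival \<delta> a b z w"
    by (simp add: thinned_survival_def t_eq)
  show "thinned_survival \<delta> a b b w \<le> prob {w2 \<in> space M. covered p (\<lambda>s _. loc s w) fading stores active n \<delta> w2}"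
    "prob {w2 \<in> space M. covered p (\<lambda>s _. loc s w) fading stores active n \<delta> w2} \<le> thinned_survival \<delta> a b a w"
    unfolding eq using \<delta> a z by (auto intro!: thinned_survival_antimono)
qed

definition ring_mean :: "real \<Rightarrow> real \<Rightarrow> real" where
  "ring_mean a b = lambda1 p * (pi * (b\<^sup>2 - a\<^sup>2))"

text \<open>\<open>single_macro\<close> also demands an empty disc of radius \<open>a\<close>, which
  the count on the ring does not see. The product supplies it: a station in that disc has thinning 1
  and makes the product vanish. The event thus becomes a function of the ring count, as the Laplace
  functional requires.\<close>

lemma single_macro_count:
  assumes "0 \<le> \<delta>"
  shows "of_bool (single_macro a b w) * inf_prod (\<lambda>i. 1 - macro_thinning (alpha p) \<delta> a b z (loc (MBS i) w)) =
    of_bool (num_points (\<lambda>j. loc (MBS j)) (cball 0 b - cball 0 a) w = 1) *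
      inf_prod (\<lambda>i. 1 - macro_thinning (alpha p) \<delta> a b z (loc (MBS i) w))"
proof (cases "single_macro a b w")
  case True
  then obtain j where j: "a < norm (loc (MBS j) w)" "norm (loc (MBS j) w) \<le> b" "\<And>i. i \<noteq> j \<Longrightarrow> b < norm (loc (MBS i) w)"
    unfolding single_macro_def by blast
  have "{i. loc (MBS i) w \<in> cball 0 b - cball 0 a} = {j}"
    using j by (auto simp: not_le) (meson not_le)
  then show ?thesis using True by (simp add: num_points_def)
next
  case False
  show ?thesis
  proof (cases "num_points (\<lambda>j. loc (MBS j)) (cball 0 b - cball 0 a) w = 1")
    case True
    then obtain j where j: "{i. loc (MBS i) w \<in> cball 0 b - cball 0 a} = {j}"
      unfolding num_points_def by (auto simp: card_1_singleton_iff)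
    then have "a < norm (loc (MBS j) w)" "norm (loc (MBS j) w) \<le> b" by auto
    then obtain i where i: "i \<noteq> j" "norm (loc (MBS i) w) \<le> b"
      using False unfolding single_macro_def by (auto simp: not_less)
    then have "norm (loc (MBS i) w) \<le> a" using j by auto
    then have "(\<Prod>i<Suc i. 1 - macro_thinning (alpha p) \<delta> a b z (loc (MBS i) w)) = 0"
      by (simp add: macro_thinning_def)
    moreover have nn: "0 \<le> 1 - macro_thinning (alpha p) \<delta> a b z (loc (MBS i) w)" for i
      using macro_thinning_bounds[OF assms] by simp
    ultimately have "inf_prod (\<lambda>i. 1 - macro_thinning (alpha p) \<delta> a b z (loc (MBS i) w)) = 0"
      using inf_prod_le[where a = "\<lambda>i. 1 - macro_thinning (alpha p) \<delta> a b z (loc (MBS i) w)" and m = "Suc i", OF nn]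
        inf_prod_bounds(1)[where a = "\<lambda>i. 1 - macro_thinning (alpha p) \<delta> a b z (loc (MBS i) w)", OF nn] by linarith
    then show ?thesis by simp
  qed (use False in simp)
qed

lemma thinned_survival_measurable [measurable]: "0 \<le> \<delta> \<Longrightarrow> thinned_survival \<delta> a b z \<in> borel_measurable M"
  unfolding thinned_survival_def[abs_def]
  by (intro borel_measurable_times borel_measurable_const borel_measurable_inf_prod)
     (auto simp: macro_thinning_bounds helper_bounds)

lemma thinned_survival_bounds: "0 \<le> \<delta> \<Longrightarrow> 0 \<le> thinned_survival \<delta> a b z w"
  "0 \<le> \<delta> \<Longrightarrow> 0 \<le> z \<Longrightarrow> thinned_survival \<delta> a b z w \<le> 1"
  unfolding thinned_survival_def using valid
  by (auto intro!: mult_nonneg_nonneg inf_prod_bounds mult_le_one simp: macro_thinning_bounds helper_bounds)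

text \<open>Macro and helper locations are independent, so the mean splits. In the macro factor the
  ring count is carried along as the test function of the Laplace functional, and a Poisson count
  with mean \<open>m\<close> equals 1 with probability \<open>m * exp (- m)\<close>.\<close>

lemma expectation_thinned_survival:
  assumes \<delta>: "0 < \<delta>" and ab: "0 < a" "a < b" and z: "0 < z"
  shows "expectation (\<lambda>w. of_bool (single_macro a b w) * thinned_survival \<delta> a b z w) =
    exp (- (\<delta> * z powr alpha p / power1 p * noise p)) *
    (ring_mean a b * exp (- ring_mean a b) * exp (- (lambda1 p * (\<integral>x. macro_thinning (alpha p) \<delta> a b z x \<partial>lborel))) *
      exp (- (lambda2 p * (\<integral>x. helper_thinning p \<delta> z x \<partial>lborel))))"
proof -
  let ?X = "\<lambda>w. of_bool (single_macro a b w) * inf_prod (\<lambda>i. 1 - macro_thinning (alpha p) \<delta> a b z (loc (MBS i) w))"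
  let ?Y = "\<lambda>w. inf_prod (\<lambda>k. 1 - helper_thinning p \<delta> z (loc (Helper k) w))"
  let ?D = "cball 0 b - cball 0 a :: (real ^ 2) set"
  have D: "?D \<in> sets borel" "bounded ?D" by (auto intro: bounded_subset[OF bounded_cball])
  have \<delta>0: "0 \<le> \<delta>" using \<delta> by simp
  have X01: "0 \<le> inf_prod (\<lambda>i. 1 - macro_thinning (alpha p) \<delta> a b z (loc (MBS i) w))"
    "inf_prod (\<lambda>i. 1 - macro_thinning (alpha p) \<delta> a b z (loc (MBS i) w)) \<le> 1" for w
    by (intro inf_prod_bounds; use macro_thinning_bounds[OF \<delta>0] in simp)+
  have Y01: "0 \<le> ?Y w" "?Y w \<le> 1" for w
    by (intro inf_prod_bounds; use helper_bounds[OF \<delta>0] in simp)+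
  have X_src: "?X \<in> borel_measurable (src n {MBS_locs})"
  proof -
    note [measurable] = loc_MBS_src[OF n, of "{MBS_locs}", simplified] single_macro_src
    have "(\<lambda>w. inf_prod (\<lambda>i. 1 - macro_thinning (alpha p) \<delta> a b z (loc (MBS i) w))) \<in> borel_measurable (src n {MBS_locs})"
      by (rule borel_measurable_inf_prod) (use macro_thinning_bounds[OF \<delta>0] in auto)
    then show ?thesis by measurable
  qed
  have Y_src: "?Y \<in> borel_measurable (src n {Helper_locs})"
  proof -
    note [measurable] = loc_Helper_src[OF n, of "{Helper_locs}", simplified]
    show ?thesis by (rule borel_measurable_inf_prod) (use helper_bounds[OF \<delta>0] in auto)
  qed
  have "expectation (\<lambda>w. of_bool (single_macro a b w) * thinned_survival \<delta> a b z w) =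
     expectation (\<lambda>w. exp (- (\<delta> * z powr alpha p / power1 p * noise p)) * (?X w * ?Y w))"
    by (simp add: thinned_survival_def mult_ac)
  also have "\<dots> = exp (- (\<delta> * z powr alpha p / power1 p * noise p)) * expectation (\<lambda>w. ?X w * ?Y w)"
    by (rule Bochner_Integration.integral_mult_right_zero)
  also have "expectation (\<lambda>w. ?X w * ?Y w) = expectation ?X * expectation ?Y"
  proof (rule expectation_prod_src[OF n _ X_src _ Y_src])
    show "integrable M ?X"
      using measurable_from_src[OF n X_src] X01 by (intro integrable_const_bound[where B = 1]) auto
    show "integrable M ?Y"
      using measurable_from_src[OF n Y_src] Y01 by (intro integrable_const_bound[where B = 1]) auto
  qed simp
  also have "expectation ?Y = exp (- (lambda2 p * (\<integral>x. helper_thinning p \<delta> z x \<partial>lborel)))"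
    using valid helper_thinning_bochner[OF params \<delta> z] \<delta>0
    by (intro poisson_functional_plain[OF Helper_process]) (auto simp: has_bochner_integral_iff helper_bounds)
  also have "expectation ?X = expectation (\<lambda>w. of_bool (num_points (\<lambda>j. loc (MBS j)) ?D w = 1) *
      inf_prod (\<lambda>i. 1 - macro_thinning (alpha p) \<delta> a b z (loc (MBS i) w)))"
    unfolding single_macro_count[OF \<delta>0] ..
  also have "\<dots> = expectation (\<lambda>w. of_bool (num_points (\<lambda>j. loc (MBS j)) ?D w = 1)) *
      exp (- (lambda1 p * (\<integral>x. macro_thinning (alpha p) \<delta> a b z x \<partial>lborel)))"
    using valid \<delta> ab z
    by (intro poisson_functional[OF MBS_process _ D, where \<phi> = "\<lambda>k. of_bool (k = 1)"] macro_thinning_integrable macro_thinning_bounds)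
       (auto simp: macro_thinning_def)
  also have "expectation (\<lambda>w. of_bool (num_points (\<lambda>j. loc (MBS j)) ?D w = 1)) = ring_mean a b * exp (- ring_mean a b)"
  proof -
    have "{w \<in> space M. num_points (\<lambda>j. loc (MBS j)) ?D w = 1} \<in> events"
      using poisson_num_points_measurable[OF MBS_process D] by measurable
    then have "expectation (\<lambda>w. of_bool (num_points (\<lambda>j. loc (MBS j)) ?D w = 1)) =
        prob {w \<in> space M. num_points (\<lambda>j. loc (MBS j)) ?D w = 1}"
      by (subst Bochner_Integration.integral_cong[where g = "indicator {w \<in> space M. num_points (\<lambda>j. loc (MBS j)) ?D w = 1}"])
         (auto split: split_indicator)
    then show ?thesis
      using poisson_processD(3)[OF MBS_process D, of 1] measure_ring_real2[of a b] ab by (simp add: ring_mean_def)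
  qed
  finally show ?thesis .
qed

text \<open>The macro process supplies the summand 1 in \<open>xi1 p\<close> and in
  \<open>zeta1 p\<close>; the helper process supplies the terms with the power ratio
  \<open>\<rho>\<close>.\<close>

lemma density_exponent:
  assumes \<delta>: "0 < \<delta>" and z: "0 < z"
  shows "lambda1 p * (pi * z\<^sup>2 + pi * z\<^sup>2 * G_fun \<delta> (alpha p)) + lambda2 p * (\<integral>x. helper_thinning p \<delta> z x \<partial>lborel) =
    pi * lambda1 p * z\<^sup>2 * (xi1 p * G_fun \<delta> (alpha p) + varsigma1 p * H_fun \<delta> (alpha p) + zeta1 p)"
proof -
  let ?P1 = "power1 p powr (2 / alpha p)" and ?P2 = "power2 p powr (2 / alpha p)"
  have P1: "0 < ?P1" using valid by simp
  define \<rho> where "\<rho> = ?P2 / ?P1"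
  have P2: "?P2 = \<rho> * ?P1" using P1 by (simp add: \<rho>_def)
  have "(power2 p / power1 p) powr (2 / alpha p) = \<rho>" using valid by (simp add: powr_divide \<rho>_def)
  then have I: "(\<integral>x. helper_thinning p \<delta> z x \<partial>lborel) = pi * z\<^sup>2 * \<rho> *
      ((1 - p_Lp p) * p_active p * H_fun \<delta> (alpha p) + p_Lp p * (1 + p_active p * G_fun \<delta> (alpha p)))"
    using helper_thinning_bochner[OF params \<delta> z] by (simp add: has_bochner_integral_iff)
  have c: "xi1 p = 1 + p_active p * p_Lp p * lambda2 p * \<rho> / lambda1 p"
    "varsigma1 p = p_active p * (1 - p_Lp p) * lambda2 p * \<rho> / lambda1 p"
    "zeta1 p = 1 + p_Lp p * lambda2 p * \<rho> / lambda1 p"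
    unfolding xi1_def varsigma1_def zeta1_def P2 using P1 valid(2) by (simp_all add: field_simps)
  show ?thesis unfolding I c using valid(2) by (simp add: field_simps)
qed

text \<open>The factor \<open>exp (- ring_mean a b)\<close>, from demanding a single station in the
  ring, enlarges the empty disc from radius \<open>a\<close> to radius \<open>b\<close>, so
  evaluation at \<open>z = b\<close> is exact. At \<open>z = a\<close> the same factor compensates
  for the ring that \<open>macro_thinning\<close> spares, which leaves an upper bound.\<close>

lemma single_macro_coverage_bounds:
  assumes \<delta>: "0 < \<delta>" and ab: "0 < a" "a < b"
  shows "ring_mean a b * coverage_density \<delta> b \<le> prob {w \<in> space M. single_macro a b w \<and> cov \<delta> w}"
    and "prob {w \<in> space M. single_macro a b w \<and> cov \<delta> w} \<le> ring_mean a b * coverage_density \<delta> a"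
proof -
  have \<delta>0: "0 \<le> \<delta>" using \<delta> by simp
  have m: "0 \<le> ring_mean a b" using ab valid by (simp add: ring_mean_def power_mono)
  let ?c = "\<lambda>w. prob {w2 \<in> space M. covered p (\<lambda>s _. loc s w) fading stores active n \<delta> w2}"
  let ?E = "\<lambda>z. expectation (\<lambda>w. of_bool (single_macro a b w) * thinned_survival \<delta> a b z w)"
  let ?K = "{MBS_locs, Helper_locs}"
  have "ennreal (prob {w \<in> space M. single_macro a b w \<and> cov \<delta> w}) =
    ennreal (prob {w \<in> space M. single_macro a b w \<and> covered p (\<lambda>s _. loc s w) fading stores active n \<delta> w})"
    by (simp add: covered_cong[of "\<lambda>s _. loc s _" _ loc])
  also have "\<dots> = (\<integral>\<^sup>+w1. ennreal (prob {w2 \<in> space M. single_macro a b w1 \<and> covered p (\<lambda>s _. loc s w1) fading stores active n \<delta> w2}) \<partial>M)"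
  proof (rule prob_src[OF n, of ?K "- ?K"])
    have [measurable]: "Measurable.pred (src n ?K) (single_macro a b)"
    proof -
      note [measurable] = loc_src[OF n, of ?K, simplified]
      show ?thesis unfolding single_macro_def[abs_def] by measurable
    qed
    note [measurable] = loc_src[OF n, of ?K, simplified] fading_src[OF n, of _ "- ?K", simplified]
      stores_src[OF n, of _ "- ?K", simplified] active_src[OF n, of _ "- ?K", simplified]
    let ?N = "src n ?K \<Otimes>\<^sub>M src n (- ?K)"
    have "Measurable.pred ?N (covered p (\<lambda>s x. loc s (fst x)) (\<lambda>s x. fading s (snd x)) (\<lambda>j n x. stores j n (snd x)) (\<lambda>j x. active j (snd x)) n \<delta>)"
      by (rule pred_covered) measurable
    also have "covered p (\<lambda>s x. loc s (fst x)) (\<lambda>s x. fading s (snd x)) (\<lambda>j n x. stores j n (snd x)) (\<lambda>j x. active j (snd x)) n \<delta> =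
       (\<lambda>x. covered p (\<lambda>s _. loc s (fst x)) fading stores active n \<delta> (snd x))"
      by (rule ext, rule covered_cong) simp_all
    finally have [measurable]: "Measurable.pred ?N (\<lambda>x. covered p (\<lambda>s _. loc s (fst x)) fading stores active n \<delta> (snd x))" .
    show "Measurable.pred ?N (\<lambda>(w1, w2). single_macro a b w1 \<and> covered p (\<lambda>s _. loc s w1) fading stores active n \<delta> w2)"
      unfolding case_prod_unfold by measurable
  qed simp
  also have "\<dots> = (\<integral>\<^sup>+w. ennreal (of_bool (single_macro a b w) * ?c w) \<partial>M)"
    by (rule nn_integral_cong) simp
  finally have eq: "ennreal (prob {w \<in> space M. single_macro a b w \<and> cov \<delta> w}) = (\<integral>\<^sup>+w. ennreal (of_bool (single_macro a b w) * ?c w) \<partial>M)" .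
  have E: "(\<integral>\<^sup>+w. ennreal (of_bool (single_macro a b w) * thinned_survival \<delta> a b z w) \<partial>M) = ennreal (?E z)" if "0 \<le> z" for z
  proof (rule nn_integral_eq_integral)
    show "integrable M (\<lambda>w. of_bool (single_macro a b w) * thinned_survival \<delta> a b z w)"
      using thinned_survival_bounds[OF \<delta>0] that \<delta>0 by (intro integrable_const_bound[where B = 1]) auto
  qed (use thinned_survival_bounds[OF \<delta>0] in auto)
  have E0: "0 \<le> ?E z" for z
    using thinned_survival_bounds[OF \<delta>0] by (intro Bochner_Integration.integral_nonneg) auto
  have "ennreal (?E b) \<le> ennreal (prob {w \<in> space M. single_macro a b w \<and> cov \<delta> w})"
    unfolding eq E[of b, symmetric, OF less_imp_le[OF less_trans[OF ab]]]
    using interference_summable_AE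
  proof (intro nn_integral_mono_AE, eventually_elim)
    case (elim w)
    then show ?case using coverage_single_macro(1)[OF \<delta> ab(1)] by (auto intro!: ennreal_leI)
  qed
  then have lower: "?E b \<le> prob {w \<in> space M. single_macro a b w \<and> cov \<delta> w}" by simp
  have "ennreal (prob {w \<in> space M. single_macro a b w \<and> cov \<delta> w}) \<le> ennreal (?E a)"
    unfolding eq E[of a, symmetric, OF less_imp_le[OF ab(1)]]
    using interference_summable_AE
  proof (intro nn_integral_mono_AE, eventually_elim)
    case (elim w)
    then show ?case using coverage_single_macro(2)[OF \<delta> ab(1)] by (auto intro!: ennreal_leI)
  qed
  then have upper: "prob {w \<in> space M. single_macro a b w \<and> cov \<delta> w} \<le> ?E a" using E0 by simp
  have noise_eq: "\<delta> * z powr alpha p / power1 p * noise p = z powr alpha p * inverse (power1 p) * \<delta> * noise p" for z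
    by (simp add: field_simps)
  have b: "0 < b" using ab by simp
  have "?E b = ring_mean a b * coverage_density \<delta> b"
  proof -
    have "?E b = exp (- (\<delta> * b powr alpha p / power1 p * noise p)) * (ring_mean a b *
       exp (- (ring_mean a b + lambda1 p * (pi * a\<^sup>2 + pi * b\<^sup>2 * G_fun \<delta> (alpha p)) + lambda2 p * (\<integral>x. helper_thinning p \<delta> b x \<partial>lborel))))"
      unfolding expectation_thinned_survival[OF \<delta> ab b] macro_thinning_integral(1)[OF valid(1) \<delta> ab]
      by (simp only: exp_add[symmetric] mult.assoc minus_add_distrib[symmetric] exp_minus_inverse)
    also have "ring_mean a b + lambda1 p * (pi * a\<^sup>2 + pi * b\<^sup>2 * G_fun \<delta> (alpha p)) =
       lambda1 p * (pi * b\<^sup>2 + pi * b\<^sup>2 * G_fun \<delta> (alpha p))" by (simp add: ring_mean_def algebra_simps)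
    finally show ?thesis
      unfolding density_exponent[OF \<delta> b] coverage_density_def noise_eq by (simp only: mult.left_commute)
  qed
  with lower show "ring_mean a b * coverage_density \<delta> b \<le> prob {w \<in> space M. single_macro a b w \<and> cov \<delta> w}" by simp
  have "?E a \<le> ring_mean a b * coverage_density \<delta> a"
  proof -
    have "?E a = exp (- (\<delta> * a powr alpha p / power1 p * noise p)) * (ring_mean a b *
       exp (- (ring_mean a b + lambda1 p * (\<integral>x. macro_thinning (alpha p) \<delta> a b a x \<partial>lborel) + lambda2 p * (\<integral>x. helper_thinning p \<delta> a x \<partial>lborel))))"
      unfolding expectation_thinned_survival[OF \<delta> ab ab(1)]
      by (simp add: algebra_simps exp_add[symmetric])
    also have "\<dots> \<le> exp (- (\<delta> * a powr alpha p / power1 p * noise p)) * (ring_mean a b *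
       exp (- (lambda1 p * (pi * a\<^sup>2 + pi * a\<^sup>2 * G_fun \<delta> (alpha p)) + lambda2 p * (\<integral>x. helper_thinning p \<delta> a x \<partial>lborel))))"
    proof -
      have "lambda1 p * (pi * a\<^sup>2 + pi * a\<^sup>2 * G_fun \<delta> (alpha p) - pi * (b\<^sup>2 - a\<^sup>2)) \<le> lambda1 p * (\<integral>x. macro_thinning (alpha p) \<delta> a b a x \<partial>lborel)"
        using valid macro_thinning_integral(2)[OF valid(1) \<delta> ab] by (intro mult_left_mono) auto
      then have "lambda1 p * (pi * a\<^sup>2 + pi * a\<^sup>2 * G_fun \<delta> (alpha p)) \<le> ring_mean a b + lambda1 p * (\<integral>x. macro_thinning (alpha p) \<delta> a b a x \<partial>lborel)"
        using right_diff_distrib[of "lambda1 p" "pi * a\<^sup>2 + pi * a\<^sup>2 * G_fun \<delta> (alpha p)" "pi * (b\<^sup>2 - a\<^sup>2)"]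
        unfolding ring_mean_def by linarith
      then show ?thesis using m by (intro mult_left_mono) auto
    qed
    also have "\<dots> = ring_mean a b * coverage_density \<delta> a"
      unfolding density_exponent[OF \<delta> ab(1)] coverage_density_def noise_eq by (simp only: mult.left_commute)
    finally show ?thesis .
  qed
  with upper show "prob {w \<in> space M. single_macro a b w \<and> cov \<delta> w} \<le> ring_mean a b * coverage_density \<delta> a" by simp
qed

text \<open>Almost sure finiteness is recorded because \<open>num_points\<close> is a cardinality:
  on an infinite index set it returns 0 and would hide the two stations.\<close>

lemma ring_two_points:
  assumes ab: "0 < a" "a < b"
  defines "N \<equiv> num_points (\<lambda>j. loc (MBS j)) (cball 0 b - cball 0 a)"
  shows "prob {w \<in> space M. N w \<noteq> 0 \<and> N w \<noteq> 1} \<le> (ring_mean a b)\<^sup>2"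
    and "{w \<in> space M. N w \<noteq> 0 \<and> N w \<noteq> 1} \<in> events"
    and "AE w in M. finite {j. loc (MBS j) w \<in> cball 0 b - cball 0 a}"
proof -
  have D: "cball 0 b - cball 0 a \<in> sets (borel :: (real ^ 2) measure)" "bounded (cball 0 b - cball 0 a :: (real ^ 2) set)"
    by (auto intro: bounded_subset[OF bounded_cball])
  have [measurable]: "N \<in> measurable M (count_space UNIV)"
    unfolding N_def by (rule poisson_num_points_measurable[OF MBS_process D])
  let ?m = "ring_mean a b"
  have m: "lambda1 p * measure lborel (cball 0 b - cball 0 a :: (real ^ 2) set) = ?m"
    using ab by (simp add: measure_ring_real2 ring_mean_def)
  have m0: "0 \<le> ?m" using ab valid by (simp add: ring_mean_def power_mono)
  have "prob {w \<in> space M. N w \<noteq> 0 \<and> N w \<noteq> 1} = 1 - prob ({w \<in> space M. N w = 0} \<union> {w \<in> space M. N w = 1})"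
    by (subst prob_compl[symmetric]) (auto intro!: arg_cong[where f = prob])
  also have "prob ({w \<in> space M. N w = 0} \<union> {w \<in> space M. N w = 1}) = prob {w \<in> space M. N w = 0} + prob {w \<in> space M. N w = 1}"
    by (rule finite_measure_Union) auto
  also have "prob {w \<in> space M. N w = 0} = exp (- ?m)"
    unfolding N_def poisson_processD(3)[OF MBS_process D] m by simp
  also have "prob {w \<in> space M. N w = 1} = ?m * exp (- ?m)"
    unfolding N_def poisson_processD(3)[OF MBS_process D] m by simp
  also have "1 - (exp (- ?m) + ?m * exp (- ?m)) \<le> ?m\<^sup>2"
  proof -
    \<comment> \<open>The bound comes from \<open>exp (- m) \<ge> 1 - m\<close>, multiplied by
      \<open>1 + m\<close>.\<close>
    have "(1 + ?m) * (1 - ?m) \<le> (1 + ?m) * exp (- ?m)"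
      using m0 exp_ge_add_one_self[of "- ?m"] by (intro mult_left_mono) auto
    then show ?thesis by (simp add: algebra_simps power2_eq_square)
  qed
  finally show "prob {w \<in> space M. N w \<noteq> 0 \<and> N w \<noteq> 1} \<le> ?m\<^sup>2" .
  show "{w \<in> space M. N w \<noteq> 0 \<and> N w \<noteq> 1} \<in> events" by measurable
  show "AE w in M. finite {j. loc (MBS j) w \<in> cball 0 b - cball 0 a}"
    by (rule poisson_processD(2)[OF MBS_process D])
qed

section \<open>Differentiation of the coverage probability in the radius\<close>

definition coverage_within :: "real \<Rightarrow> real \<Rightarrow> real" where
  "coverage_within \<delta> r = prob {w \<in> space M. cov \<delta> w \<and> (\<exists>i. norm (loc (MBS i) w) \<le> r)}"

text \<open>The increment is the probability \<open>prob ?D\<close> that the user is covered while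
  the ring, but not the inner disc, contains a macro station. \<open>?D\<close> contains the event
  with a single station and exceeds it only if the ring holds at least two.\<close>

lemma coverage_within_increment:
  assumes \<delta>: "0 < \<delta>" and ab: "0 < a" "a < b"
  shows "ring_mean a b * coverage_density \<delta> b \<le> coverage_within \<delta> b - coverage_within \<delta> a"
    and "coverage_within \<delta> b - coverage_within \<delta> a \<le> ring_mean a b * coverage_density \<delta> a + (ring_mean a b)\<^sup>2"
proof -
  let ?N = "num_points (\<lambda>j. loc (MBS j)) (cball 0 b - cball 0 a)"
  let ?D = "{w \<in> space M. cov \<delta> w \<and> (\<exists>i. norm (loc (MBS i) w) \<le> b) \<and> (\<forall>i. a < norm (loc (MBS i) w))}"
  let ?S = "{w \<in> space M. single_macro a b w \<and> cov \<delta> w}"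
  let ?B = "{w \<in> space M. ?N w \<noteq> 0 \<and> ?N w \<noteq> 1}"
  have D [measurable]: "?D \<in> events" by measurable
  have S [measurable]: "?S \<in> events" by measurable
  have B [measurable]: "?B \<in> events" by (rule ring_two_points(2)[OF ab])
  have "coverage_within \<delta> b = prob ({w \<in> space M. cov \<delta> w \<and> (\<exists>i. norm (loc (MBS i) w) \<le> a)} \<union> ?D)"
  proof -
    have "x \<le> a \<Longrightarrow> x \<le> b" for x using ab by linarith
    then show ?thesis
      unfolding coverage_within_def by (intro arg_cong[where f = prob]) (auto simp: not_less)
  qed
  also have "\<dots> = coverage_within \<delta> a + prob ?D"
    unfolding coverage_within_def
  proof (rule finite_measure_Union)
    show "{w \<in> space M. cov \<delta> w \<and> (\<exists>i. norm (loc (MBS i) w) \<le> a)} \<inter> ?D = {}"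
      by (auto dest!: leD)
  qed measurable
  finally have diff: "coverage_within \<delta> b - coverage_within \<delta> a = prob ?D" by simp
  have "prob ?S \<le> prob ?D"
  proof (rule finite_measure_mono[OF _ D], rule subsetI)
    fix w assume w: "w \<in> ?S"
    then obtain j where j: "a < norm (loc (MBS j) w)" "norm (loc (MBS j) w) \<le> b" "\<And>i. i \<noteq> j \<Longrightarrow> b < norm (loc (MBS i) w)"
      by (auto simp: single_macro_def)
    have "a < norm (loc (MBS i) w)" for i
      using j(1) j(3)[of i] ab by (cases "i = j") auto
    with w j(2) show "w \<in> ?D" by auto
  qed
  then show "ring_mean a b * coverage_density \<delta> b \<le> coverage_within \<delta> b - coverage_within \<delta> a"
    unfolding diff using single_macro_coverage_bounds(1)[OF \<delta> ab] by simp
  have "prob ?D \<le> prob (?S \<union> ?B)"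
  proof (rule finite_measure_mono_AE)
    show "AE w in M. w \<in> ?D \<longrightarrow> w \<in> ?S \<union> ?B"
      using ring_two_points(3)[OF ab]
    proof eventually_elim
      case (elim w)
      show ?case
      proof
        assume w: "w \<in> ?D"
        then obtain i where i: "norm (loc (MBS i) w) \<le> b" by auto
        have a: "a < norm (loc (MBS k) w)" for k using w by auto
        show "w \<in> ?S \<union> ?B"
        proof (cases "\<forall>k. k \<noteq> i \<longrightarrow> b < norm (loc (MBS k) w)")
          case True
          then have "single_macro a b w" using i a by (auto simp: single_macro_def)
          then show ?thesis using w by auto
        next
          case False
          then obtain k where k: "k \<noteq> i" "norm (loc (MBS k) w) \<le> b" by (auto simp: not_less)
          have "{i, k} \<subseteq> {j. loc (MBS j) w \<in> cball 0 b - cball 0 a}"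
            using i k a[of i] a[of k] by auto
          then have "card {i, k} \<le> ?N w" unfolding num_points_def using elim by (intro card_mono)
          then have "2 \<le> ?N w" using k by simp
          then show ?thesis using w by auto
        qed
      qed
    qed
  qed measurable
  also have "\<dots> \<le> prob ?S + prob ?B" by (rule measure_Un_le[OF S B])
  finally show "coverage_within \<delta> b - coverage_within \<delta> a \<le> ring_mean a b * coverage_density \<delta> a + (ring_mean a b)\<^sup>2"
    unfolding diff using single_macro_coverage_bounds(2)[OF \<delta> ab] ring_two_points(1)[OF ab] by simp
qed

lemma isCont_coverage_density: "0 < z \<Longrightarrow> isCont (coverage_density \<delta>) z"
  unfolding coverage_density_def[abs_def] by (intro continuous_intros) auto

text \<open>The increment bounds are used with \<open>z\<close> as inner radius for the right limit
  and as outer radius for the left limit. The squared ring mean is of second order in the width, and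
  continuity of \<open>coverage_density\<close> handles the bound evaluated at the moving
  endpoint.\<close>

lemma coverage_within_deriv:
  assumes \<delta>: "0 < \<delta>" and z: "0 < z"
  shows "(coverage_within \<delta> has_real_derivative 2 * pi * lambda1 p * z * coverage_density \<delta> z) (at z)"
proof -
  let ?T = "coverage_within \<delta>" and ?L = "coverage_density \<delta>"
  let ?k = "pi * lambda1 p"
  have ring: "ring_mean a b = (?k * (a + b)) * (b - a)" for a b
    by (simp add: ring_mean_def power2_eq_square algebra_simps)
  have alg: "X * d * l + (X * d)\<^sup>2 = (X * l + X\<^sup>2 * d) * d" for X d l :: real
    by (simp add: power2_eq_square algebra_simps)
  have L: "(?L \<longlongrightarrow> ?L z) (at z)" using isCont_coverage_density[OF z] by (simp add: isCont_def)
  have R: "((\<lambda>y. (?T y - ?T z) / (y - z)) \<longlongrightarrow> ?k * (z + z) * ?L z) (at_right z)"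
  proof (rule tendsto_sandwich)
    have "(?L \<longlongrightarrow> ?L z) (at_right z)" by (rule tendsto_mono[OF at_le[OF subset_UNIV] L])
    then show "((\<lambda>y. ?k * (z + y) * ?L y) \<longlongrightarrow> ?k * (z + z) * ?L z) (at_right z)"
      by (intro tendsto_intros)
    have "((\<lambda>y. ?k * (z + y) * ?L z + (?k * (z + y))\<^sup>2 * (y - z)) \<longlongrightarrow> ?k * (z + z) * ?L z + (?k * (z + z))\<^sup>2 * (z - z)) (at_right z)"
      by (intro tendsto_intros)
    then show "((\<lambda>y. ?k * (z + y) * ?L z + (?k * (z + y))\<^sup>2 * (y - z)) \<longlongrightarrow> ?k * (z + z) * ?L z) (at_right z)"
      by simp
    have ev: "eventually (\<lambda>y. z < y) (at_right z)" by (simp add: eventually_at_filter)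
    show "eventually (\<lambda>y. ?k * (z + y) * ?L y \<le> (?T y - ?T z) / (y - z)) (at_right z)"
      using ev
    proof eventually_elim
      case (elim y)
      then show ?case using coverage_within_increment(1)[OF \<delta> z elim] unfolding ring
        by (simp add: pos_le_divide_eq mult_ac)
    qed
    show "eventually (\<lambda>y. (?T y - ?T z) / (y - z) \<le> ?k * (z + y) * ?L z + (?k * (z + y))\<^sup>2 * (y - z)) (at_right z)"
      using ev
    proof eventually_elim
      case (elim y)
      then show ?case using coverage_within_increment(2)[OF \<delta> z elim] unfolding ring alg
        by (subst pos_divide_le_eq) simp_all
    qed
  qed
  have Lf: "((\<lambda>y. (?T y - ?T z) / (y - z)) \<longlongrightarrow> ?k * (z + z) * ?L z) (at_left z)"
  proof (rule tendsto_sandwich)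
    show "((\<lambda>y. ?k * (y + z) * ?L z) \<longlongrightarrow> ?k * (z + z) * ?L z) (at_left z)"
      by (intro tendsto_intros)
    have "(?L \<longlongrightarrow> ?L z) (at_left z)" by (rule tendsto_mono[OF at_le[OF subset_UNIV] L])
    then have "((\<lambda>y. ?k * (y + z) * ?L y + (?k * (y + z))\<^sup>2 * (z - y)) \<longlongrightarrow> ?k * (z + z) * ?L z + (?k * (z + z))\<^sup>2 * (z - z)) (at_left z)"
      by (intro tendsto_intros)
    then show "((\<lambda>y. ?k * (y + z) * ?L y + (?k * (y + z))\<^sup>2 * (z - y)) \<longlongrightarrow> ?k * (z + z) * ?L z) (at_left z)"
      by simp
    have ev: "eventually (\<lambda>y. 0 < y \<and> y < z) (at_left z)"
      using z by (auto simp: eventually_at_left_field intro!: exI[of _ 0])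
    have flip: "(?T y - ?T z) / (y - z) = (?T z - ?T y) / (z - y)" for y
      by (metis minus_diff_eq minus_divide_divide)
    show "eventually (\<lambda>y. ?k * (y + z) * ?L z \<le> (?T y - ?T z) / (y - z)) (at_left z)"
      using ev
    proof eventually_elim
      case (elim y)
      then show ?case using coverage_within_increment(1)[OF \<delta>, of y z] unfolding ring flip[of y]
        by (simp add: pos_le_divide_eq mult_ac)
    qed
    show "eventually (\<lambda>y. (?T y - ?T z) / (y - z) \<le> ?k * (y + z) * ?L y + (?k * (y + z))\<^sup>2 * (z - y)) (at_left z)"
      using ev
    proof eventually_elim
      case (elim y)
      then show ?case using coverage_within_increment(2)[OF \<delta>, of y z] unfolding ring flip[of y] alg
        by (subst pos_divide_le_eq) simp_all
    qed
  qed
  have "((\<lambda>y. (?T y - ?T z) / (y - z)) \<longlongrightarrow> ?k * (z + z) * ?L z) (at z)"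
    using Lf R by (simp add: filterlim_split_at)
  then show ?thesis by (simp add: has_field_derivative_iff mult_ac)
qed

text \<open>The boundary value at 0 is 0, since a small disc is likely to contain no macro station;
  at infinity the radius restriction disappears. Nonnegativity of the derivative lets the
  fundamental theorem yield integrability as well.\<close>

lemma coverage_integral:
  assumes \<delta>: "0 < \<delta>"
  shows "set_integrable lborel {0<..} (\<lambda>z. 2 * pi * lambda1 p * z * coverage_density \<delta> z)"
    and "prob {w \<in> space M. cov \<delta> w} = (LBINT z:{0<..}. 2 * pi * lambda1 p * z * coverage_density \<delta> z)"
proof -
  let ?f = "\<lambda>z. 2 * pi * lambda1 p * z * coverage_density \<delta> z" and ?T = "coverage_within \<delta>"
  have ei: "einterval 0 \<infinity> = {0<..}" by (auto simp: einterval_def)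
  have T0: "(?T \<longlongrightarrow> 0) (at_right 0)"
  proof (rule tendsto_sandwich)
    show "eventually (\<lambda>r. 0 \<le> ?T r) (at_right 0)" by (simp add: coverage_within_def)
    show "eventually (\<lambda>r. ?T r \<le> 1 - exp (- (lambda1 p * (pi * r\<^sup>2)))) (at_right 0)"
    proof -
      have "?T r \<le> 1 - exp (- (lambda1 p * (pi * r\<^sup>2)))" if r: "0 < r" for r
      proof -
        have D: "cball 0 r \<in> sets (borel :: (real ^ 2) measure)" "bounded (cball 0 r :: (real ^ 2) set)" by auto
        let ?N = "num_points (\<lambda>j. loc (MBS j)) (cball 0 r)"
        have N [measurable]: "?N \<in> measurable M (count_space UNIV)" by (rule poisson_num_points_measurable[OF MBS_process D])
        have "?T r \<le> prob (space M - {w \<in> space M. ?N w = 0})"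
          unfolding coverage_within_def
        proof (rule finite_measure_mono_AE)
          show "AE w in M. w \<in> {w \<in> space M. cov \<delta> w \<and> (\<exists>i. norm (loc (MBS i) w) \<le> r)} \<longrightarrow> w \<in> space M - {w \<in> space M. ?N w = 0}"
            using poisson_processD(2)[OF MBS_process D]
            by eventually_elim (auto simp: num_points_def)
        qed measurable
        also have "\<dots> = 1 - prob {w \<in> space M. ?N w = 0}" by (rule prob_compl) measurable
        also have "prob {w \<in> space M. ?N w = 0} = exp (- (lambda1 p * (pi * r\<^sup>2)))"
          using r poisson_processD(3)[OF MBS_process D, of 0] by (simp add: measure_disc_real2)
        finally show ?thesis .
      qed
      then show ?thesis by (simp add: eventually_at_filter)
    qed
    have "((\<lambda>r. 1 - exp (- (lambda1 p * (pi * r\<^sup>2)))) \<longlongrightarrow> 1 - exp (- (lambda1 p * (pi * 0\<^sup>2)))) (at_right 0)"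
      by (intro tendsto_intros)
    then show "((\<lambda>r. 1 - exp (- (lambda1 p * (pi * r\<^sup>2)))) \<longlongrightarrow> 0) (at_right 0)" by simp
  qed simp
  have Tinf: "(?T \<longlongrightarrow> prob {w \<in> space M. cov \<delta> w}) at_top"
  proof -
    have "((\<lambda>r. expectation (indicat_real {w \<in> space M. cov \<delta> w \<and> (\<exists>i. norm (loc (MBS i) w) \<le> r)})) \<longlongrightarrow>
        expectation (indicat_real {w \<in> space M. cov \<delta> w})) at_top"
    proof (rule integral_dominated_convergence_at_top[where w = "\<lambda>_. 1"])
      show "AE w in M. ((\<lambda>r. indicat_real {w \<in> space M. cov \<delta> w \<and> (\<exists>i. norm (loc (MBS i) w) \<le> r)} w) \<longlongrightarrow>
          indicat_real {w \<in> space M. cov \<delta> w} w) at_top"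
      proof (rule AE_I2, rule tendsto_eventually)
        fix w
        show "eventually (\<lambda>r. indicat_real {w \<in> space M. cov \<delta> w \<and> (\<exists>i. norm (loc (MBS i) w) \<le> r)} w =
            indicat_real {w \<in> space M. cov \<delta> w} w) at_top"
          \<comment> \<open>Once \<open>r\<close> exceeds the distance of the station with index 0,
            some macro station lies within \<open>r\<close>.\<close>
          using eventually_ge_at_top[of "norm (loc (MBS 0) w)"]
          by eventually_elim (auto split: split_indicator)
      qed
    qed (auto split: split_indicator)
    then show ?thesis by (simp add: coverage_within_def[abs_def])
  qed
  have nonneg: "0 \<le> ?f z" if "0 < z" for z
    using that valid by (simp add: coverage_density_def)
  have F: "\<And>x. 0 < ereal x \<Longrightarrow> ereal x < \<infinity> \<Longrightarrow> DERIV ?T x :> ?f x"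
    using coverage_within_deriv[OF \<delta>] by simp
  have C: "\<And>x. 0 < ereal x \<Longrightarrow> ereal x < \<infinity> \<Longrightarrow> isCont ?f x"
    by (intro continuous_intros isCont_coverage_density) simp_all
  have A: "((?T \<circ> real_of_ereal) \<longlongrightarrow> 0) (at_right 0)"
    using T0 by (simp add: zero_ereal_def ereal_tendsto_simps)
  have B: "((?T \<circ> real_of_ereal) \<longlongrightarrow> prob {w \<in> space M. cov \<delta> w}) (at_left \<infinity>)"
    using Tinf by (simp add: ereal_tendsto_simps)
  have "AE x in lborel. 0 < ereal x \<longrightarrow> ereal x < \<infinity> \<longrightarrow> 0 \<le> ?f x"
    using nonneg by (intro AE_I2) simp
  note FTC = interval_integral_FTC_nonneg[OF _ F C this A B]
  show "set_integrable lborel {0<..} ?f" using FTC(1) unfolding ei by simp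
  have "(LBINT z=0..\<infinity>. ?f z) = prob {w \<in> space M. cov \<delta> w}" using FTC(2) by simp
  then show "prob {w \<in> space M. cov \<delta> w} = (LBINT z:{0<..}. ?f z)"
    by (simp add: interval_lebesgue_integral_def ei)
qed

section \<open>Averaging over the load of the serving station\<close>

lemma access_success1_eq_suminf:
  "(\<lambda>l. load1_law p l * prob {w \<in> space M. cov (delta1 p l) w}) sums access_success1 M p loc fading stores active load1 n"
proof -
  let ?E = "\<lambda>l. {w \<in> space M. load1 w = l + 1 \<and> cov (delta1 p l) w}"
  let ?A = "{w \<in> space M. \<exists>j. is_serving p loc stores n w (MBS j) \<and> rate_req p \<le> access_rate1 p loc fading active load1 w (MBS j)}"
  have [measurable]: "Measurable.pred M (\<lambda>w. is_serving p loc stores n w s)" for s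
    by (rule pred_is_serving) auto
  have [measurable]: "(\<lambda>w. SINR p loc fading active w s) \<in> borel_measurable M" for s
    by (rule measurable_SINR) auto
  have A: "?A \<in> events" unfolding access_rate1_def by measurable
  have E: "prob (?E l) = load1_law p l * prob {w \<in> space M. cov (delta1 p l) w}" for l
  proof -
    let ?a = "\<lambda>w. of_bool (load1 w = l + 1) :: real" and ?b = "\<lambda>w. of_bool (cov (delta1 p l) w) :: real"
    have a: "?a \<in> borel_measurable (src n {Load})"
      using load1_src[OF n, of "{Load}"] by simp
    have b: "?b \<in> borel_measurable (src n (- {Load}))"
    proof -
      have "Measurable.pred (src n (- {Load})) (cov (delta1 p l))"
        by (rule pred_covered) (auto intro: loc_src[OF n] fading_src[OF n] stores_src[OF n] active_src[OF n])
      then show ?thesis by simp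
    qed
    have ind: "prob {w \<in> space M. P w} = expectation (\<lambda>w. of_bool (P w))" if [measurable]: "Measurable.pred M P" for P
      by (subst Bochner_Integration.integral_cong[where g = "indicator {w \<in> space M. P w}"]) (auto split: split_indicator)
    have "expectation (\<lambda>w. ?a w * ?b w) = expectation ?a * expectation ?b"
      by (rule expectation_prod_src[OF n _ a _ b]) (auto intro!: integrable_const_bound[where B = 1])
    then show ?thesis
      using load1_law[of l] by (simp add: ind of_bool_conj)
  qed
  have "(\<lambda>l. prob (?E l)) sums prob (\<Union>l. ?E l)"
    by (rule finite_measure_UNION) (auto simp: disjoint_family_on_def)
  also have "prob (\<Union>l. ?E l) = prob ?A"
  proof (rule finite_measure_eq_AE)
    show "AE w in M. (w \<in> (\<Union>l. ?E l)) = (w \<in> ?A)"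
      using fading_pos_AE[OF n]
    proof eventually_elim
      case (elim w)
      \<comment> \<open>Nonnegativity of the SINR is prepared here, because solving the rate
        condition for the SINR inverts \<open>log 2\<close> at \<open>1 + SINR\<close>, which must
        be positive.\<close>
      have mp: "0 \<le> mean_rx_power p loc s w" for s
        using valid by (cases s) (auto simp: mean_rx_power_def)
      have "0 \<le> interference p loc fading active w s" for s
        unfolding interference_def using elim mp by (intro infsum_nonneg mult_nonneg_nonneg) (auto intro: less_imp_le)
      then have sinr: "0 \<le> SINR p loc fading active w s" for s
        unfolding SINR_def using elim mp valid by (intro divide_nonneg_nonneg mult_nonneg_nonneg add_nonneg_nonneg) (auto intro: less_imp_le)
      have rate: "rate_req p \<le> access_rate1 p loc fading active load1 w s \<longleftrightarrow> (\<exists>l. load1 w = l + 1 \<and> delta1 p l \<le> SINR p loc fading active w s)" for s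
      proof (cases "load1 w")
        case 0
        \<comment> \<open>Load 0 is not of the form \<open>l + 1\<close>; division by 0 gives it
          rate 0, which misses the positive requirement, so both sides are false.\<close>
        then show ?thesis using valid by (simp add: access_rate1_def)
      next
        case (Suc l)
        let ?S = "SINR p loc fading active w s"
        have "rate_req p \<le> access_rate1 p loc fading active load1 w s \<longleftrightarrow> real (l + 1) * rate_req p / bandwidth p \<le> log 2 (1 + ?S)"
          using valid Suc by (simp add: access_rate1_def field_simps)
        also have "\<dots> \<longleftrightarrow> 2 powr (real (l + 1) * rate_req p / bandwidth p) \<le> 1 + ?S"
          using sinr[of s] by (simp add: le_log_iff)
        finally show ?thesis using Suc by (auto simp: delta1_def)
      qed
      show ?case by (auto simp: rate covered_def)
    qed
  qed (use A in measurable)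
  also have "prob ?A = access_success1 M p loc fading stores active load1 n"
    by (simp add: access_success1_def)
  finally show ?thesis unfolding E .
qed

text \<open>All terms are nonnegative and their integrals form a convergent series, by the
  decomposition along the load; so sum and integral may be exchanged, and the series converges at
  almost every \<open>z\<close>.\<close>

lemma access_success1_integral:
  "access_success1 M p loc fading stores active load1 n =
    (LBINT z:{0<..}. (\<Sum>l. 2 * pi * lambda1 p * z * coverage_density (delta1 p l) z * load1_law p l))"
proof -
  let ?f = "\<lambda>l z. indicator {0<..} z * (2 * pi * lambda1 p * z * coverage_density (delta1 p l) z * load1_law p l)"
  have \<delta>: "0 < delta1 p l" for l
    using valid by (simp add: delta1_def)
  have law: "0 \<le> load1_law p l" "(\<Sum>l<m. load1_law p l) \<le> 1" for l m
  proof -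
    show "0 \<le> load1_law p l" using load1_law[of l] by (metis measure_nonneg)
    have "(\<Sum>l<m. load1_law p l) = prob (\<Union>l<m. {w \<in> space M. load1 w = l + 1})"
      unfolding load1_law[symmetric] by (subst finite_measure_finite_Union) (auto simp: disjoint_family_on_def)
    then show "(\<Sum>l<m. load1_law p l) \<le> 1" by simp
  qed
  have law_sum: "summable (load1_law p)"
    by (rule summableI_nonneg_bounded[where x = 1]) (use law in auto)
  have f_nonneg: "0 \<le> ?f l z" for l z
    using law valid by (auto simp: coverage_density_def split: split_indicator)
  have f_int: "integrable lborel (?f l)" for l
    using set_integrable_mult_left[of "load1_law p l", OF coverage_integral(1)[OF \<delta>[of l]]] by (simp add: set_integrable_def)
  have f_val: "(\<integral>z. ?f l z \<partial>lborel) = load1_law p l * prob {w \<in> space M. cov (delta1 p l) w}" for l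
    using coverage_integral(2)[OF \<delta>[of l]] by (simp add: set_lebesgue_integral_def mult.assoc[symmetric])
  have "(\<integral>z. (\<Sum>l. ?f l z) \<partial>lborel) = (\<Sum>l. \<integral>z. ?f l z \<partial>lborel)"
  proof (rule integral_suminf[OF f_int])
    show "summable (\<lambda>l. \<integral>z. norm (?f l z) \<partial>lborel)"
      using f_nonneg sums_summable[OF access_success1_eq_suminf] by (simp add: f_val abs_of_nonneg)
    show "AE z in lborel. summable (\<lambda>l. norm (?f l z))"
    proof -
      have "(\<integral>\<^sup>+z. (\<Sum>l. ennreal (?f l z)) \<partial>lborel) = (\<Sum>l. \<integral>\<^sup>+z. ennreal (?f l z) \<partial>lborel)"
        using f_int by (intro nn_integral_suminf) auto
      also have "\<dots> = (\<Sum>l. ennreal (load1_law p l * prob {w \<in> space M. cov (delta1 p l) w}))"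
        using f_int f_nonneg by (intro suminf_cong) (subst nn_integral_eq_integral, auto simp: f_val)
      also have "\<dots> < \<infinity>"
        using sums_summable[OF access_success1_eq_suminf] law by (subst suminf_ennreal2) (auto simp: less_top[symmetric])
      finally have "AE z in lborel. (\<Sum>l. ennreal (?f l z)) \<noteq> \<infinity>"
        using f_int by (intro nn_integral_PInf_AE) auto
      then show ?thesis
      proof (rule eventually_mono)
        fix z assume "(\<Sum>l. ennreal (?f l z)) \<noteq> \<infinity>"
        then have "summable (\<lambda>l. ?f l z)" by (intro summable_suminf_not_top f_nonneg) auto
        then show "summable (\<lambda>l. norm (?f l z))"
          by (simp only: real_norm_def abs_of_nonneg[OF f_nonneg])
      qed
    qed
  qed
  also have "\<dots> = access_success1 M p loc fading stores active load1 n"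
    unfolding f_val by (rule sums_unique[OF access_success1_eq_suminf, symmetric])
  finally have "access_success1 M p loc fading stores active load1 n = (\<integral>z. (\<Sum>l. ?f l z) \<partial>lborel)" ..
  also have "\<dots> = (LBINT z:{0<..}. (\<Sum>l. 2 * pi * lambda1 p * z * coverage_density (delta1 p l) z * load1_law p l))"
    unfolding set_lebesgue_integral_def
  proof (rule Bochner_Integration.integral_cong)
    show "(\<Sum>l. ?f l z) = indicator {0<..} z *\<^sub>R (\<Sum>l. 2 * pi * lambda1 p * z * coverage_density (delta1 p l) z * load1_law p l)" for z
      by (cases "0 < z") simp_all
  qed simp
  finally show ?thesis .
qed

end
end

theorem lemma4:
  fixes M :: "'w measure"
    and p :: net_params
    and loc :: "station \<Rightarrow> 'w \<Rightarrow> real ^ 2"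
    and fading :: "station \<Rightarrow> 'w \<Rightarrow> real"
    and stores :: "nat \<Rightarrow> nat \<Rightarrow> 'w \<Rightarrow> bool"
    and active :: "nat \<Rightarrow> 'w \<Rightarrow> bool"
    and load1 :: "'w \<Rightarrow> nat"
    and n :: nat
  assumes "cache_network M p loc fading stores active load1"
    and "n \<in> second_group p"
  shows "access_success1 M p loc fading stores active load1 n =
    (LBINT z:{0<..}. (\<Sum>l. 2 * pi * lambda1 p * z
        * exp (- (z powr alpha p * inverse (power1 p) * delta1 p l * noise p))
        * exp (- (pi * lambda1 p * z\<^sup>2 *
            (xi1 p * G_fun (delta1 p l) (alpha p)
             + varsigma1 p * H_fun (delta1 p l) (alpha p)
             + zeta1 p)))
        * load1_law p l))"
proof -
  interpret cache_network M p loc fading stores active load1 by fact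
  show ?thesis
    unfolding access_success1_integral[OF assms(2)] coverage_density_def by (simp only: mult.assoc)
qed

end
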